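(* Consider the time-optimal problem described in the context with $\Omega$ strictly convex. Then for every $\alpha$ the rotated set $\tilde\Omega=e^{\mathbf{i}\alpha}\Omega$ satisfies $\tilde\theta_1\equiv\tilde\theta_2\pmod{2\mathbb{S}}$ and $\tilde\theta_3\equiv\tilde\theta_4\pmod{2\mathbb{S}}$. An optimal control $u_2$ is a piecewise constant function with values $u_2^1,u_2^2,\dots,u_2^n$ on consecutive time intervals of lengths $T^1,T^2,\dots,T^n$, and it is of one of the following two types: (a) $u_2^{2k}=0$ and $u_2^{2k+1}\in\{-1,1\}$ for $k\in\mathbb{N}$; the lengths $T^{2k}$ are arbitrary, $T^1\le2\mathbb{S}$, $T^n\le2\mathbb{S}$, and $T^{2k+1}=2\mathbb{S}$ for $k\neq0$, $2k+1\neq n$; (b) $u_2^{2k}=\pm1$, $u_2^{2k+1}=\mp1$ for $k\in\mathbb{N}$; $T^2=T^3=\dots=T^{n-1}=\hat T\le2\mathbb{S}$, $T^1\le\hat T$, $T^n\le\hat T$.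
   Context: Let $\Omega\subset\mathbb{R}^2$ be a convex compact set with $0\in\operatorname{int}\Omega$ and area $\mathbb{S}$. For $\theta\in[0,2\mathbb{S})$, $(\cos_\Omega\theta,\sin_\Omega\theta)$ is the point of $\partial\Omega$ such that the area of the sector of $\Omega$ between the positive $x$-axis and the ray through this point (counterclockwise) is $\theta/2$; extended $2\mathbb{S}$-periodically. The problem ($\Omega$-modified Markov–Dubins problem): $\dot x=\cos_\Omega\theta$, $\dot y=\sin_\Omega\theta$, $\dot\theta=u_2$, $|u_2|\le1$, $(x,y,\theta)\in\mathbb{R}^2\times\mathbb{R}/2\mathbb{S}\mathbb{Z}$, with fixed endpoints $q(0)=(0,0,\theta_0)$, $q(T)=q_1$, and $T\to\min$. For an angle $\alpha$, $e^{\mathbf{i}\alpha}$ denotes the clockwise rotation of $\mathbb{R}^2$ by $\alpha$ about the origin and $\tilde\Omega=e^{\mathbf{i}\alpha}\Omega$ (also of area $\mathbb{S}$). Let $m_1<0<m_2$ be the minimal and maximal values of $\cos_{\tilde\Omega}$, and let $[\tilde\theta_1,\tilde\theta_2]$ and $[\tilde\theta_3,\tilde\theta_4]$ (modulo $2\mathbb{S}$) be the sets of angles where $\cos_{\tilde\Omega}$ equals $m_1$ and $m_2$ respectively. *)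

theory Defs
  imports "HOL-Analysis.Analysis"
begin

definition strictly_convex_set :: "complex set \<Rightarrow> bool" where
  "strictly_convex_set S \<longleftrightarrow> convex S \<and>
     (\<forall>x\<in>S. \<forall>y\<in>S. x \<noteq> y \<longrightarrow>
        (\<forall>u::real. 0 < u \<and> u < 1 \<longrightarrow> (1 - u) *\<^sub>R x + u *\<^sub>R y \<in> interior S))"

definition area :: "complex set \<Rightarrow> real" where
  "area \<Omega> = measure lebesgue \<Omega>"

definition sector :: "complex set \<Rightarrow> real \<Rightarrow> complex set" where
  "sector \<Omega> \<phi> = {z \<in> \<Omega>. \<exists>r t. 0 \<le> r \<and> 0 \<le> t \<and> t \<le> \<phi> \<and> z = of_real r * cis t}"

text \<open>The point (cos_Omega theta, sin_Omega theta) of the boundary, extended 2S-periodically.\<close>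
definition gen_pt :: "complex set \<Rightarrow> real \<Rightarrow> complex" where
  "gen_pt \<Omega> \<theta> = (THE p. p \<in> frontier \<Omega> \<and>
     (\<exists>\<phi> r. 0 \<le> \<phi> \<and> \<phi> < 2 * pi \<and> 0 < r \<and> p = of_real r * cis \<phi> \<and>
        2 * measure lebesgue (sector \<Omega> \<phi>) =
          \<theta> - 2 * area \<Omega> * of_int \<lfloor>\<theta> / (2 * area \<Omega>)\<rfloor>))"

definition cos_gen :: "complex set \<Rightarrow> real \<Rightarrow> real" where
  "cos_gen \<Omega> \<theta> = Re (gen_pt \<Omega> \<theta>)"

definition sin_gen :: "complex set \<Rightarrow> real \<Rightarrow> real" where
  "sin_gen \<Omega> \<theta> = Im (gen_pt \<Omega> \<theta>)"

definition rot :: "real \<Rightarrow> complex set \<Rightarrow> complex set" where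
  "rot \<alpha> \<Omega> = (\<lambda>z. cis (- \<alpha>) * z) ` \<Omega>"

text \<open>Control system: theta' = u, x' + i y' = cos_Omega theta + i sin_Omega theta,
  starting at (0,0,theta0).\<close>
definition admissible :: "real \<Rightarrow> (real \<Rightarrow> real) \<Rightarrow> bool" where
  "admissible T u \<longleftrightarrow> 0 \<le> T \<and> u integrable_on {0..T} \<and> (\<forall>t\<in>{0..T}. \<bar>u t\<bar> \<le> 1)"

definition heading :: "real \<Rightarrow> (real \<Rightarrow> real) \<Rightarrow> real \<Rightarrow> real" where
  "heading \<theta>0 u t = \<theta>0 + integral {0..t} u"

definition position :: "complex set \<Rightarrow> real \<Rightarrow> (real \<Rightarrow> real) \<Rightarrow> real \<Rightarrow> complex" where
  "position \<Omega> \<theta>0 u t =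
     integral {0..t} (\<lambda>s. Complex (cos_gen \<Omega> (heading \<theta>0 u s)) (sin_gen \<Omega> (heading \<theta>0 u s)))"

definition reaches :: "complex set \<Rightarrow> real \<Rightarrow> complex \<Rightarrow> real \<Rightarrow> (real \<Rightarrow> real) \<Rightarrow> real \<Rightarrow> bool" where
  "reaches \<Omega> \<theta>0 p1 \<theta>1 u T \<longleftrightarrow> position \<Omega> \<theta>0 u T = p1 \<and>
     (\<exists>k::int. heading \<theta>0 u T = \<theta>1 + 2 * area \<Omega> * of_int k)"

definition time_optimal :: "complex set \<Rightarrow> real \<Rightarrow> complex \<Rightarrow> real \<Rightarrow> (real \<Rightarrow> real) \<Rightarrow> real \<Rightarrow> bool" where
  "time_optimal \<Omega> \<theta>0 p1 \<theta>1 u T \<longleftrightarrow> admissible T u \<and> reaches \<Omega> \<theta>0 p1 \<theta>1 u T \<and>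
     (\<forall>u' T'. admissible T' u' \<and> reaches \<Omega> \<theta>0 p1 \<theta>1 u' T' \<longrightarrow> T \<le> T')"

definition piecewise_const :: "(real \<Rightarrow> real) \<Rightarrow> real \<Rightarrow> nat \<Rightarrow> (nat \<Rightarrow> real) \<Rightarrow> (nat \<Rightarrow> real) \<Rightarrow> bool" where
  "piecewise_const u T n L v \<longleftrightarrow> (\<forall>i\<in>{1..n}. 0 \<le> L i) \<and> (\<Sum>i=1..n. L i) = T \<and>
     (\<forall>i\<in>{1..n}. AE t in lborel.
        (\<Sum>j=1..<i. L j) < t \<and> t < (\<Sum>j=1..i. L j) \<longrightarrow> u t = v i)"

definition type_a :: "real \<Rightarrow> nat \<Rightarrow> (nat \<Rightarrow> real) \<Rightarrow> (nat \<Rightarrow> real) \<Rightarrow> bool" where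
  "type_a S n L v \<longleftrightarrow>
     (\<forall>i\<in>{1..n}. (even i \<longrightarrow> v i = 0) \<and> (odd i \<longrightarrow> v i \<in> {-1, 1})) \<and>
     (1 \<le> n \<longrightarrow> L 1 \<le> 2 * S \<and> L n \<le> 2 * S) \<and>
     (\<forall>i\<in>{1..n}. odd i \<and> i \<noteq> 1 \<and> i \<noteq> n \<longrightarrow> L i = 2 * S)"

definition type_b :: "real \<Rightarrow> nat \<Rightarrow> (nat \<Rightarrow> real) \<Rightarrow> (nat \<Rightarrow> real) \<Rightarrow> bool" where
  "type_b S n L v \<longleftrightarrow>
     (\<exists>\<sigma>\<in>{-1, 1::real}. \<forall>i\<in>{1..n}. v i = (if even i then \<sigma> else - \<sigma>)) \<and>
     (\<exists>Th. Th \<le> 2 * S \<and> (\<forall>i. 2 \<le> i \<and> i \<le> n - 1 \<longrightarrow> L i = Th) \<and>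
        (1 \<le> n \<longrightarrow> L 1 \<le> Th \<and> L n \<le> Th))"

end

theory Submission imports Defs begin

text \<open>The displacement of a path depends only on its occupation measure, that is, on the time spent
  at each heading, modulo the period.  A path from \<open>a\<close> to \<open>b\<close> (\<open>a \<le> b\<close>) with range \<open>[c, d]\<close> spends at
  least one unit of time per unit of heading on \<open>[a, b]\<close> and at least two on the rest of \<open>[c, d]\<close>;
  conversely the path \<open>a \<rightarrow> c \<rightarrow> d \<rightarrow> b\<close> realizes this minimum, and any further occupation time can be
  added by dwelling (\<open>u = 0\<close>).  For a fixed range the problem is thus convex, and a separating
  functional \<open>\<psi>\<close> shows that an optimal path is of the form \<open>a \<rightarrow> c \<rightarrow> d \<rightarrow> b\<close> with finitely many
  dwells.  Without dwells it consists of at most three arcs and is of type (b) or (a): otherwise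
  moving full loops from the middle arc to the first one would give an optimal path whose turns are
  in the wrong order.  With a dwell, varying \<open>c\<close> and \<open>d\<close> and passing to the limit in \<open>\<psi>\<close> shows that all dwells and
  turns occur at headings where \<open>\<psi> \<bullet> p\<close> attains its global maximum.  By strict convexity these
  headings agree modulo the period, which is type (a).\<close>

subsection \<open>Controlled headings\<close>

text \<open>Three obstacles shape the argument. The control is merely integrable and bounded by 1,
  so the heading is never differentiated: lower bounds use its Lipschitz estimate and bisection, and
  the case of equality recovers unit speed and rests. Next, the functional found for a fixed range
  is controlled on \<open>{c..d}\<close> only. At a dwell strictly inside, this gives a local and
  hence a global maximum of \<open>\<psi> \<bullet> p\<close>; at a dwell on an end of the range the
  maximum is one-sided, and at a turn without a dwell nothing is known yet. Both gaps are closed by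
  perturbing the range. Each perturbed range brings its own functional, so a bound on
  \<open>h\<close> and compactness of the unit circle are needed to reach a limit. Finally, the
  boundary curve need not have a tangent, so growth of \<open>\<psi> \<bullet> p\<close> beyond an
  end of the range is measured against chords, not against the parameter. All of this is done for an
  abstract closed curve, because that class is stable under \<open>s \<mapsto> - s\<close>; this
  symmetry reduces decreasing headings and upper ends of ranges to increasing headings and lower
  ends.\<close>

definition adm_path :: "(real \<Rightarrow> real) \<Rightarrow> real \<Rightarrow> bool" where
  "adm_path \<theta> T \<longleftrightarrow> 0 \<le> T \<and> (\<exists>u. u integrable_on {0..T} \<and> (\<forall>t\<in>{0..T}. \<bar>u t\<bar> \<le> 1) \<and>
     (\<forall>t\<in>{0..T}. integral {0..t} u = \<theta> t - \<theta> 0))"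

definition join_path :: "(real \<Rightarrow> real) \<Rightarrow> real \<Rightarrow> (real \<Rightarrow> real) \<Rightarrow> real \<Rightarrow> real" where
  "join_path \<theta>1 T1 \<theta>2 t = (if t \<le> T1 then \<theta>1 t else \<theta>2 (t - T1))"

lemma adm_path_nonneg: "adm_path \<theta> T \<Longrightarrow> 0 \<le> T"
  by (simp add: adm_path_def)

lemma adm_path_line:
  assumes "\<bar>v\<bar> \<le> 1" "0 \<le> L"
  shows "adm_path (\<lambda>t. l + v * t) L"
  unfolding adm_path_def using assms
  by (auto intro!: exI[of _ "\<lambda>_. v"])

lemma adm_path_uminus:
  assumes "adm_path \<theta> T"
  shows "adm_path (\<lambda>t. - \<theta> t) T"
proof -
  obtain u where "0 \<le> T" "u integrable_on {0..T}" "\<forall>t\<in>{0..T}. \<bar>u t\<bar> \<le> 1"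
    "\<forall>t\<in>{0..T}. integral {0..t} u = \<theta> t - \<theta> 0"
    using assms unfolding adm_path_def by blast
  then show ?thesis
    unfolding adm_path_def
    by (intro conjI exI[of _ "\<lambda>t. - u t"]) (auto intro: integrable_neg)
qed

text \<open>All lower bounds on the duration of a path use the control through this estimate
  alone.\<close>

lemma adm_path_lipschitz:
  assumes "adm_path \<theta> T" "0 \<le> s" "s \<le> t" "t \<le> T"
  shows "\<bar>\<theta> t - \<theta> s\<bar> \<le> t - s"
proof -
  obtain u where u: "0 \<le> T" "u integrable_on {0..T}" "\<forall>t\<in>{0..T}. \<bar>u t\<bar> \<le> 1"
    "\<forall>t\<in>{0..T}. integral {0..t} u = \<theta> t - \<theta> 0"
    using assms unfolding adm_path_def by blast
  have i: "u integrable_on {0..t}" "u integrable_on {s..t}"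
    using u(2) assms by (auto intro: integrable_on_subinterval)
  have "integral {0..s} u + integral {s..t} u = integral {0..t} u"
    using i assms by (intro Henstock_Kurzweil_Integration.integral_combine) auto
  then have "\<theta> t - \<theta> s = integral {s..t} u"
    using u(4) assms by auto
  moreover have "norm (integral {s..t} u) \<le> 1 * (t - s)"
    using integrable_bound[of 1 u s t] i(2) u(3) assms by auto
  ultimately show ?thesis by simp
qed

lemma adm_path_continuous:
  assumes "adm_path \<theta> T"
  shows "continuous_on {0..T} \<theta>"
proof (rule continuous_onI)
  fix x e :: real assume "x \<in> {0..T}" "0 < e"
  then show "\<exists>d>0. \<forall>x'\<in>{0..T}. dist x' x < d \<longrightarrow> dist (\<theta> x') (\<theta> x) \<le> e"
    using adm_path_lipschitz[OF assms]
    by (intro exI[of _ e]) (auto simp: dist_real_def, smt (verit))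
qed

lemma integral_shift:
  fixes u :: "real \<Rightarrow> 'a::real_normed_vector"
  shows "integral {0..t} (\<lambda>s. u (x + s)) = integral {x..x + t} u"
  using integral_shift_Icc_real[of 0 t u x] by (simp add: o_def add.commute)

lemma integrable_shift:
  fixes u :: "real \<Rightarrow> 'a::real_normed_vector"
  shows "(\<lambda>s. u (x + s)) integrable_on {0..t} \<longleftrightarrow> u integrable_on {x..x + t}"
  unfolding integrable_on_def
  using has_integral_shift_Icc_real[of u x _ 0 t] by (simp add: o_def add.commute)

lemma adm_path_sub:
  assumes "adm_path \<theta> T" "0 \<le> x" "x \<le> y" "y \<le> T"
  shows "adm_path (\<lambda>t. \<theta> (x + t)) (y - x)"
proof -
  obtain u where u: "0 \<le> T" "u integrable_on {0..T}" "\<forall>t\<in>{0..T}. \<bar>u t\<bar> \<le> 1"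
    "\<forall>t\<in>{0..T}. integral {0..t} u = \<theta> t - \<theta> 0"
    using assms unfolding adm_path_def by blast
  have "integral {0..x} u + integral {x..x+t} u = integral {0..x+t} u" if "t \<in> {0..y-x}" for t
    using assms that
    by (intro Henstock_Kurzweil_Integration.integral_combine integrable_on_subinterval[OF u(2)]) auto
  then have "integral {x..x+t} u = \<theta> (x + t) - \<theta> (x + 0)" if "t \<in> {0..y-x}" for t
    using u(4) assms that by (auto simp: algebra_simps)
  moreover have "(\<lambda>t. u (x + t)) integrable_on {0..y - x}"
    using assms by (auto simp: integrable_shift intro!: integrable_on_subinterval[OF u(2)])
  ultimately show ?thesis
    unfolding adm_path_def using u assms
    by (intro conjI exI[of _ "\<lambda>t. u (x + t)"]) (auto simp: integral_shift)
qed

lemma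
  fixes f :: "real \<Rightarrow> 'a::banach"
  assumes "f integrable_on {0..T1}" "g integrable_on {0..T2}" "0 \<le> T1" "0 \<le> T2"
  shows integrable_join: "(\<lambda>t. if t \<le> T1 then f t else g (t - T1)) integrable_on {0..T1 + T2}"
    and integral_join: "integral {0..T1 + T2} (\<lambda>t. if t \<le> T1 then f t else g (t - T1)) =
      integral {0..T1} f + integral {0..T2} g"
proof -
  let ?h = "\<lambda>t. if t \<le> T1 then f t else g (t - T1)"
  have 1: "(?h has_integral integral {0..T1} f) {0..T1}"
    using integrable_integral[OF assms(1)]
    by (subst has_integral_cong[where g = f]) auto
  have "((\<lambda>s. g (s + (- T1))) has_integral integral {0..T2} g) {T1..T1+T2}"
    using integrable_integral[OF assms(2)]
      has_integral_shift_Icc_real[of g "- T1" "integral {0..T2} g" T1 "T1 + T2"] by (simp add: o_def)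
  then have 2: "(?h has_integral integral {0..T2} g) {T1..T1+T2}"
    by (rule has_integral_spike_finite[of "{T1}", rotated 2]) auto
  have "(?h has_integral (integral {0..T1} f + integral {0..T2} g)) {0..T1+T2}"
    using assms 1 2 by (intro has_integral_combine[where c = T1]) auto
  then show "?h integrable_on {0..T1 + T2}"
    "integral {0..T1 + T2} ?h = integral {0..T1} f + integral {0..T2} g"
    by auto
qed

lemma adm_path_join:
  assumes "adm_path \<theta>1 T1" "adm_path \<theta>2 T2" "\<theta>1 T1 = \<theta>2 0"
  shows "adm_path (join_path \<theta>1 T1 \<theta>2) (T1 + T2)"
proof -
  obtain u where u: "0 \<le> T1" "u integrable_on {0..T1}" "\<forall>t\<in>{0..T1}. \<bar>u t\<bar> \<le> 1"
    "\<forall>t\<in>{0..T1}. integral {0..t} u = \<theta>1 t - \<theta>1 0"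
    using assms unfolding adm_path_def by blast
  obtain v where v: "0 \<le> T2" "v integrable_on {0..T2}" "\<forall>t\<in>{0..T2}. \<bar>v t\<bar> \<le> 1"
    "\<forall>t\<in>{0..T2}. integral {0..t} v = \<theta>2 t - \<theta>2 0"
    using assms unfolding adm_path_def by blast
  let ?w = "\<lambda>t. if t \<le> T1 then u t else v (t - T1)"
  have "?w integrable_on {0..T1 + T2}"
    by (rule integrable_join) fact+
  moreover have "integral {0..t} ?w = join_path \<theta>1 T1 \<theta>2 t - \<theta>1 0" if t: "t \<in> {0..T1+T2}" for t
  proof (cases "t \<le> T1")
    case True
    then have "integral {0..t} ?w = integral {0..t} u"
      by (intro Henstock_Kurzweil_Integration.integral_cong) auto
    then show ?thesis using True u(4) t by (auto simp: join_path_def)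
  next
    case False
    have "integral {0..T1 + (t - T1)} ?w = integral {0..T1} u + integral {0..t - T1} v"
      using False u v t
      by (intro integral_join integrable_on_subinterval[OF v(2)]) auto
    moreover have "integral {0..t - T1} v = \<theta>2 (t - T1) - \<theta>2 0" "integral {0..T1} u = \<theta>1 T1 - \<theta>1 0"
      using False t u v by auto
    ultimately show ?thesis using False assms(3) by (simp add: join_path_def)
  qed
  ultimately show ?thesis
    unfolding adm_path_def using u v
    by (intro conjI exI[of _ ?w]) (auto simp: join_path_def)
qed

lemma integral_comp_join:
  fixes p :: "real \<Rightarrow> 'a::banach"
  assumes "continuous_on UNIV p" "adm_path \<theta>1 T1" "adm_path \<theta>2 T2"
  shows "integral {0..T1 + T2} (\<lambda>t. p (join_path \<theta>1 T1 \<theta>2 t)) =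
    integral {0..T1} (\<lambda>t. p (\<theta>1 t)) + integral {0..T2} (\<lambda>t. p (\<theta>2 t))"
proof -
  have "integral {0..T1 + T2} (\<lambda>t. p (join_path \<theta>1 T1 \<theta>2 t)) =
    integral {0..T1 + T2} (\<lambda>t. if t \<le> T1 then p (\<theta>1 t) else p (\<theta>2 (t - T1)))"
    by (simp add: join_path_def if_distrib cong: if_cong)
  also have "\<dots> = integral {0..T1} (\<lambda>t. p (\<theta>1 t)) + integral {0..T2} (\<lambda>t. p (\<theta>2 t))"
    using assms
    by (intro integral_join integrable_continuous_interval
        continuous_on_compose2[OF assms(1)] adm_path_continuous) (auto simp: adm_path_nonneg)
  finally show ?thesis .
qed

text \<open>The path is stopped for time \<open>r\<close> at a moment \<open>s\<close> when its
  heading is \<open>l\<close>. The inclusion of images keeps every level available, so that further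
  dwells can be inserted afterwards.\<close>

lemma insert_dwell:
  fixes p :: "real \<Rightarrow> 'a::banach"
  assumes p: "continuous_on UNIV p" and \<theta>: "adm_path \<theta> T" and l: "l \<in> \<theta> ` {0..T}" and r: "0 \<le> r"
  obtains \<theta>' where "adm_path \<theta>' (T + r)" "\<theta>' 0 = \<theta> 0" "\<theta>' (T + r) = \<theta> T"
    "\<theta> ` {0..T} \<subseteq> \<theta>' ` {0..T + r}"
    "integral {0..T + r} (\<lambda>t. p (\<theta>' t)) = integral {0..T} (\<lambda>t. p (\<theta> t)) + r *\<^sub>R p l"
proof -
  obtain s where s: "0 \<le> s" "s \<le> T" "\<theta> s = l"
    using l by auto
  let ?A = "\<lambda>t. \<theta> (0 + t)" and ?B = "\<lambda>t. l + 0 * t" and ?C = "\<lambda>t. \<theta> (s + t)"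
  let ?D = "join_path ?A (s - 0) ?B" and ?E = "join_path (join_path ?A (s - 0) ?B) ((s - 0) + r) ?C"
  have A: "adm_path ?A (s - 0)" and C: "adm_path ?C (T - s)"
    using s by (intro adm_path_sub[OF \<theta>]; simp)+
  have B: "adm_path ?B r"
    using r by (intro adm_path_line) auto
  have D: "adm_path ?D ((s - 0) + r)"
    using s by (intro adm_path_join[OF A B]) auto
  have E: "adm_path ?E (((s - 0) + r) + (T - s))"
    using s r by (intro adm_path_join[OF D C]) (auto simp: join_path_def)
  have eq: "((s - 0) + r) + (T - s) = T + r" by simp
  have cont: "continuous_on {0..T} (\<lambda>t. p (\<theta> t))"
    by (intro continuous_on_compose2[OF p] adm_path_continuous[OF \<theta>]) auto
  have "integral {0..T + r} (\<lambda>t. p (?E t)) =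
     integral {0..s} (\<lambda>t. p (\<theta> t)) + r *\<^sub>R p l + integral {0..T - s} (\<lambda>t. p (\<theta> (s + t)))"
    using integral_comp_join[OF p D C] integral_comp_join[OF p A B] r by (simp add: algebra_simps)
  also have "\<dots> = integral {0..T} (\<lambda>t. p (\<theta> t)) + r *\<^sub>R p l"
    using Henstock_Kurzweil_Integration.integral_combine[OF s(1,2) integrable_continuous_interval[OF cont]]
      integral_shift[of "T - s" "\<lambda>t. p (\<theta> t)" s] by (simp add: algebra_simps)
  finally have 1: "integral {0..T + r} (\<lambda>t. p (?E t)) = integral {0..T} (\<lambda>t. p (\<theta> t)) + r *\<^sub>R p l" .
  have "\<theta> t \<in> ?E ` {0..T + r}" if "t \<in> {0..T}" for t
  proof (cases "t \<le> s")
    case True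
    then show ?thesis using that r s by (intro image_eqI[of _ _ t]) (auto simp: join_path_def)
  next
    case False
    then show ?thesis using that r s by (intro image_eqI[of _ _ "t + r"]) (auto simp: join_path_def)
  qed
  then have "\<theta> ` {0..T} \<subseteq> ?E ` {0..T + r}" by blast
  moreover have "?E 0 = \<theta> 0" "?E (T + r) = \<theta> T"
    using s r by (auto simp: join_path_def)
  ultimately show ?thesis
    using that[of ?E] E 1 unfolding eq by blast
qed

text \<open>Formally the chain rule: the derivative of \<open>G (\<theta> t)\<close> has modulus at
  most \<open>g (\<theta> t)\<close>. Since \<theta> need not be differentiable, the inequality is
  shown locally with an error \<open>e * (t - s)\<close>, propagated by bisection, and
  \<open>e\<close> is sent to 0. For \<open>g = 1\<close> it bounds elapsed time by heading
  change.\<close>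

lemma le_integral_comp_path:
  fixes g \<theta> :: "real \<Rightarrow> real"
  assumes g: "continuous_on {c..d} g" "\<And>s. s \<in> {c..d} \<Longrightarrow> 0 \<le> g s"
    and lip: "\<And>s t. x \<le> s \<Longrightarrow> s \<le> t \<Longrightarrow> t \<le> y \<Longrightarrow> \<bar>\<theta> t - \<theta> s\<bar> \<le> t - s"
    and range: "\<theta> ` {x..y} \<subseteq> {c..d}" and xy: "x \<le> y"
  shows "\<bar>integral {c..\<theta> y} g - integral {c..\<theta> x} g\<bar> \<le> integral {x..y} (\<lambda>t. g (\<theta> t))"
proof -
  define G where "G = (\<lambda>s. integral {c..s} g)"
  have cont\<theta>: "continuous_on {x..y} \<theta>"
  proof (rule continuous_onI)
    fix z e :: real assume "z \<in> {x..y}" "0 < e"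
    then show "\<exists>d>0. \<forall>x'\<in>{x..y}. dist x' z < d \<longrightarrow> dist (\<theta> x') (\<theta> z) \<le> e"
      using lip by (intro exI[of _ e]) (auto simp: dist_real_def, smt (verit))
  qed
  have cg: "continuous_on {x..y} (\<lambda>t. g (\<theta> t))"
    by (rule continuous_on_compose2[OF g(1) cont\<theta> range])
  have ig: "(\<lambda>t. g (\<theta> t)) integrable_on {s..t}" if "x \<le> s" "t \<le> y" for s t
    using that by (intro integrable_continuous_interval continuous_on_subset[OF cg]) auto
  have Gdiff: "\<bar>G v - G w\<bar> \<le> M * \<bar>v - w\<bar>"
    if "v \<in> {c..d}" "w \<in> {c..d}" "\<And>s. min v w \<le> s \<Longrightarrow> s \<le> max v w \<Longrightarrow> g s \<le> M" for v w M
  proof -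
    have *: "\<bar>G v - G w\<bar> \<le> M * (v - w)" if "w \<le> v" "v \<in> {c..d}" "w \<in> {c..d}"
      "\<And>s. w \<le> s \<Longrightarrow> s \<le> v \<Longrightarrow> g s \<le> M" for v w
    proof -
      have "integral {c..w} g + integral {w..v} g = integral {c..v} g"
        using that
        by (intro Henstock_Kurzweil_Integration.integral_combine integrable_continuous_interval
            continuous_on_subset[OF g(1)]) auto
      moreover have "norm (integral {w..v} g) \<le> M * (v - w)"
        using that g(2)
        by (intro integral_bound continuous_on_subset[OF g(1)]) auto
      ultimately show ?thesis by (simp add: G_def)
    qed
    show ?thesis
      using *[of v w] *[of w v] that by (cases "w \<le> v") (auto simp: min_def max_def abs_minus_commute)
  qed
  have main: "\<bar>G (\<theta> y) - G (\<theta> x)\<bar> \<le> integral {x..y} (\<lambda>t. g (\<theta> t)) + e * (y - x)" if e: "0 < e" for e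
  proof -
    let ?P = "\<lambda>s t. x \<le> s \<and> s \<le> t \<and> t \<le> y \<longrightarrow>
      \<bar>G (\<theta> t) - G (\<theta> s)\<bar> \<le> integral {s..t} (\<lambda>t. g (\<theta> t)) + e * (t - s)"
    have "?P x y"
    proof (induction rule: Bolzano[OF xy, of ?P, case_names trans local])
      case (trans s m t)
      show ?case
      proof
        assume "x \<le> s \<and> s \<le> t \<and> t \<le> y"
        moreover then have "integral {s..m} (\<lambda>t. g (\<theta> t)) + integral {m..t} (\<lambda>t. g (\<theta> t)) =
          integral {s..t} (\<lambda>t. g (\<theta> t))"
          using trans by (intro Henstock_Kurzweil_Integration.integral_combine ig) auto
        ultimately show "\<bar>G (\<theta> t) - G (\<theta> s)\<bar> \<le> integral {s..t} (\<lambda>t. g (\<theta> t)) + e * (t - s)"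
          using trans by (auto simp: algebra_simps)
      qed
    next
      \<comment> \<open>Near \<open>z\<close> the weight stays within \<open>e / 2\<close> of
        \<open>g (\<theta> z)\<close>; one half of the error \<open>e\<close> is spent on the
        increment of \<open>G\<close>, the other on the time integral.\<close>
      case (local z)
      then have \<theta>z: "\<theta> z \<in> {c..d}" using range by (auto simp: image_subset_iff)
      then obtain \<delta> where \<delta>: "\<delta> > 0"
        "\<And>s. s \<in> {c..d} \<Longrightarrow> \<bar>s - \<theta> z\<bar> < \<delta> \<Longrightarrow> \<bar>g s - g (\<theta> z)\<bar> < e / 2"
        using g(1) e unfolding continuous_on_iff dist_real_def by (meson half_gt_zero)
      have "?P s t" if st: "s \<le> z" "z \<le> t" "t - s < \<delta>" for s t
      proof
        assume as: "x \<le> s \<and> s \<le> t \<and> t \<le> y"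
        have near: "\<bar>\<theta> w - \<theta> z\<bar> < \<delta>" if "w \<in> {s..t}" for w
          using lip[of w z] lip[of z w] st that as by (cases "w \<le> z") auto
        have ir: "\<theta> w \<in> {c..d}" if "w \<in> {s..t}" for w
          using range that as by (auto simp: image_subset_iff)
        have "\<bar>G (\<theta> t) - G (\<theta> s)\<bar> \<le> (g (\<theta> z) + e / 2) * \<bar>\<theta> t - \<theta> s\<bar>"
        proof (rule Gdiff)
          fix w assume w: "min (\<theta> t) (\<theta> s) \<le> w" "w \<le> max (\<theta> t) (\<theta> s)"
          have "\<bar>w - \<theta> z\<bar> < \<delta>"
            using near[of s] near[of t] w as by auto
          moreover have "w \<in> {c..d}"
            using ir[of s] ir[of t] w as by auto
          ultimately show "g w \<le> g (\<theta> z) + e / 2"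
            using \<delta>(2)[of w] by linarith
        qed (use ir as in auto)
        also have "\<dots> \<le> (g (\<theta> z) + e / 2) * (t - s)"
          using lip[of s t] as g(2)[OF \<theta>z] e by (intro mult_left_mono) auto
        finally have 1: "\<bar>G (\<theta> t) - G (\<theta> s)\<bar> \<le> (g (\<theta> z) + e / 2) * (t - s)" .
        have "integral {s..t} (\<lambda>_. g (\<theta> z) - e / 2) \<le> integral {s..t} (\<lambda>t. g (\<theta> t))"
        proof (intro integral_le ig)
          fix w assume "w \<in> {s..t}"
          then show "g (\<theta> z) - e / 2 \<le> g (\<theta> w)"
            using \<delta>(2)[OF ir[of w] near[of w]] \<open>w \<in> {s..t}\<close> by (smt (verit))
        qed (use as in auto)
        then have "(g (\<theta> z) - e / 2) * (t - s) \<le> integral {s..t} (\<lambda>t. g (\<theta> t))"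
          using as by (simp add: mult.commute)
        with 1 show "\<bar>G (\<theta> t) - G (\<theta> s)\<bar> \<le> integral {s..t} (\<lambda>t. g (\<theta> t)) + e * (t - s)"
          by argo
      qed
      then show ?case using \<delta>(1) by blast
    qed
    then show ?thesis using xy by simp
  qed
  show ?thesis
  proof (rule field_le_epsilon)
    fix e :: real assume e: "0 < e"
    have "e / (y - x + 1) * (y - x) \<le> e"
      using e xy by (auto simp: field_simps)
    then show "\<bar>integral {c..\<theta> y} g - integral {c..\<theta> x} g\<bar> \<le> integral {x..y} (\<lambda>t. g (\<theta> t)) + e"
      using main[of "e / (y - x + 1)"] e xy by (auto simp: G_def)
  qed
qed

subsection \<open>Linear functionals on a strictly convex curve\<close>

text \<open>Of three boundary points on one level line of \<psi>, the middle one is a proper convex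
  combination of the others, hence interior by strict convexity.\<close>

lemma no_three_collinear:
  fixes A B C \<psi> :: complex
  assumes sc: "strictly_convex_set \<Omega>" and \<psi>: "\<psi> \<noteq> 0"
    and mem: "A \<in> \<Omega>" "B \<in> \<Omega>" "C \<in> \<Omega>"
    and bd: "A \<notin> interior \<Omega>" "B \<notin> interior \<Omega>" "C \<notin> interior \<Omega>"
    and dist: "A \<noteq> B" "B \<noteq> C" "A \<noteq> C"
    and eq: "\<psi> \<bullet> A = \<psi> \<bullet> B" "\<psi> \<bullet> B = \<psi> \<bullet> C"
  shows False
proof -
  \<comment> \<open>\<open>\<i> * \<psi>\<close> is \<psi> turned by a right angle, so \<tau> is a
    coordinate along the level lines of \<psi>; the two functionals together separate
    points.\<close>
  define \<tau> where "\<tau> X = (\<i> * \<psi>) \<bullet> X" for X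
  have inj: "X = Y" if "\<psi> \<bullet> X = \<psi> \<bullet> Y" "\<tau> X = \<tau> Y" for X Y
  proof -
    have "(Re \<psi>)\<^sup>2 + (Im \<psi>)\<^sup>2 \<noteq> 0"
      using \<psi> by (simp add: complex_eq_iff)
    moreover have "Re \<psi> * (Re X - Re Y) + Im \<psi> * (Im X - Im Y) = 0"
      "Re \<psi> * (Im X - Im Y) - Im \<psi> * (Re X - Re Y) = 0"
      using that by (simp_all add: \<tau>_def inner_complex_def algebra_simps)
    then have "((Re \<psi>)\<^sup>2 + (Im \<psi>)\<^sup>2) * (Re X - Re Y) = 0" "((Re \<psi>)\<^sup>2 + (Im \<psi>)\<^sup>2) * (Im X - Im Y) = 0"
      by algebra+
    ultimately show ?thesis unfolding complex_eq_iff mult_eq_0_iff by auto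
  qed
  have no: False
    if XYZ: "\<tau> X < \<tau> Y" "\<tau> Y < \<tau> Z" "\<psi> \<bullet> X = \<psi> \<bullet> Y" "\<psi> \<bullet> Y = \<psi> \<bullet> Z" "X \<in> \<Omega>" "Z \<in> \<Omega>" "Y \<notin> interior \<Omega>" for X Y Z
  proof -
    define u where "u = (\<tau> Y - \<tau> X) / (\<tau> Z - \<tau> X)"
    have u: "0 < u" "u < 1" using XYZ by (auto simp: u_def field_simps)
    have *: "\<tau> X + u * (\<tau> Z - \<tau> X) = \<tau> Y"
      using XYZ(1,2) by (simp add: u_def)
    have "Y = (1 - u) *\<^sub>R X + u *\<^sub>R Z"
    proof (rule inj)
      show "\<psi> \<bullet> Y = \<psi> \<bullet> ((1 - u) *\<^sub>R X + u *\<^sub>R Z)"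
        using XYZ by (simp add: inner_add_right algebra_simps)
      have "\<tau> ((1 - u) *\<^sub>R X + u *\<^sub>R Z) = (1 - u) * \<tau> X + u * \<tau> Z"
        by (simp add: \<tau>_def inner_add_right)
      then show "\<tau> Y = \<tau> ((1 - u) *\<^sub>R X + u *\<^sub>R Z)"
        using * by (simp add: algebra_simps)
    qed
    moreover have "X \<noteq> Z" using XYZ by auto
    ultimately show False
      using sc[unfolded strictly_convex_set_def] u XYZ(5,6,7) by metis
  qed
  have "\<tau> A \<noteq> \<tau> B" "\<tau> B \<noteq> \<tau> C" "\<tau> A \<noteq> \<tau> C"
    using inj dist eq by metis+
  then consider "\<tau> A < \<tau> B" "\<tau> B < \<tau> C" | "\<tau> A < \<tau> C" "\<tau> C < \<tau> B" | "\<tau> B < \<tau> A" "\<tau> A < \<tau> C"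
    | "\<tau> B < \<tau> C" "\<tau> C < \<tau> A" | "\<tau> C < \<tau> A" "\<tau> A < \<tau> B" | "\<tau> C < \<tau> B" "\<tau> B < \<tau> A"
    by linarith
  then show False
    using no[of A B C] no[of A C B] no[of B A C] no[of B C A] no[of C A B] no[of C B A] mem bd eq
    by cases metis+
qed

text \<open>What is kept of the generalized trigonometric functions once the area parametrization is
  forgotten. The class is invariant under reversal of the parameter.\<close>

locale sc_curve =
  fixes p :: "real \<Rightarrow> complex" and P :: real and \<Omega> :: "complex set"
  assumes P_pos: "0 < P"
    and cont: "continuous_on UNIV p"
    and per: "p (s + P) = p s"
    and inj: "p s = p t \<Longrightarrow> \<exists>k::int. t = s + P * of_int k"
    and sc: "strictly_convex_set \<Omega>"
    and mem: "p s \<in> \<Omega>"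
    and bdry: "p s \<notin> interior \<Omega>"
begin

lemma per_int: "p (s + P * of_int k) = p s"
proof -
  have n: "p (s + P * of_nat n) = p s" for n s
    proof (induction n)
    case (Suc n)
    then show ?case using per[of "s + P * real n"] by (simp add: algebra_simps)
  qed simp
  show ?thesis
  proof (cases "k \<ge> 0")
    case True
    then show ?thesis using n[of s "nat k"] by simp
  next
    case False
    then show ?thesis using n[of "s + P * of_int k" "nat (- k)"] by simp
  qed
qed

lemma reduce: obtains k :: int where "a \<le> s + P * of_int k" "s + P * of_int k < a + P"
proof (rule that[of "- \<lfloor>(s - a) / P\<rfloor>"])
  have "P * of_int \<lfloor>(s - a) / P\<rfloor> \<le> P * ((s - a) / P)"
    using P_pos by (intro mult_left_mono) auto
  moreover have "P * ((s - a) / P) < P * (of_int \<lfloor>(s - a) / P\<rfloor> + 1)"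
    using P_pos by (intro mult_strict_left_mono) linarith+
  moreover have "P * ((s - a) / P) = s - a"
    using P_pos by simp
  ultimately show "a \<le> s + P * of_int (- \<lfloor>(s - a) / P\<rfloor>)" "s + P * of_int (- \<lfloor>(s - a) / P\<rfloor>) < a + P"
    by (simp_all only: of_int_minus distrib_left)
qed

lemma inj_near: "p s \<noteq> p t" if "s < t" "t < s + P"
proof
  assume "p s = p t"
  then obtain k :: int where "t = s + P * of_int k"
    using inj by blast
  then have "0 < P * of_int k" "P * of_int k < P * 1"
    using that by auto
  then show False
    using P_pos by (auto simp: zero_less_mult_iff mult_less_cancel_left)
qed

lemma cont_inner: "continuous_on A (\<lambda>s. \<psi> \<bullet> p s)"
  using continuous_on_subset[OF cont subset_UNIV] by (intro continuous_on_inner continuous_on_const)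

text \<open>Transfers results from increasing to decreasing headings and from the lower end of a
  range to the upper one.\<close>

lemma reflect: "sc_curve (\<lambda>s. p (- s)) P \<Omega>"
proof
  show "continuous_on UNIV (\<lambda>s. p (- s))"
    by (intro continuous_on_compose2[OF cont] continuous_intros) auto
  show "p (- (s + P)) = p (- s)" for s
    using per[of "- s - P"] by simp
  show "\<exists>k::int. t = s + P * of_int k" if "p (- s) = p (- t)" for s t
  proof -
    obtain k :: int where "- t = - s + P * of_int k"
      using inj[OF \<open>p (- s) = p (- t)\<close>] by blast
    then show ?thesis by (intro exI[of _ "- k"]) auto
  qed
qed (use P_pos sc mem bdry in auto)

lemma no_three_levels:
  assumes "\<psi> \<noteq> 0" "r < s" "s < t" "t < r + P" "\<psi> \<bullet> p r = \<psi> \<bullet> p s" "\<psi> \<bullet> p s = \<psi> \<bullet> p t"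
  shows False
proof (rule no_three_collinear[OF sc assms(1) mem mem mem bdry bdry bdry _ _ _ assms(5,6)])
  show "p r \<noteq> p s" "p s \<noteq> p t" "p r \<noteq> p t"
    using assms(2-4) by (intro inj_near; linarith)+
qed

text \<open>If the function rose anywhere between its maximum at \<open>x\<close> and its minimum at
  \<open>y\<close>, some intermediate value would be taken three times within less than a period,
  against \<open>no_three_levels\<close>.\<close>

lemma inner_strict_antimono:
  assumes \<psi>: "\<psi> \<noteq> 0" and xy: "x < y" "y < x + P"
    and ext: "\<And>s. x \<le> s \<Longrightarrow> s \<le> y \<Longrightarrow> \<psi> \<bullet> p y \<le> \<psi> \<bullet> p s \<and> \<psi> \<bullet> p s \<le> \<psi> \<bullet> p x"
    and st: "x \<le> s" "s < t" "t \<le> y"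
  shows "\<psi> \<bullet> p t < \<psi> \<bullet> p s"
proof -
  have no: False if hyp: "x \<le> s" "s < t" "t \<le> y" "\<psi> \<bullet> p s < \<psi> \<bullet> p t" for s t
  proof -
    define v where "v = (\<psi> \<bullet> p s + \<psi> \<bullet> p t) / 2"
    have v: "\<psi> \<bullet> p s < v" "v < \<psi> \<bullet> p t" using hyp by (auto simp: v_def)
    have e: "\<psi> \<bullet> p y < v" "v < \<psi> \<bullet> p x" using ext[of s] ext[of t] hyp v by auto
    obtain x1 where x1: "x \<le> x1" "x1 \<le> s" "\<psi> \<bullet> p x1 = v"
      using IVT2'[of "\<lambda>s. \<psi> \<bullet> p s" s v x] v e hyp cont_inner by force
    obtain x2 where x2: "s \<le> x2" "x2 \<le> t" "\<psi> \<bullet> p x2 = v"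
      using IVT'[of "\<lambda>s. \<psi> \<bullet> p s" s v t] v hyp cont_inner by force
    obtain x3 where x3: "t \<le> x3" "x3 \<le> y" "\<psi> \<bullet> p x3 = v"
      using IVT2'[of "\<lambda>s. \<psi> \<bullet> p s" y v t] v e hyp cont_inner by force
    have ne: "x1 \<noteq> s" "x2 \<noteq> s" "x2 \<noteq> t" "x3 \<noteq> t" using x1 x2 x3 v by auto
    have "x1 < x2" "x2 < x3" using x1 x2 x3 ne by auto
    moreover have "x3 < x1 + P" using x1 x3 xy by auto
    ultimately show False
      using no_three_levels[OF \<psi>, of x1 x2 x3] x1 x2 x3 by auto
  qed
  show ?thesis
  proof (rule ccontr)
    assume "\<not> ?thesis"
    then have eq: "\<psi> \<bullet> p s = \<psi> \<bullet> p t" using no[of s t] st by force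
    \<comment> \<open>As no rise is possible, equal values at \<open>s\<close> and \<open>t\<close>
      force the same value at the midpoint, which again makes three points on one level.\<close>
    let ?m = "(s + t) / 2"
    have m: "s < ?m" "?m < t" using st by auto
    have "\<psi> \<bullet> p ?m = \<psi> \<bullet> p s"
      using no[of s ?m] no[of ?m t] m st eq by force
    then show False
      using no_three_levels[OF \<psi>, of s ?m t] m st xy eq by auto
  qed
qed

text \<open>A maximum \<open>M\<close> and a minimum \<open>m\<close> cut the period into two arcs;
  \<open>inner_strict_antimono\<close> applies to the first with \<psi> and to the second with
  \<open>- \<psi>\<close>.\<close>

lemma unimodal:
  assumes \<psi>: "\<psi> \<noteq> 0"
  obtains M m where "M < m" "m < M + P"
    "\<And>s t. M \<le> s \<Longrightarrow> s < t \<Longrightarrow> t \<le> m \<Longrightarrow> \<psi> \<bullet> p t < \<psi> \<bullet> p s"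
    "\<And>s t. m \<le> s \<Longrightarrow> s < t \<Longrightarrow> t \<le> M + P \<Longrightarrow> \<psi> \<bullet> p s < \<psi> \<bullet> p t"
    "\<And>s. \<psi> \<bullet> p s \<le> \<psi> \<bullet> p M" "\<And>s. \<psi> \<bullet> p m \<le> \<psi> \<bullet> p s"
proof -
  obtain M where M: "\<forall>s\<in>{0..P}. \<psi> \<bullet> p s \<le> \<psi> \<bullet> p M"
    using continuous_attains_sup[OF compact_Icc, of 0 P "\<lambda>s. \<psi> \<bullet> p s"] cont_inner P_pos by force
  have max: "\<psi> \<bullet> p s \<le> \<psi> \<bullet> p M" for s
    using M by (metis per_int reduce[of 0 s] add_0 atLeastAtMost_iff less_imp_le)
  obtain m where m: "m \<in> {M..M+P}" "\<forall>s\<in>{M..M+P}. \<psi> \<bullet> p m \<le> \<psi> \<bullet> p s"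
    using continuous_attains_inf[OF compact_Icc, of M "M + P" "\<lambda>s. \<psi> \<bullet> p s"] cont_inner P_pos by force
  have min: "\<psi> \<bullet> p m \<le> \<psi> \<bullet> p s" for s
    using m(2) by (metis per_int reduce[of M s] atLeastAtMost_iff less_imp_le)
  have "\<psi> \<bullet> p m \<noteq> \<psi> \<bullet> p M"
  proof
    assume "\<psi> \<bullet> p m = \<psi> \<bullet> p M"
    then have "\<psi> \<bullet> p s = \<psi> \<bullet> p M" for s
      using max[of s] min[of s] by auto
    from this[of 0] this[of "P/3"] this[of "P/2"]
    have "\<psi> \<bullet> p 0 = \<psi> \<bullet> p (P/3)" "\<psi> \<bullet> p (P/3) = \<psi> \<bullet> p (P/2)" by simp_all
    then show False
      using no_three_levels[OF \<psi>, of 0 "P/3" "P/2"] P_pos by auto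
  qed
  then have ne: "m \<noteq> M" "m \<noteq> M + P" using per by auto
  have *: "M < m" "m < M + P" using m(1) ne by auto
  show ?thesis
  proof (rule that[OF * _ _ max min])
    show "\<psi> \<bullet> p t < \<psi> \<bullet> p s" if "M \<le> s" "s < t" "t \<le> m" for s t
      using inner_strict_antimono[OF \<psi> * _ that] max min by auto
    show "\<psi> \<bullet> p s < \<psi> \<bullet> p t" if "m \<le> s" "s < t" "t \<le> M + P" for s t
      using inner_strict_antimono[of "- \<psi>" m "M + P" s t] \<psi> * that max min per[of M] by auto
  qed
qed

definition argmax :: "complex \<Rightarrow> real \<Rightarrow> bool" where
  "argmax \<psi> s \<longleftrightarrow> (\<forall>t. \<psi> \<bullet> p t \<le> \<psi> \<bullet> p s)"

text \<open>Translated into \<open>[M, M + P)\<close>, a maximum can only be \<open>M\<close>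
  itself, by strict monotonicity on both branches. This is what later makes the headings of all
  dwells and turns agree modulo the period.\<close>

lemma argmax_unique:
  assumes "\<psi> \<noteq> 0" "argmax \<psi> s" "argmax \<psi> t"
  obtains k :: int where "t = s + P * of_int k"
proof -
  obtain M m where Mm: "M < m" "m < M + P"
    "\<And>s t. M \<le> s \<Longrightarrow> s < t \<Longrightarrow> t \<le> m \<Longrightarrow> \<psi> \<bullet> p t < \<psi> \<bullet> p s"
    "\<And>s t. m \<le> s \<Longrightarrow> s < t \<Longrightarrow> t \<le> M + P \<Longrightarrow> \<psi> \<bullet> p s < \<psi> \<bullet> p t"
    "\<And>s. \<psi> \<bullet> p s \<le> \<psi> \<bullet> p M" "\<And>s. \<psi> \<bullet> p m \<le> \<psi> \<bullet> p s"
    using unimodal[OF assms(1)] by blast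
  have *: "\<exists>k::int. s = M + P * of_int k" if s: "argmax \<psi> s" for s
  proof -
    obtain k :: int where k: "M \<le> s + P * of_int k" "s + P * of_int k < M + P"
      using reduce by blast
    have eq: "\<psi> \<bullet> p (s + P * of_int k) = \<psi> \<bullet> p M"
      using s Mm(5) unfolding argmax_def per_int by (meson order_antisym)
    have "s + P * of_int k = M"
      using Mm(3)[of M "s + P * of_int k"] Mm(4)[of "s + P * of_int k" "M + P"] k eq per[of M] by force
    then show ?thesis by (intro exI[of _ "- k"]) auto
  qed
  obtain k l :: int where "s = M + P * of_int k" "t = M + P * of_int l"
    using * assms by metis
  then show ?thesis by (intro that[of "l - k"]) (auto simp: algebra_simps)
qed

text \<open>Each monotone branch takes a value once, and a bounded interval meets finitely many
  translates of the period. Finiteness is what allows a path to be cut into finitely many arcs and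
  dwells.\<close>

lemma finite_level: 
  assumes "\<psi> \<noteq> 0"
  shows "finite {s \<in> {c..d}. \<psi> \<bullet> p s = v}"
proof -
  obtain M m where Mm: "M < m" "m < M + P"
    "\<And>s t. M \<le> s \<Longrightarrow> s < t \<Longrightarrow> t \<le> m \<Longrightarrow> \<psi> \<bullet> p t < \<psi> \<bullet> p s"
    "\<And>s t. m \<le> s \<Longrightarrow> s < t \<Longrightarrow> t \<le> M + P \<Longrightarrow> \<psi> \<bullet> p s < \<psi> \<bullet> p t"
    "\<And>s. \<psi> \<bullet> p s \<le> \<psi> \<bullet> p M" "\<And>s. \<psi> \<bullet> p m \<le> \<psi> \<bullet> p s"
    using unimodal[OF assms(1)] by blast
  define f where "f = (\<lambda>s. \<psi> \<bullet> p s)"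
  have "inj_on f {M..m}" "inj_on f {m..M+P}"
    unfolding f_def by (intro linorder_inj_onI; force dest: Mm(3,4))+
  then have "finite (f -` {v} \<inter> {M..m})" "finite (f -` {v} \<inter> {m..M+P})"
    by (auto intro: finite_vimage_IntI)
  moreover define A where "A = {s. M \<le> s \<and> s < M + P \<and> \<psi> \<bullet> p s = v}"
  have "A \<subseteq> (f -` {v} \<inter> {M..m}) \<union> (f -` {v} \<inter> {m..M+P})"
    by (auto simp: A_def f_def)
  ultimately have finA: "finite A" by (meson finite_UnI finite_subset)
  have "{s \<in> {c..d}. \<psi> \<bullet> p s = v} \<subseteq> (\<lambda>(k::int,s). s - P * of_int k) ` ({\<lfloor>(M - d) / P\<rfloor>..\<lceil>(M + P - c) / P\<rceil>} \<times> A)"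
  proof
    fix s assume s: "s \<in> {s \<in> {c..d}. \<psi> \<bullet> p s = v}"
    obtain k :: int where k: "M \<le> s + P * of_int k" "s + P * of_int k < M + P"
      using reduce by blast
    have "(M - d) / P \<le> of_int k" "of_int k \<le> (M + P - c) / P"
      using k s P_pos by (auto simp: field_simps)
    then have "k \<in> {\<lfloor>(M - d) / P\<rfloor>..\<lceil>(M + P - c) / P\<rceil>}"
      by (auto; linarith)
    moreover have "s + P * of_int k \<in> A"
      using k s by (auto simp: A_def per_int)
    ultimately show "s \<in> (\<lambda>(k::int,s). s - P * of_int k) ` ({\<lfloor>(M - d) / P\<rfloor>..\<lceil>(M + P - c) / P\<rceil>} \<times> A)"
      by (intro image_eqI[of _ _ "(k, s + P * of_int k)"]) auto
  qed
  then show ?thesis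
    using finA by (meson finite_SigmaI finite_atLeastAtMost_int finite_imageI finite_subset)
qed

text \<open>Away from the two extremal points, \<open>\<psi>\<close> is not normal to the curve.  If the chords
  from \<open>p s0\<close> to nearby points were almost orthogonal to \<open>\<psi>\<close>, then the level line through
  \<open>p s0\<close>, which meets the interior at \<open>z\<close>, would force one of the two boundary points into the
  interior.\<close>

lemma inner_chord_bound:
  assumes \<psi>: "\<psi> \<noteq> 0" and x: "\<psi> \<bullet> p s0 < \<psi> \<bullet> p x" and y: "\<psi> \<bullet> p y < \<psi> \<bullet> p s0"
  obtains \<kappa> \<eta> where "0 < \<kappa>" "0 < \<eta>"
    "\<And>s. \<bar>s - s0\<bar> < \<eta> \<Longrightarrow> \<kappa> * norm (p s - p s0) \<le> \<bar>\<psi> \<bullet> p s - \<psi> \<bullet> p s0\<bar>"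
proof -
  \<comment> \<open>The parameter at which the segment from \<open>p x\<close> to \<open>p y\<close>
    crosses the level of \<open>p s0\<close>.\<close>
  define u where "u = (\<psi> \<bullet> p x - \<psi> \<bullet> p s0) / (\<psi> \<bullet> p x - \<psi> \<bullet> p y)"
  define z where "z = (1 - u) *\<^sub>R p x + u *\<^sub>R p y"
  have u: "0 < u" "u < 1" using x y by (auto simp: u_def field_simps)
  have z: "z \<in> interior \<Omega>"
    unfolding z_def using sc u mem x y unfolding strictly_convex_set_def by (metis less_trans less_irrefl)
  have int: "(1 - u) *\<^sub>R X + u *\<^sub>R Y \<in> interior \<Omega>" if "0 < u" "u < 1" "X \<in> \<Omega>" "Y \<in> \<Omega>" "X \<noteq> Y" for X Y u
    using sc that unfolding strictly_convex_set_def by blast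
  obtain \<beta> where \<beta>: "0 < \<beta>" "ball z \<beta> \<subseteq> interior \<Omega>"
    using z open_interior open_contains_ball by metis
  define e where "e = z - p s0"
  have e0: "e \<noteq> 0" using z bdry by (auto simp: e_def)
  have "u * (\<psi> \<bullet> p x - \<psi> \<bullet> p y) = \<psi> \<bullet> p x - \<psi> \<bullet> p s0"
    using x y by (simp add: u_def)
  then have \<psi>e: "\<psi> \<bullet> e = 0"
    by (simp add: e_def z_def inner_diff_right inner_add_right algebra_simps)
  \<comment> \<open>Read off from the two facts at the end: \<open>norm v \<le> \<bar>\<gamma>\<bar>
    * norm \<psi> * (norm e / \<beta> + 1)\<close>, and
    \<open>\<bar>\<psi> \<bullet> v\<bar>\<close> is \<open>\<bar>\<gamma>\<bar>\<close> times the
    square of \<open>norm \<psi>\<close>.\<close>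
  define \<kappa> where "\<kappa> = norm \<psi> / (norm e / \<beta> + 1)"
  have \<kappa>: "0 < \<kappa>" using \<psi> \<beta> e0 by (auto simp: \<kappa>_def intro!: divide_pos_pos add_nonneg_pos)
  have "isCont p s0" using cont by (simp add: continuous_on_eq_continuous_at)
  then obtain \<eta> where \<eta>: "0 < \<eta>" "\<And>s. \<bar>s - s0\<bar> < \<eta> \<Longrightarrow> norm (p s - p s0) < norm e"
    using e0 unfolding continuous_at_eps_delta dist_norm by (metis real_norm_def zero_less_norm_iff)
  have main: "\<kappa> * norm (p s - p s0) \<le> \<bar>\<psi> \<bullet> p s - \<psi> \<bullet> p s0\<bar>" if s: "\<bar>s - s0\<bar> < \<eta>" for s
  proof -
    define v where "v = p s - p s0"
    define \<alpha> where "\<alpha> = (e \<bullet> v) / (norm e)\<^sup>2"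
    define \<gamma> where "\<gamma> = (\<psi> \<bullet> v) / (norm \<psi>)\<^sup>2"
    have v: "v = \<alpha> *\<^sub>R e + \<gamma> *\<^sub>R \<psi>"
    proof -
      have 1: "(norm e)\<^sup>2 = Re e ^2 + Im e ^2" "(norm \<psi>)\<^sup>2 = Re \<psi> ^2 + Im \<psi> ^2"
        by (simp_all add: cmod_power2)
      have 2: "(norm e)\<^sup>2 \<noteq> 0" "(norm \<psi>)\<^sup>2 \<noteq> 0" using e0 \<psi> by auto
      have 3: "Re \<psi> * Re e + Im \<psi> * Im e = 0" using \<psi>e by (simp add: inner_complex_def)
      let ?w = "v - \<alpha> *\<^sub>R e - \<gamma> *\<^sub>R \<psi>"
      have w1: "e \<bullet> ?w = 0" "\<psi> \<bullet> ?w = 0"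
        using 2 \<psi>e by (simp_all add: \<alpha>_def \<gamma>_def inner_diff_right power2_norm_eq_inner inner_commute)
      define wr wi where "wr = Re ?w" and "wi = Im ?w"
      have w2: "Re e * wr + Im e * wi = 0" "Re \<psi> * wr + Im \<psi> * wi = 0"
        using w1 unfolding inner_complex_def wr_def wi_def by simp_all
      have "(norm e)\<^sup>2 * (norm \<psi>)\<^sup>2 * wr = 0" "(norm e)\<^sup>2 * (norm \<psi>)\<^sup>2 * wi = 0"
        unfolding 1 using w2 3 by algebra+
      then have "wr = 0" "wi = 0" using 2 by auto
      then have "?w = 0" unfolding wr_def wi_def complex_eq_iff by simp
      then show ?thesis by (simp add: algebra_simps)
    qed
    have nv: "norm v < norm e" using \<eta>(2)[OF s] by (simp add: v_def)
    have "\<bar>e \<bullet> v\<bar> \<le> norm e * norm v" by (rule Cauchy_Schwarz_ineq2)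
    then have "\<bar>\<alpha>\<bar> * norm e \<le> norm v"
      using e0 by (simp add: \<alpha>_def power2_eq_square field_simps)
    then have "\<bar>\<alpha>\<bar> * norm e < 1 * norm e" using nv by linarith
    then have \<alpha>1: "\<bar>\<alpha>\<bar> < 1" using e0 by (auto simp: mult_less_cancel_right)
    \<comment> \<open>Otherwise \<open>z'\<close> below is still interior and collinear with
      \<open>p s0\<close> and \<open>p s\<close>. For positive \<alpha>, \<open>p s\<close> lies
      strictly between \<open>p s0\<close> and \<open>z'\<close>; for negative \<alpha>,
      \<open>p s0\<close> lies strictly between \<open>p s\<close> and \<open>z'\<close>.\<close>
    have key: "\<beta> * \<bar>\<alpha>\<bar> \<le> \<bar>\<gamma>\<bar> * norm \<psi>"
    proof (rule ccontr)
      assume neg: "\<not> ?thesis"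
      then have \<alpha>0: "\<alpha> \<noteq> 0" by auto
      define z' where "z' = z + (\<gamma> / \<alpha>) *\<^sub>R \<psi>"
      have "\<bar>\<gamma>\<bar> * norm \<psi> / \<bar>\<alpha>\<bar> < \<beta>"
        using neg \<alpha>0 by (simp add: field_simps)
      then have "z' \<in> ball z \<beta>" by (simp add: z'_def dist_norm)
      then have z': "z' \<in> interior \<Omega>" using \<beta> by auto
      then have z'\<Omega>: "z' \<in> \<Omega>" using interior_subset by auto
      have ps: "p s = p s0 + \<alpha> *\<^sub>R (z' - p s0)"
        using v \<alpha>0 by (simp add: z'_def v_def e_def algebra_simps)
      have ne: "z' \<noteq> p s0" "z' \<noteq> p s" using z' bdry by auto
      show False
      proof (cases "\<alpha> > 0")
        case True
        then have "(1 - \<alpha>) *\<^sub>R p s0 + \<alpha> *\<^sub>R z' \<in> interior \<Omega>"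
          using int[of \<alpha> "p s0" z'] \<alpha>1 mem z'\<Omega> ne by auto
        then show False using bdry[of s] ps by (simp add: algebra_simps)
      next
        case False
        then have neg: "\<alpha> < 0" using \<alpha>0 by auto
        define u where "u = - \<alpha> / (1 - \<alpha>)"
        have u: "0 < u" "u < 1" using neg by (auto simp: u_def field_simps)
        have "(1 - \<alpha>) *\<^sub>R p s0 = p s - \<alpha> *\<^sub>R z'" using ps by (simp add: algebra_simps)
        have "p s0 = (1 / (1 - \<alpha>)) *\<^sub>R ((1 - \<alpha>) *\<^sub>R p s0)"
          using neg by simp
        also have "\<dots> = (1 / (1 - \<alpha>)) *\<^sub>R (p s - \<alpha> *\<^sub>R z')"
          by (simp only: \<open>(1 - \<alpha>) *\<^sub>R p s0 = p s - \<alpha> *\<^sub>R z'\<close>)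
        also have "\<dots> = (1 - u) *\<^sub>R p s + u *\<^sub>R z'"
          using neg by (simp add: u_def field_simps scaleR_diff_right)
        finally have "p s0 \<in> interior \<Omega>"
          using int[of u "p s" z'] u mem z'\<Omega> ne by auto
        then show False using bdry by blast
      qed
    qed
    have "norm v \<le> \<bar>\<alpha>\<bar> * norm e + \<bar>\<gamma>\<bar> * norm \<psi>"
      unfolding v by (rule order_trans[OF norm_triangle_ineq]) simp
    also have "\<bar>\<alpha>\<bar> * norm e \<le> (\<bar>\<gamma>\<bar> * norm \<psi> / \<beta>) * norm e"
      using key \<beta> by (intro mult_right_mono) (auto simp: field_simps)
    finally have "norm v \<le> (\<bar>\<gamma>\<bar> * norm \<psi>) * (norm e / \<beta> + 1)" by (simp add: algebra_simps)
    moreover have pos: "norm e / \<beta> + 1 > 0" using \<beta> by (intro add_nonneg_pos) auto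
    ultimately have "norm v / (norm e / \<beta> + 1) \<le> \<bar>\<gamma>\<bar> * norm \<psi>" by (simp add: pos_divide_le_eq)
    then have "norm \<psi> * (norm v / (norm e / \<beta> + 1)) \<le> norm \<psi> * (\<bar>\<gamma>\<bar> * norm \<psi>)"
      by (intro mult_left_mono) auto
    also have "\<dots> = \<bar>\<psi> \<bullet> v\<bar>"
      using \<psi> by (simp add: \<gamma>_def power2_eq_square)
    finally show ?thesis by (simp add: \<kappa>_def v_def inner_diff_right)
  qed
  show ?thesis by (rule that[OF \<kappa> \<eta>(1) main])
qed

text \<open>Modulo the period, every point other than \<open>M\<close> has larger values arbitrarily
  close by: to its left on the descending branch, including the minimum, and to its right on the
  ascending one.\<close>

lemma local_max_imp_argmax:
  assumes \<psi>: "\<psi> \<noteq> 0" and \<eta>: "0 < \<eta>" and max: "\<And>s. \<bar>s - s0\<bar> < \<eta> \<Longrightarrow> \<psi> \<bullet> p s \<le> \<psi> \<bullet> p s0"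
  shows "argmax \<psi> s0"
proof -
  obtain M m where Mm: "M < m" "m < M + P"
    "\<And>s t. M \<le> s \<Longrightarrow> s < t \<Longrightarrow> t \<le> m \<Longrightarrow> \<psi> \<bullet> p t < \<psi> \<bullet> p s"
    "\<And>s t. m \<le> s \<Longrightarrow> s < t \<Longrightarrow> t \<le> M + P \<Longrightarrow> \<psi> \<bullet> p s < \<psi> \<bullet> p t"
    "\<And>s. \<psi> \<bullet> p s \<le> \<psi> \<bullet> p M" "\<And>s. \<psi> \<bullet> p m \<le> \<psi> \<bullet> p s"
    using unimodal[OF \<psi>] by blast
  obtain k :: int where k: "M \<le> s0 + P * of_int k" "s0 + P * of_int k < M + P"
    using reduce by blast
  define s1 where "s1 = s0 + P * of_int k"
  have max1: "\<psi> \<bullet> p s \<le> \<psi> \<bullet> p s1" if "\<bar>s - s1\<bar> < \<eta>" for s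
    using max[of "s - P * of_int k"] that per_int[of s0 k] per_int[of "s - P * of_int k" k]
    by (simp add: s1_def algebra_simps)
  have "s1 = M"
  proof (rule ccontr)
    assume "s1 \<noteq> M"
    then have gt: "M < s1" "s1 < M + P" using k by (auto simp: s1_def)
    show False
    proof (cases "s1 \<le> m")
      case True
      have "\<psi> \<bullet> p s1 < \<psi> \<bullet> p (max M (s1 - \<eta>/2))"
        using Mm(3)[of "max M (s1 - \<eta>/2)" s1] gt True \<eta> by auto
      moreover have "\<bar>max M (s1 - \<eta>/2) - s1\<bar> < \<eta>" using gt \<eta> by auto
      ultimately show False using max1 by fastforce
    next
      case False
      have "\<psi> \<bullet> p s1 < \<psi> \<bullet> p (min (M + P) (s1 + \<eta>/2))"
        using Mm(4)[of s1 "min (M + P) (s1 + \<eta>/2)"] gt False \<eta> by auto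
      moreover have "\<bar>min (M + P) (s1 + \<eta>/2) - s1\<bar> < \<eta>" using gt \<eta> by auto
      ultimately show False using max1 by fastforce
    qed
  qed
  then have "p s0 = p M" using per_int[of s0 k] by (simp add: s1_def)
  then show ?thesis using Mm(5) by (simp add: argmax_def)
qed

text \<open>Maximal on the range but not globally, \<open>c\<close> lies modulo the period on the
  descending branch, strictly between \<open>M\<close> and \<open>m\<close>. Moving left therefore
  raises \<open>\<psi> \<bullet> p\<close>, by \<open>inner_chord_bound\<close> at least linearly in
  the chord.\<close>

lemma left_increase:
  assumes \<psi>: "\<psi> \<noteq> 0" and cd: "c < d" and max: "\<And>s. c \<le> s \<Longrightarrow> s \<le> d \<Longrightarrow> \<psi> \<bullet> p s \<le> \<psi> \<bullet> p c"
    and not: "\<not> argmax \<psi> c"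
  obtains \<kappa> \<eta> where "0 < \<kappa>" "0 < \<eta>"
    "\<And>s. c - \<eta> < s \<Longrightarrow> s \<le> c \<Longrightarrow> \<kappa> * norm (p s - p c) \<le> \<psi> \<bullet> p s - \<psi> \<bullet> p c"
proof -
  obtain M m where Mm: "M < m" "m < M + P"
    "\<And>s t. M \<le> s \<Longrightarrow> s < t \<Longrightarrow> t \<le> m \<Longrightarrow> \<psi> \<bullet> p t < \<psi> \<bullet> p s"
    "\<And>s t. m \<le> s \<Longrightarrow> s < t \<Longrightarrow> t \<le> M + P \<Longrightarrow> \<psi> \<bullet> p s < \<psi> \<bullet> p t"
    "\<And>s. \<psi> \<bullet> p s \<le> \<psi> \<bullet> p M" "\<And>s. \<psi> \<bullet> p m \<le> \<psi> \<bullet> p s"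
    using unimodal[OF \<psi>] by blast
  obtain k :: int where k: "M \<le> c + P * of_int k" "c + P * of_int k < M + P"
    using reduce by blast
  define c1 where "c1 = c + P * of_int k"
  have p1: "p (s + P * of_int k) = p s" for s by (rule per_int)
  have c1M: "c1 \<noteq> M" using not Mm(5) p1[of c] by (auto simp: c1_def argmax_def)
  \<comment> \<open>On the ascending branch the values would grow immediately to the right of
    \<open>c\<close>, inside the range.\<close>
  have c1m: "c1 < m"
  proof (rule ccontr)
    assume "\<not> c1 < m"
    define s where "s = min (M + P) (d + P * of_int k)"
    have "\<psi> \<bullet> p c1 < \<psi> \<bullet> p s"
      using Mm(4)[of c1 s] \<open>\<not> c1 < m\<close> k cd by (auto simp: s_def c1_def)
    moreover have "c \<le> s - P * of_int k" "s - P * of_int k \<le> d"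
      using k cd by (auto simp: s_def c1_def)
    ultimately show False
      using max[of "s - P * of_int k"] p1[of c] p1[of "s - P * of_int k"] by (simp add: c1_def)
  qed
  have gt: "M < c1" using c1M k by (auto simp: c1_def)
  have "\<psi> \<bullet> p c < \<psi> \<bullet> p M" "\<psi> \<bullet> p m < \<psi> \<bullet> p c"
    using Mm(3)[of M c1] Mm(3)[of c1 m] gt c1m p1[of c] by (auto simp: c1_def)
  then obtain \<kappa> \<eta> where *: "0 < \<kappa>" "0 < \<eta>"
    "\<And>s. \<bar>s - c\<bar> < \<eta> \<Longrightarrow> \<kappa> * norm (p s - p c) \<le> \<bar>\<psi> \<bullet> p s - \<psi> \<bullet> p c\<bar>"
    using inner_chord_bound[OF \<psi>] by blast
  \<comment> \<open>The second bound \<open>c1 - M\<close> keeps \<open>s\<close> on the descending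
    branch, so that the modulus in the chord estimate can be removed.\<close>
  show ?thesis
  proof (rule that[of \<kappa> "min \<eta> (c1 - M)"])
    fix s assume s: "c - min \<eta> (c1 - M) < s" "s \<le> c"
    have "\<psi> \<bullet> p c \<le> \<psi> \<bullet> p s"
    proof (cases "s = c")
      case False
      then show ?thesis
        using Mm(3)[of "s + P * of_int k" c1] s c1m p1[of c] p1[of s]
        by (auto simp: c1_def min_def split: if_splits)
    qed auto
    then show "\<kappa> * norm (p s - p c) \<le> \<psi> \<bullet> p s - \<psi> \<bullet> p c"
      using *(3)[of s] s by auto
  qed (use * gt in auto)
qed

end

subsection \<open>Occupation time of a path\<close>

text \<open>A signed primitive with the fixed base point 0, so that durations and displacements
  become algebraic expressions in its values at the headings \<open>a\<close>, \<open>b\<close>,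
  \<open>c\<close>, \<open>d\<close>, whatever their signs.\<close>

definition prim :: "(real \<Rightarrow> 'a::banach) \<Rightarrow> real \<Rightarrow> 'a" where
  "prim F s = (if 0 \<le> s then integral {0..s} F else - integral {s..0} F)"

lemma prim_diff:
  fixes F :: "real \<Rightarrow> 'a::banach"
  assumes F: "continuous_on UNIV F" and xy: "x \<le> y"
  shows "integral {x..y} F = prim F y - prim F x"
proof -
  have i: "F integrable_on {u..v}" for u v
    using F by (intro integrable_continuous_interval continuous_on_subset[OF F]) auto
  have c: "integral {u..v} F + integral {v..w} F = integral {u..w} F" if "u \<le> v" "v \<le> w" for u v w
    using that i by (intro Henstock_Kurzweil_Integration.integral_combine) auto
  show ?thesis
    using c[of 0 x y] c[of x 0 y] c[of x y 0] xy
    by (auto simp: prim_def algebra_simps add_eq_0_iff)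
qed

lemma prim_has_vector_derivative:
  fixes F :: "real \<Rightarrow> 'a::banach"
  assumes F: "continuous_on UNIV F"
  shows "(prim F has_vector_derivative F s) (at s within A)"
proof -
  define l u where "l = s - 1" and "u = s + 1"
  have "((\<lambda>v. integral {l..v} F) has_vector_derivative F s) (at s within {l..u})"
    by (intro integral_has_vector_derivative continuous_on_subset[OF F]) (auto simp: l_def u_def)
  then have "((\<lambda>v. integral {l..v} F) has_vector_derivative F s) (at s)"
    by (subst (asm) at_within_interior) (auto simp: l_def u_def)
  then have "((\<lambda>v. integral {l..v} F + prim F l) has_vector_derivative F s) (at s)"
    by (auto intro!: derivative_eq_intros)
  then have "(prim F has_vector_derivative F s) (at s)"
  proof (rule has_vector_derivative_transform_within_open[where S = "{l<..<u}"])
    show "integral {l..v} F + prim F l = prim F v" if "v \<in> {l<..<u}" for v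
      using prim_diff[OF F, of l v] that by auto
  qed (auto simp: l_def u_def)
  then show ?thesis by (rule has_vector_derivative_at_within)
qed

lemma has_integral_comp_line:
  fixes F :: "real \<Rightarrow> 'a::banach"
  assumes F: "continuous_on UNIV F" and "x \<le> y" and \<sigma>: "\<sigma> = 1 \<or> \<sigma> = -1"
  shows "((\<lambda>t. F (l + \<sigma> * (t - x))) has_integral \<sigma> *\<^sub>R (prim F (l + \<sigma> * (y - x)) - prim F l)) {x..y}"
proof -
  have "((\<lambda>t. F (l + \<sigma> * (t - x))) has_integral
     \<sigma> *\<^sub>R prim F (l + \<sigma> * (y - x)) - \<sigma> *\<^sub>R prim F (l + \<sigma> * (x - x))) {x..y}"
  proof (rule fundamental_theorem_of_calculus)
    fix t assume "t \<in> {x..y}"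
    have "((prim F \<circ> (\<lambda>t. l + \<sigma> * (t - x))) has_vector_derivative \<sigma> *\<^sub>R F (l + \<sigma> * (t - x))) (at t within {x..y})"
      by (intro vector_diff_chain_within prim_has_vector_derivative[OF F])
         (auto intro!: derivative_eq_intros simp: has_real_derivative_iff_has_vector_derivative[symmetric])
    then have "((\<lambda>t. \<sigma> *\<^sub>R prim F (l + \<sigma> * (t - x))) has_vector_derivative \<sigma> *\<^sub>R \<sigma> *\<^sub>R F (l + \<sigma> * (t - x))) (at t within {x..y})"
      by (auto simp: o_def intro!: derivative_eq_intros)
    then show "((\<lambda>t. \<sigma> *\<^sub>R prim F (l + \<sigma> * (t - x))) has_vector_derivative F (l + \<sigma> * (t - x))) (at t within {x..y})"
      using \<sigma> by auto
  qed fact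
  then show ?thesis by (simp add: scaleR_diff_right)
qed

text \<open>\<open>seg \<sigma> \<theta> x y D\<close>: on \<open>[x, y]\<close> the path moves with velocity \<open>\<sigma>\<close>, except for finitely many
  dwells; \<open>D\<close> lists their levels and durations.\<close>

inductive seg :: "real \<Rightarrow> (real \<Rightarrow> real) \<Rightarrow> real \<Rightarrow> real \<Rightarrow> (real \<times> real) list \<Rightarrow> bool" for \<sigma> \<theta> where
  dwell: "x \<le> y \<Longrightarrow> (\<And>t. x \<le> t \<Longrightarrow> t \<le> y \<Longrightarrow> \<theta> t = \<theta> x) \<Longrightarrow> seg \<sigma> \<theta> x y [(\<theta> x, y - x)]"
| arc: "x \<le> y \<Longrightarrow> (\<And>t. x \<le> t \<Longrightarrow> t \<le> y \<Longrightarrow> \<theta> t = \<theta> x + \<sigma> * (t - x)) \<Longrightarrow> seg \<sigma> \<theta> x y []"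
| trans: "seg \<sigma> \<theta> x y D \<Longrightarrow> seg \<sigma> \<theta> y z E \<Longrightarrow> seg \<sigma> \<theta> x z (D @ E)"

lemma seg_le: "seg \<sigma> \<theta> x y D \<Longrightarrow> x \<le> y"
  by (induction rule: seg.induct) auto

lemma seg_mono:
  assumes "seg \<sigma> \<theta> x y D" "\<sigma> = 1 \<or> \<sigma> = -1"
  shows "x \<le> s \<Longrightarrow> s \<le> t \<Longrightarrow> t \<le> y \<Longrightarrow> \<sigma> * \<theta> s \<le> \<sigma> * \<theta> t"
  using assms(1)
proof (induction arbitrary: s t rule: seg.induct)
  case (dwell x y)
  have "\<theta> s = \<theta> x" "\<theta> t = \<theta> x"
    using dwell.prems by (intro dwell.hyps(2); linarith)+
  then show ?case by simp
next
  case (arc x y)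
  have "\<theta> s = \<theta> x + \<sigma> * (s - x)" "\<theta> t = \<theta> x + \<sigma> * (t - x)"
    using arc.prems by (intro arc.hyps(2); linarith)+
  then have "\<sigma> * \<theta> t - \<sigma> * \<theta> s = \<sigma> * \<sigma> * (t - s)" by algebra
  moreover have "\<sigma> * \<sigma> = 1" using assms(2) by auto
  ultimately show ?case using arc.prems by simp
next
  case (trans x y D z E)
  have xy: "x \<le> y" "y \<le> z" using trans.hyps seg_le by auto
  consider "t \<le> y" | "y \<le> s" | "s \<le> y" "y \<le> t" by linarith
  then show ?case
  proof cases
    case 1
    then show ?thesis using trans.prems by (intro trans.IH(1))
  next
    case 2
    then show ?thesis using trans.prems by (intro trans.IH(2))
  next
    case 3
    then have "\<sigma> * \<theta> s \<le> \<sigma> * \<theta> y" "\<sigma> * \<theta> y \<le> \<sigma> * \<theta> t"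
      using trans.prems xy by (intro trans.IH(1) trans.IH(2); simp)+
    then show ?thesis by simp
  qed
qed

lemma seg_uminus:
  assumes "seg \<sigma> \<theta> x y D"
  shows "seg (- \<sigma>) (\<lambda>t. - \<theta> t) x y (map (\<lambda>(l, r). (- l, r)) D)"
  using assms
proof (induction rule: seg.induct)
  case (dwell x y)
  have "seg (- \<sigma>) (\<lambda>t. - \<theta> t) x y [(- \<theta> x, y - x)]"
    by (rule seg.dwell[OF dwell.hyps(1)]) (rule arg_cong[OF dwell.hyps(2)])
  then show ?case by simp
next
  case (arc x y)
  have "seg (- \<sigma>) (\<lambda>t. - \<theta> t) x y []"
  proof (rule seg.arc[OF arc.hyps(1)])
    fix t assume t: "x \<le> t" "t \<le> y"
    show "- \<theta> t = - \<theta> x + - \<sigma> * (t - x)" by (subst arc.hyps(2)[OF t]) simp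
  qed
  then show ?case by simp
next
  case (trans x y D z E)
  then show ?case unfolding map_append by (intro seg.trans)
qed

text \<open>Only the end headings and the list of dwells enter, not the times at which the dwells
  take place. This occupation formula is what makes rearrangement possible.\<close>

lemma seg_has_integral:
  fixes F :: "real \<Rightarrow> 'a::banach"
  assumes "seg \<sigma> \<theta> x y D" "\<sigma> = 1 \<or> \<sigma> = -1" "continuous_on UNIV F"
  shows "((\<lambda>t. F (\<theta> t)) has_integral
    (\<sigma> *\<^sub>R (prim F (\<theta> y) - prim F (\<theta> x)) + (\<Sum>(l, r)\<leftarrow>D. r *\<^sub>R F l))) {x..y}"
  using assms(1)
proof (induction rule: seg.induct)
  case (dwell x y)
  have "((\<lambda>t. F (\<theta> x)) has_integral (y - x) *\<^sub>R F (\<theta> x)) {x..y}"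
    using has_integral_const_real[of "F (\<theta> x)" x y] dwell.hyps(1) by simp
  then have "((\<lambda>t. F (\<theta> t)) has_integral (y - x) *\<^sub>R F (\<theta> x)) {x..y}"
    by (rule has_integral_eq[rotated]) (metis atLeastAtMost_iff dwell.hyps(2))
  moreover have "\<theta> y = \<theta> x" using dwell.hyps(1) by (intro dwell.hyps(2)) auto
  ultimately show ?case by simp
next
  case (arc x y)
  have "\<theta> y = \<theta> x + \<sigma> * (y - x)" using arc.hyps(1) by (intro arc.hyps(2)) auto
  moreover have "((\<lambda>t. F (\<theta> t)) has_integral \<sigma> *\<^sub>R (prim F (\<theta> x + \<sigma> * (y - x)) - prim F (\<theta> x))) {x..y}"
    by (rule has_integral_eq[OF _ has_integral_comp_line[OF assms(3) arc.hyps(1) assms(2)]])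
      (metis atLeastAtMost_iff arc.hyps(2))
  ultimately show ?case by simp
next
  case (trans x y D z E)
  have "((\<lambda>t. F (\<theta> t)) has_integral
    (\<sigma> *\<^sub>R (prim F (\<theta> y) - prim F (\<theta> x)) + (\<Sum>(l, r)\<leftarrow>D. r *\<^sub>R F l)) +
    (\<sigma> *\<^sub>R (prim F (\<theta> z) - prim F (\<theta> y)) + (\<Sum>(l, r)\<leftarrow>E. r *\<^sub>R F l))) {x..z}"
    using trans.IH seg_le[OF trans.hyps(1)] seg_le[OF trans.hyps(2)]
    by (intro has_integral_combine[of x y z])
  then show ?case by (simp add: algebra_simps)
qed

lemma seg_levels:
  assumes "seg \<sigma> \<theta> x y D" "(l, r) \<in> set D"
  shows "0 \<le> r \<and> l \<in> \<theta> ` {x..y}"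
  using assms
proof (induction rule: seg.induct)
  case (dwell x y)
  have "l = \<theta> x" "r = y - x" using dwell.prems by simp_all
  then show ?case using dwell.hyps(1) by simp
next
  case (trans x y D z E)
  have "{x..y} \<subseteq> {x..z}" "{y..z} \<subseteq> {x..z}"
    using seg_le[OF trans.hyps(1)] seg_le[OF trans.hyps(2)] by auto
  then show ?case using trans.IH trans.prems by (simp, blast)
qed simp

lemma seg_duration:
  assumes "seg \<sigma> \<theta> x y D" "\<sigma> = 1 \<or> \<sigma> = -1"
  shows "y - x = \<sigma> * (\<theta> y - \<theta> x) + (\<Sum>(l, r)\<leftarrow>D. r)"
  using assms(1)
proof (induction rule: seg.induct)
  case (dwell x y)
  have "\<theta> y = \<theta> x" using dwell.hyps(1) by (intro dwell.hyps(2)) auto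
  then show ?case by simp
next
  case (arc x y)
  have "\<theta> y = \<theta> x + \<sigma> * (y - x)" using arc.hyps(1) by (intro arc.hyps(2)) auto
  then show ?case using assms(2) by auto
next
  case (trans x y D z E)
  then show ?case by (simp add: algebra_simps)
qed

section \<open>Equality in the occupation bound\<close>

lemma prim_strict_mono:
  fixes g :: "real \<Rightarrow> real"
  assumes g: "continuous_on UNIV g" "\<And>s. s \<in> {c..d} \<Longrightarrow> 0 \<le> g s" and fin: "finite {s\<in>{c..d}. g s = 0}"
    and uv: "c \<le> u" "u < v" "v \<le> d"
  shows "prim g u < prim g v"
proof -
  have cg: "continuous_on {u..v} g" using g(1) by (rule continuous_on_subset) auto
  have "0 \<le> integral {u..v} g"
    using uv g by (intro integral_nonneg integrable_continuous_interval cg) auto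
  moreover have "integral {u..v} g \<noteq> 0"
  proof
    assume "integral {u..v} g = 0"
    then have "\<forall>s\<in>{u..v}. g s = 0"
      using integral_eq_0_iff[OF cg] uv g by auto
    then have "{u..v} \<subseteq> {s\<in>{c..d}. g s = 0}" using uv by auto
    then show False using fin uv infinite_Icc[of u v] finite_subset by blast
  qed
  ultimately show ?thesis using prim_diff[OF g(1), of u v] uv by auto
qed

text \<open>Equality in the occupation bound with a positive weight leaves no room for moving slower
  than speed 1: near \<open>z\<close> one side is close to \<open>g (\<theta> z)\<close> times the
  elapsed time, the other to \<open>g (\<theta> z)\<close> times the heading increment. Bisection
  again replaces differentiation.\<close>

lemma unit_speed:
  fixes g \<theta> :: "real \<Rightarrow> real"
  assumes g: "continuous_on UNIV g"
    and lip: "\<And>s t. x \<le> s \<Longrightarrow> s \<le> t \<Longrightarrow> t \<le> y \<Longrightarrow> \<bar>\<theta> t - \<theta> s\<bar> \<le> t - s"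
    and eq: "\<And>s t. x \<le> s \<Longrightarrow> s \<le> t \<Longrightarrow> t \<le> y \<Longrightarrow> integral {s..t} (\<lambda>t. g (\<theta> t)) = prim g (\<theta> t) - prim g (\<theta> s)"
    and int: "(\<lambda>t. g (\<theta> t)) integrable_on {x..y}"
    and mono: "\<And>s t. x \<le> s \<Longrightarrow> s \<le> t \<Longrightarrow> t \<le> y \<Longrightarrow> \<theta> s \<le> \<theta> t"
    and pos: "\<And>t. x \<le> t \<Longrightarrow> t \<le> y \<Longrightarrow> 0 < g (\<theta> t)" and xy: "x \<le> y"
  shows "\<theta> y - \<theta> x = y - x"
proof -
  have main: "(1 - e) * (y - x) \<le> \<theta> y - \<theta> x" if e: "0 < e" "e < 1" for e
  proof -
    let ?P = "\<lambda>s t. x \<le> s \<and> s \<le> t \<and> t \<le> y \<longrightarrow> (1 - e) * (t - s) \<le> \<theta> t - \<theta> s"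
    have "?P x y"
    proof (induction rule: Bolzano[OF xy, of ?P, case_names trans local])
      case (trans s m t)
      then show ?case by (auto simp: algebra_simps)
    next
      case (local z)
      define g0 where "g0 = g (\<theta> z)"
      have g0: "0 < g0" using pos local by (simp add: g0_def)
      have "isCont g (\<theta> z)" using g by (simp add: continuous_on_eq_continuous_at)
      moreover have "0 < g0 * (e / 2)" using g0 e by simp
      ultimately obtain \<delta> where "\<delta> > 0"
        "\<forall>s. dist s (\<theta> z) < \<delta> \<longrightarrow> dist (g s) (g (\<theta> z)) < g0 * (e / 2)"
        unfolding continuous_at_eps_delta by blast
      then have \<delta>: "\<delta> > 0" "\<And>s. \<bar>s - \<theta> z\<bar> < \<delta> \<Longrightarrow> \<bar>g s - g0\<bar> < g0 * (e / 2)"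
        by (simp_all add: dist_real_def g0_def)
      have "?P s t" if st: "s \<le> z" "z \<le> t" "t - s < \<delta>" for s t
      proof
        assume as: "x \<le> s \<and> s \<le> t \<and> t \<le> y"
        have near: "\<bar>\<theta> w - \<theta> z\<bar> < \<delta>" if "w \<in> {s..t}" for w
          using lip[of w z] lip[of z w] st that as by (cases "w \<le> z") auto
        have "g0 * (1 - e / 2) * (t - s) = integral {s..t} (\<lambda>_. g0 * (1 - e / 2))"
          using as by simp
        also have "\<dots> \<le> integral {s..t} (\<lambda>t. g (\<theta> t))"
        proof (rule integral_le)
          show "(\<lambda>t. g (\<theta> t)) integrable_on {s..t}"
            using as by (intro integrable_on_subinterval[OF int]) auto
          show "g0 * (1 - e / 2) \<le> g (\<theta> w)" if "w \<in> {s..t}" for w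
          proof -
            have "g0 * (1 - e / 2) = g0 - g0 * (e / 2)" by (simp add: algebra_simps)
            then show ?thesis using \<delta>(2)[OF near[OF that]] by linarith
          qed
        qed auto
        also have "\<dots> = integral {\<theta> s..\<theta> t} g"
          using eq[of s t] as prim_diff[OF g mono[of s t]] by auto
        also have "\<dots> \<le> integral {\<theta> s..\<theta> t} (\<lambda>_. g0 * (1 + e / 2))"
        proof (rule integral_le)
          show "g integrable_on {\<theta> s..\<theta> t}"
            by (intro integrable_continuous_interval continuous_on_subset[OF g]) auto
          show "g w \<le> g0 * (1 + e / 2)" if "w \<in> {\<theta> s..\<theta> t}" for w
          proof -
            have "\<bar>w - \<theta> z\<bar> < \<delta>" using near[of s] near[of t] that as by auto
            then have "\<bar>g w - g0\<bar> < g0 * (e / 2)" by (rule \<delta>(2))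
            moreover have "g0 * (1 + e / 2) = g0 + g0 * (e / 2)" by (simp add: algebra_simps)
            ultimately show ?thesis by linarith
          qed
        qed auto
        also have "\<dots> = g0 * (1 + e / 2) * (\<theta> t - \<theta> s)"
          using mono[of s t] as by simp
        finally have "g0 * ((1 - e / 2) * (t - s)) \<le> g0 * ((1 + e / 2) * (\<theta> t - \<theta> s))"
          by (simp only: mult.assoc)
        then have 1: "(1 - e / 2) * (t - s) \<le> (1 + e / 2) * (\<theta> t - \<theta> s)"
          using g0 by simp
        have "(1 + e / 2) * ((1 - e) * (t - s)) \<le> (1 - e / 2) * (t - s)"
          unfolding mult.assoc[symmetric] using as by (intro mult_right_mono) (simp_all add: field_simps)
        with 1 have "(1 + e / 2) * ((1 - e) * (t - s)) \<le> (1 + e / 2) * (\<theta> t - \<theta> s)" by linarith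
        then show "(1 - e) * (t - s) \<le> \<theta> t - \<theta> s" using e by simp
      qed
      then show ?case using \<delta>(1) by blast
    qed
    then show ?thesis using xy by simp
  qed
  have "y - x \<le> \<theta> y - \<theta> x"
  proof (rule field_le_mult_one_interval)
    fix z :: real assume "0 < z" "z < 1"
    then show "z * (y - x) \<le> \<theta> y - \<theta> x" using main[of "1 - z"] by simp
  qed
  then show ?thesis using lip[of x y] xy by auto
qed

lemma last_time_at_start:
  fixes \<theta> :: "real \<Rightarrow> real"
  assumes cont: "continuous_on {x..y} \<theta>" and "x \<le> y"
  obtains t where "x \<le> t" "t \<le> y" "\<theta> t = \<theta> x" "\<And>s. t < s \<Longrightarrow> s \<le> y \<Longrightarrow> \<theta> s \<noteq> \<theta> x"
proof -
  have "closed ({x..y} \<inter> \<theta> -` {\<theta> x})"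
    by (intro continuous_closed_preimage cont) auto
  then have "compact ({x..y} \<inter> \<theta> -` {\<theta> x})"
    by (metis compact_Icc compact_Int_closed inf.left_idem)
  moreover have "x \<in> {x..y} \<inter> \<theta> -` {\<theta> x}" using assms by auto
  ultimately obtain t where t: "t \<in> {x..y} \<inter> \<theta> -` {\<theta> x}" and le: "\<forall>s\<in>{x..y} \<inter> \<theta> -` {\<theta> x}. s \<le> t"
    using compact_attains_sup by (metis empty_iff)
  show ?thesis
  proof (rule that)
    show "\<theta> s \<noteq> \<theta> x" if "t < s" "s \<le> y" for s
    proof
      assume "\<theta> s = \<theta> x"
      then have "s \<in> {x..y} \<inter> \<theta> -` {\<theta> x}" using t that by auto
      then show False using bspec[OF le] that(1) by fastforce
    qed
  qed (use t in auto)
qed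

lemma first_time_at_end:
  fixes \<theta> :: "real \<Rightarrow> real"
  assumes cont: "continuous_on {x..y} \<theta>" and "x \<le> y"
  obtains t where "x \<le> t" "t \<le> y" "\<theta> t = \<theta> y" "\<And>s. x \<le> s \<Longrightarrow> s < t \<Longrightarrow> \<theta> s \<noteq> \<theta> y"
proof -
  have "closed ({x..y} \<inter> \<theta> -` {\<theta> y})"
    by (intro continuous_closed_preimage cont) auto
  then have "compact ({x..y} \<inter> \<theta> -` {\<theta> y})"
    by (metis compact_Icc compact_Int_closed inf.left_idem)
  moreover have "y \<in> {x..y} \<inter> \<theta> -` {\<theta> y}" using assms by auto
  ultimately obtain t where t: "t \<in> {x..y} \<inter> \<theta> -` {\<theta> y}" and le: "\<forall>s\<in>{x..y} \<inter> \<theta> -` {\<theta> y}. t \<le> s"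
    using compact_attains_inf by (metis empty_iff)
  show ?thesis
  proof (rule that)
    show "\<theta> s \<noteq> \<theta> y" if "x \<le> s" "s < t" for s
    proof
      assume "\<theta> s = \<theta> y"
      then have "s \<in> {x..y} \<inter> \<theta> -` {\<theta> y}" using t that by auto
      then show False using bspec[OF le] that(2) by fastforce
    qed
  qed (use t in auto)
qed

text \<open>Waiting is free only at zeros of \<open>g\<close>. Equality passes to all subintervals
  and makes \<theta> monotone; the induction then cuts the path at a time when a zero of
  \<open>g\<close> strictly between \<open>\<theta> x\<close> and \<open>\<theta> y\<close> is
  taken.\<close>

lemma seg_exists:
  fixes g \<theta> :: "real \<Rightarrow> real"
  assumes g: "continuous_on UNIV g" "\<And>s. s \<in> {c..d} \<Longrightarrow> 0 \<le> g s" and fin: "finite {s\<in>{c..d}. g s = 0}"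
    and lip: "\<And>s t. x \<le> s \<Longrightarrow> s \<le> t \<Longrightarrow> t \<le> y \<Longrightarrow> \<bar>\<theta> t - \<theta> s\<bar> \<le> t - s"
    and cont: "continuous_on {x..y} \<theta>"
    and range: "\<And>t. x \<le> t \<Longrightarrow> t \<le> y \<Longrightarrow> \<theta> t \<in> {c..d}" and xy: "x \<le> y"
    and ge: "\<And>s t. x \<le> s \<Longrightarrow> s \<le> t \<Longrightarrow> t \<le> y \<Longrightarrow>
      \<bar>prim g (\<theta> t) - prim g (\<theta> s)\<bar> \<le> integral {s..t} (\<lambda>t. g (\<theta> t))"
    and eq: "integral {x..y} (\<lambda>t. g (\<theta> t)) = prim g (\<theta> y) - prim g (\<theta> x)"
  shows "\<exists>D. seg 1 \<theta> x y D"
proof -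
  have cg: "continuous_on {x..y} (\<lambda>t. g (\<theta> t))"
    by (rule continuous_on_compose2[OF g(1) cont]) auto
  have ig: "(\<lambda>t. g (\<theta> t)) integrable_on {s..t}" if "x \<le> s" "t \<le> y" for s t
    using that by (intro integrable_continuous_interval continuous_on_subset[OF cg]) auto
  \<comment> \<open>Each of the three pieces is at least its increment, and the totals agree, so no
    piece exceeds its increment.\<close>
  have eq': "integral {s..t} (\<lambda>t. g (\<theta> t)) = prim g (\<theta> t) - prim g (\<theta> s)"
    if st: "x \<le> s" "s \<le> t" "t \<le> y" for s t
  proof -
    have "integral {x..s} (\<lambda>t. g (\<theta> t)) + integral {s..y} (\<lambda>t. g (\<theta> t)) = integral {x..y} (\<lambda>t. g (\<theta> t))"
      "integral {s..t} (\<lambda>t. g (\<theta> t)) + integral {t..y} (\<lambda>t. g (\<theta> t)) = integral {s..y} (\<lambda>t. g (\<theta> t))"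
      using st by (intro Henstock_Kurzweil_Integration.integral_combine ig; simp)+
    then show ?thesis using ge[of x s] ge[of s t] ge[of t y] eq st by linarith
  qed
  have mono: "\<theta> s \<le> \<theta> t" if st: "x \<le> s" "s \<le> t" "t \<le> y" for s t
  proof (rule ccontr)
    assume "\<not> \<theta> s \<le> \<theta> t"
    then have "prim g (\<theta> t) < prim g (\<theta> s)"
      using range[of s] range[of t] st by (intro prim_strict_mono[OF g fin]) auto
    then show False using ge[of s t] eq'[of s t] st by auto
  qed
  show ?thesis
    using lip cont range xy eq' mono ig
  proof (induction "card {z\<in>{c..d}. g z = 0 \<and> \<theta> x < z \<and> z < \<theta> y}" arbitrary: x y rule: less_induct)
    case less
    let ?Z = "\<lambda>x y. {z\<in>{c..d}. g z = 0 \<and> \<theta> x < z \<and> z < \<theta> y}"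
    have finZ: "finite (?Z u v)" for u v
      by (rule finite_subset[OF _ fin]) auto
    show ?case
    proof (cases "?Z x y = {}")
      case False
      then obtain z where z: "z \<in> {c..d}" "g z = 0" "\<theta> x < z" "z < \<theta> y" by blast
      obtain w where w: "x \<le> w" "w \<le> y" "\<theta> w = z"
        using IVT'[of \<theta> x z y] z less.prems by auto
      have zin: "z \<in> ?Z x y" using z by auto
      have 1: "?Z x w \<subset> ?Z x y" and 2: "?Z w y \<subset> ?Z x y"
        using zin w z by auto
      have "card (?Z x w) < card (?Z x y)" "card (?Z w y) < card (?Z x y)"
        using psubset_card_mono[OF finZ 1] psubset_card_mono[OF finZ 2] by auto
      moreover have "continuous_on {x..w} \<theta>" "continuous_on {w..y} \<theta>"
        using w by (auto intro: continuous_on_subset[OF less.prems(2)])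
      ultimately have "\<exists>D. seg 1 \<theta> x w D" "\<exists>D. seg 1 \<theta> w y D"
        using less.prems w by (intro less.hyps; simp)+
      then show ?thesis using seg.trans by blast
    next
      case True
      show ?thesis
      proof (cases "\<theta> x = \<theta> y")
        case True
        have "\<theta> t = \<theta> x" if "x \<le> t" "t \<le> y" for t
          using less.prems(6)[of x t] less.prems(6)[of t y] that True by auto
        then show ?thesis using seg.dwell[of x y \<theta> 1] less.prems(4) by blast
      next
        case ne: False
        \<comment> \<open>With no zero of \<open>g\<close> strictly in between, the path rests at
          \<open>\<theta> x\<close> up to \<beta>, runs at unit speed up to \<alpha>, and rests at
          \<open>\<theta> y\<close> afterwards.\<close>
        obtain \<beta> where \<beta>: "x \<le> \<beta>" "\<beta> \<le> y" "\<theta> \<beta> = \<theta> x" "\<And>s. \<beta> < s \<Longrightarrow> s \<le> y \<Longrightarrow> \<theta> s \<noteq> \<theta> x"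
          using last_time_at_start[OF less.prems(2,4)] by blast
        obtain \<alpha> where \<alpha>: "x \<le> \<alpha>" "\<alpha> \<le> y" "\<theta> \<alpha> = \<theta> y" "\<And>s. x \<le> s \<Longrightarrow> s < \<alpha> \<Longrightarrow> \<theta> s \<noteq> \<theta> y"
          using first_time_at_end[OF less.prems(2,4)] by blast
        have \<beta>\<alpha>: "\<beta> < \<alpha>"
          using less.prems(6)[of \<alpha> \<beta>] less.prems(6)[of x y] less.prems(4) \<alpha> \<beta> ne by force
        have pos: "0 < g (\<theta> t)" if "\<beta> < t" "t < \<alpha>" for t
        proof -
          have "\<theta> x < \<theta> t" "\<theta> t < \<theta> y"
            using less.prems(6)[of x t] less.prems(6)[of t y] \<beta>(4)[of t] \<alpha>(4)[of t] that \<alpha>(1,2) \<beta>(1,2)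
            by linarith+
          moreover have "\<theta> t \<in> {c..d}" using less.prems(3)[of t] that \<alpha> \<beta> by auto
          ultimately show ?thesis using True g(2)[of "\<theta> t"] by force
        qed
        have speed: "\<theta> t - \<theta> s = t - s" if "\<beta> < s" "s \<le> t" "t < \<alpha>" for s t
          using less.prems that \<alpha> \<beta> pos by (intro unit_speed[OF g(1)]) auto
        have lip: "\<theta> t - \<theta> s \<le> t - s" if "\<beta> \<le> s" "s \<le> t" "t \<le> \<alpha>" for s t
          using less.prems(1)[of s t] that \<alpha> \<beta> by auto
        \<comment> \<open>At \<beta> and \<alpha> themselves the weight may vanish; unit speed
          reaches the closed interval by monotonicity and an approximation from inside.\<close>
        have speed': "\<theta> t - \<theta> \<beta> = t - \<beta>" if t: "\<beta> \<le> t" "t \<le> \<alpha>" for t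
        proof (cases "t = \<beta>")
          case False
          have "t - \<beta> \<le> \<theta> t - \<theta> \<beta>"
          proof (rule field_le_epsilon)
            fix e :: real assume e: "0 < e"
            define s where "s = min (\<beta> + e / 2) ((\<beta> + t) / 2)"
            define s' where "s' = max (t - e / 2) ((\<beta> + t) / 2)"
            have s: "\<beta> < s" "s \<le> s'" "s' < t" "s - \<beta> \<le> e/2" "t - s' \<le> e/2" 
              using e t False by (auto simp: s_def s'_def min_def max_def field_simps)
            have "\<theta> s' - \<theta> s = s' - s" using s t by (intro speed) auto
            moreover have "\<theta> \<beta> \<le> \<theta> s" "\<theta> s' \<le> \<theta> t"
              using less.prems(6)[of \<beta> s] less.prems(6)[of s' t] s t \<alpha> \<beta> by auto
            ultimately show "t - \<beta> \<le> \<theta> t - \<theta> \<beta> + e" using s by linarith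
          qed
          then show ?thesis using lip[of \<beta> t] t by auto
        qed auto
        have "seg 1 \<theta> x \<beta> [(\<theta> x, \<beta> - x)]"
        proof (rule seg.dwell)
          show "\<theta> t = \<theta> x" if "x \<le> t" "t \<le> \<beta>" for t
            using less.prems(6)[of x t] less.prems(6)[of t \<beta>] that \<beta> by auto
        qed fact
        moreover have "seg 1 \<theta> \<beta> \<alpha> []"
          using speed' \<beta>\<alpha> by (intro seg.arc) (auto simp: algebra_simps)
        moreover have "seg 1 \<theta> \<alpha> y [(\<theta> \<alpha>, y - \<alpha>)]"
        proof (rule seg.dwell)
          show "\<theta> t = \<theta> \<alpha>" if "\<alpha> \<le> t" "t \<le> y" for t
            using less.prems(6)[of \<alpha> t] less.prems(6)[of t y] that \<alpha> by auto
        qed fact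
        ultimately show ?thesis by (meson seg.trans)
      qed
    qed
  qed
qed

subsection \<open>Rearrangement of optimal paths\<close>

lemma prim_affine:
  fixes p :: "real \<Rightarrow> complex"
  assumes p: "continuous_on UNIV p"
  shows "prim (\<lambda>s. h - \<psi> \<bullet> p s) y - prim (\<lambda>s. h - \<psi> \<bullet> p s) x =
    h * (y - x) - \<psi> \<bullet> (prim p y - prim p x)"
proof -
  have c: "continuous_on A p" for A using p continuous_on_subset by blast
  have F: "continuous_on UNIV (\<lambda>s. h - \<psi> \<bullet> p s)"
    by (intro continuous_on_diff continuous_on_const continuous_on_inner c)
  have *: "prim (\<lambda>s. h - \<psi> \<bullet> p s) y - prim (\<lambda>s. h - \<psi> \<bullet> p s) x =
    h * (y - x) - \<psi> \<bullet> (prim p y - prim p x)" if "x \<le> y" for x y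
  proof -
    have ip: "p integrable_on {x..y}" by (intro integrable_continuous_interval c)
    have "integral {x..y} (\<lambda>s. h - \<psi> \<bullet> p s) = integral {x..y} (\<lambda>s. h) - integral {x..y} (\<lambda>s. \<psi> \<bullet> p s)"
      by (intro integral_diff integrable_continuous_interval continuous_on_inner continuous_on_const c)
    also have "integral {x..y} (\<lambda>s. \<psi> \<bullet> p s) = \<psi> \<bullet> integral {x..y} p"
      using integral_linear[OF ip bounded_linear_inner_right[of \<psi>]] by (simp add: o_def)
    finally show ?thesis
      using that prim_diff[OF F that] prim_diff[OF p that] by (simp add: mult.commute)
  qed
  show ?thesis
    using *[of x y] *[of y x] by (cases "x \<le> y") (auto simp: algebra_simps inner_diff_right)
qed

context sc_curve
begin

definition disp :: "(real \<Rightarrow> real) \<Rightarrow> real \<Rightarrow> complex" where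
  "disp \<theta> T = integral {0..T} (\<lambda>t. p (\<theta> t))"

text \<open>The integer \<open>k\<close> compares lifted final headings modulo the period; moving
  loops from one arc to another changes the lift.\<close>

definition optimal :: "(real \<Rightarrow> real) \<Rightarrow> real \<Rightarrow> bool" where
  "optimal \<theta> T \<longleftrightarrow> adm_path \<theta> T \<and>
     (\<forall>\<theta>' T' k. adm_path \<theta>' T' \<longrightarrow> \<theta>' 0 = \<theta> 0 \<longrightarrow> \<theta>' T' = \<theta> T + P * of_int k \<longrightarrow>
       disp \<theta>' T' = disp \<theta> T \<longrightarrow> T \<le> T')"

lemma disp_line:
  assumes "\<sigma> = 1 \<or> \<sigma> = -1" "0 \<le> L"
  shows "disp (\<lambda>t. l + \<sigma> * t) L = \<sigma> *\<^sub>R (prim p (l + \<sigma> * L) - prim p l)"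
  using has_integral_comp_line[OF cont assms(2,1), of l] unfolding disp_def
  by (simp add: integral_unique)

lemma disp_join:
  assumes "adm_path \<theta>1 T1" "adm_path \<theta>2 T2"
  shows "disp (join_path \<theta>1 T1 \<theta>2) (T1 + T2) = disp \<theta>1 T1 + disp \<theta>2 T2"
  unfolding disp_def by (rule integral_comp_join[OF cont assms])

lemma three_arcs:
  assumes \<sigma>: "\<sigma> = 1 \<or> \<sigma> = -1" and L: "0 \<le> L1" "0 \<le> L2" "0 \<le> L3"
    and b: "b1 = a + \<sigma> * L1" "b2 = b1 - \<sigma> * L2" "b3 = b2 + \<sigma> * L3"
  obtains \<theta> where "adm_path \<theta> (L1 + L2 + L3)" "\<theta> 0 = a" "\<theta> (L1 + L2 + L3) = b3"
    "\<And>t. 0 \<le> t \<Longrightarrow> t \<le> L1 \<Longrightarrow> \<theta> t = a + \<sigma> * t"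
    "\<And>t. L1 \<le> t \<Longrightarrow> t \<le> L1 + L2 \<Longrightarrow> \<theta> t = b1 - \<sigma> * (t - L1)"
    "\<And>t. L1 + L2 \<le> t \<Longrightarrow> \<theta> t = b2 + \<sigma> * (t - L1 - L2)"
    "disp \<theta> (L1 + L2 + L3) =
      \<sigma> *\<^sub>R ((prim p b1 - prim p a) - (prim p b2 - prim p b1) + (prim p b3 - prim p b2))"
proof -
  let ?A = "\<lambda>t. a + \<sigma> * t" and ?B = "\<lambda>t. b1 + (- \<sigma>) * t" and ?C = "\<lambda>t. b2 + \<sigma> * t"
  let ?D = "join_path ?A L1 ?B"
  let ?E = "join_path ?D (L1 + L2) ?C"
  have A: "adm_path ?A L1" and B: "adm_path ?B L2" and C: "adm_path ?C L3"
    using \<sigma> L by (intro adm_path_line; auto)+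
  have D: "adm_path ?D (L1 + L2)"
    using b by (intro adm_path_join[OF A B]) auto
  have DL: "?D (L1 + L2) = b2" using b L by (auto simp: join_path_def)
  have E: "adm_path ?E (L1 + L2 + L3)"
    using DL by (intro adm_path_join[OF D C]) auto
  have "disp ?E (L1 + L2 + L3) = disp ?A L1 + disp ?B L2 + disp ?C L3"
    using disp_join[OF D C] disp_join[OF A B] by simp
  also have "\<dots> = \<sigma> *\<^sub>R (prim p b1 - prim p a) + (- \<sigma>) *\<^sub>R (prim p b2 - prim p b1) + \<sigma> *\<^sub>R (prim p b3 - prim p b2)"
    using disp_line[OF \<sigma> L(1), of a] disp_line[OF _ L(2), of "- \<sigma>" b1] disp_line[OF \<sigma> L(3), of b2] b \<sigma>
    by auto
  also have "\<dots> = \<sigma> *\<^sub>R ((prim p b1 - prim p a) - (prim p b2 - prim p b1) + (prim p b3 - prim p b2))"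
    by (simp add: algebra_simps)
  finally show ?thesis
    using that[OF E] L b DL by (auto simp: join_path_def)
qed

text \<open>The duration of \<open>a \<rightarrow> c \<rightarrow> d \<rightarrow> b\<close> without
  dwells; \<open>base\<close> is its displacement.\<close>

definition len :: "real \<Rightarrow> real \<Rightarrow> real \<Rightarrow> real \<Rightarrow> real" where
  "len a b c d = (a - c) + (d - c) + (d - b)"

definition base :: "real \<Rightarrow> real \<Rightarrow> real \<Rightarrow> real \<Rightarrow> complex" where
  "base a b c d = (prim p a - prim p c) + (prim p d - prim p c) + (prim p d - prim p b)"

lemma zigzag_path:
  assumes "c \<le> a" "c \<le> d" "b \<le> d"
  obtains \<theta> where "adm_path \<theta> (len a b c d)" "\<theta> 0 = a" "\<theta> (len a b c d) = b"
    "{c..d} \<subseteq> \<theta> ` {0..len a b c d}" "disp \<theta> (len a b c d) = base a b c d"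
proof -
  have e: "c = a + (-1) * (a - c)" "d = c - (-1) * (d - c)" "b = d + (-1) * (d - b)"
    and nn: "0 \<le> a - c" "0 \<le> d - c" "0 \<le> d - b"
    using assms by auto
  show ?thesis
  proof (rule three_arcs[OF disjI2[OF refl] nn e])
    fix \<theta>
    assume \<theta>: "adm_path \<theta> (a - c + (d - c) + (d - b))" "\<theta> 0 = a" "\<theta> (a - c + (d - c) + (d - b)) = b"
      and mid: "\<And>t. a - c \<le> t \<Longrightarrow> t \<le> a - c + (d - c) \<Longrightarrow> \<theta> t = c - (-1) * (t - (a - c))"
      and disp: "disp \<theta> (a - c + (d - c) + (d - b)) =
        (-1) *\<^sub>R ((prim p c - prim p a) - (prim p d - prim p c) + (prim p b - prim p d))"
    have "s \<in> \<theta> ` {0..len a b c d}" if "s \<in> {c..d}" for s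
    proof (rule image_eqI)
      show "s = \<theta> ((a - c) + (s - c))" using mid[of "(a - c) + (s - c)"] that assms by simp
      show "(a - c) + (s - c) \<in> {0..len a b c d}" using that assms by (auto simp: len_def)
    qed
    then have "{c..d} \<subseteq> \<theta> ` {0..len a b c d}" by blast
    moreover have "disp \<theta> (len a b c d) = base a b c d"
      unfolding len_def base_def disp by simp
    ultimately show thesis
      using that[of \<theta>] \<theta> unfolding len_def by blast
  qed
qed

lemma insert_dwells:
  assumes "adm_path \<theta> T" "\<forall>(l, r)\<in>set D. l \<in> \<theta> ` {0..T} \<and> 0 \<le> r"
  shows "\<exists>\<theta>'. adm_path \<theta>' (T + (\<Sum>(l, r)\<leftarrow>D. r)) \<and> \<theta>' 0 = \<theta> 0 \<and>
    \<theta>' (T + (\<Sum>(l, r)\<leftarrow>D. r)) = \<theta> T \<and>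
    disp \<theta>' (T + (\<Sum>(l, r)\<leftarrow>D. r)) = disp \<theta> T + (\<Sum>(l, r)\<leftarrow>D. r *\<^sub>R p l)"
  using assms
proof (induction D arbitrary: \<theta> T)
  case Nil
  then show ?case by auto
next
  case (Cons x D)
  obtain l r where x: "x = (l, r)" by (cases x)
  then have "l \<in> \<theta> ` {0..T}" "0 \<le> r" using Cons.prems by auto
  then obtain \<theta>1 where \<theta>1: "adm_path \<theta>1 (T + r)" "\<theta>1 0 = \<theta> 0" "\<theta>1 (T + r) = \<theta> T"
    "\<theta> ` {0..T} \<subseteq> \<theta>1 ` {0..T + r}" "disp \<theta>1 (T + r) = disp \<theta> T + r *\<^sub>R p l"
    using insert_dwell[OF cont Cons.prems(1)] unfolding disp_def by metis
  have "\<forall>(l', r')\<in>set D. l' \<in> \<theta>1 ` {0..T + r} \<and> 0 \<le> r'"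
    using Cons.prems(2) \<theta>1(4) by auto
  then show ?case
    using Cons.IH[OF \<theta>1(1)] \<theta>1 by (simp add: x add.assoc)
qed

lemma sum_list_scale:
  fixes f :: "real \<Rightarrow> 'b::real_vector"
  shows "(\<Sum>(l, r)\<leftarrow>map (\<lambda>(l, r). (l, u * r)) D. r *\<^sub>R f l) = u *\<^sub>R (\<Sum>(l, r)\<leftarrow>D. r *\<^sub>R f l)"
  by (induction D) (auto simp: algebra_simps)

lemma sum_list_scale1: "(\<Sum>(l, r)\<leftarrow>map (\<lambda>(l, r). (l, u * r)) D. r) = u * (\<Sum>(l, r)\<leftarrow>D. r)" for u :: real
  by (induction D) (auto simp: algebra_simps)

text \<open>For a fixed range \<open>{c..d}\<close> the displacements available in less time form a convex set;
  \<open>\<psi>\<close> separates the target from it.\<close>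

lemma separation:
  assumes opt: "optimal \<theta> T" and cd: "c \<le> \<theta> 0" "c \<le> d" "\<theta> T \<le> d"
    and pos: "len (\<theta> 0) (\<theta> T) c d < T"
  obtains \<psi> where "norm \<psi> = 1"
    "\<And>s. s \<in> {c..d} \<Longrightarrow> (T - len (\<theta> 0) (\<theta> T) c d) * (\<psi> \<bullet> p s) \<le>
       \<psi> \<bullet> (disp \<theta> T - base (\<theta> 0) (\<theta> T) c d)"
proof -
  define r0 where "r0 = T - len (\<theta> 0) (\<theta> T) c d"
  define W where "W = disp \<theta> T - base (\<theta> 0) (\<theta> T) c d"
  \<comment> \<open>Dwell lists play the role of finitely supported occupation measures on
    \<open>{c..d}\<close>; a convex combination is a concatenation of rescaled lists. The strict
    bound on the total time makes \<open>W \<in> C\<close> contradict optimality.\<close>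
  define C where "C = {x. \<exists>D. (\<forall>(l, r)\<in>set D. l \<in> {c..d} \<and> 0 \<le> r) \<and>
     (\<Sum>(l, r)\<leftarrow>D. r) < r0 \<and> x = (\<Sum>(l, r)\<leftarrow>D. r *\<^sub>R p l)}"
  have r0: "0 < r0" using pos by (simp add: r0_def)
  have "convex C"
  proof (rule convexI)
    fix x y and u v :: real
    assume uv: "0 \<le> u" "0 \<le> v" "u + v = 1" and "x \<in> C" "y \<in> C"
    then obtain D E where D: "\<forall>(l, r)\<in>set D. l \<in> {c..d} \<and> 0 \<le> r" "(\<Sum>(l, r)\<leftarrow>D. r) < r0" "x = (\<Sum>(l, r)\<leftarrow>D. r *\<^sub>R p l)"
      and E: "\<forall>(l, r)\<in>set E. l \<in> {c..d} \<and> 0 \<le> r" "(\<Sum>(l, r)\<leftarrow>E. r) < r0" "y = (\<Sum>(l, r)\<leftarrow>E. r *\<^sub>R p l)"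
      unfolding C_def by blast
    let ?F = "map (\<lambda>(l, r). (l, u * r)) D @ map (\<lambda>(l, r). (l, v * r)) E"
    have "u * (\<Sum>(l, r)\<leftarrow>D. r) + v * (\<Sum>(l, r)\<leftarrow>E. r) < r0"
      using convex_bound_lt[OF D(2) E(2) uv] .
    then have "(\<Sum>(l, r)\<leftarrow>?F. r) < r0"
      using sum_list_scale1[of u D] sum_list_scale1[of v E] by simp
    moreover have "u *\<^sub>R x + v *\<^sub>R y = (\<Sum>(l, r)\<leftarrow>?F. r *\<^sub>R p l)"
      using sum_list_scale[of p u D] sum_list_scale[of p v E] D(3) E(3) by simp
    moreover have "\<forall>(l, r)\<in>set ?F. l \<in> {c..d} \<and> 0 \<le> r"
      using D(1) E(1) uv by auto
    ultimately show "u *\<^sub>R x + v *\<^sub>R y \<in> C"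
      unfolding C_def by blast
  qed
  moreover have "0 \<in> C"
    unfolding C_def using r0 by (auto intro!: exI[of _ "[]"])
  moreover have "W \<notin> C"
  proof
    assume "W \<in> C"
    then obtain D where D: "\<forall>(l, r)\<in>set D. l \<in> {c..d} \<and> 0 \<le> r" "(\<Sum>(l, r)\<leftarrow>D. r) < r0" "W = (\<Sum>(l, r)\<leftarrow>D. r *\<^sub>R p l)"
      unfolding C_def by blast
    obtain \<theta>' where \<theta>': "adm_path \<theta>' (len (\<theta> 0) (\<theta> T) c d)" "\<theta>' 0 = \<theta> 0" "\<theta>' (len (\<theta> 0) (\<theta> T) c d) = \<theta> T"
      "{c..d} \<subseteq> \<theta>' ` {0..len (\<theta> 0) (\<theta> T) c d}" "disp \<theta>' (len (\<theta> 0) (\<theta> T) c d) = base (\<theta> 0) (\<theta> T) c d"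
      using zigzag_path[OF cd] by blast
    define T' where "T' = len (\<theta> 0) (\<theta> T) c d + (\<Sum>(l, r)\<leftarrow>D. r)"
    have "\<forall>(l, r)\<in>set D. l \<in> \<theta>' ` {0..len (\<theta> 0) (\<theta> T) c d} \<and> 0 \<le> r"
      using D(1) by (auto intro!: subsetD[OF \<theta>'(4)])
    then obtain \<theta>'' where "adm_path \<theta>'' T'" "\<theta>'' 0 = \<theta> 0" "\<theta>'' T' = \<theta> T + P * of_int 0" "disp \<theta>'' T' = disp \<theta> T"
      using insert_dwells[OF \<theta>'(1)] \<theta>' D(3) unfolding T'_def W_def
      by (metis (no_types, lifting) add.right_neutral diff_add_cancel add.commute mult_zero_right of_int_0)
    then have "T \<le> T'" using opt unfolding optimal_def by blast
    then show False using D(2) by (simp add: T'_def r0_def)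
  qed
  ultimately obtain a b where ab: "a \<noteq> 0" "\<forall>x\<in>C. a \<bullet> x \<le> b" "b \<le> a \<bullet> W"
    using separating_hyperplane_sets[of C "{W}"] by auto
  have a: "a \<bullet> x \<le> a \<bullet> W" if "x \<in> C" for x using ab that by force
  define \<psi> where "\<psi> = (1 / norm a) *\<^sub>R a"
  have "r0 * (\<psi> \<bullet> p s) \<le> \<psi> \<bullet> W" if s: "s \<in> {c..d}" for s
  proof -
    have "r0 * (a \<bullet> p s) \<le> a \<bullet> W"
    \<comment> \<open>The full time \<open>r0\<close> is excluded from \<open>C\<close>, so it is
      approached by \<open>z * r0\<close>.\<close>
    proof (rule field_le_mult_one_interval)
      fix z :: real assume z: "0 < z" "z < 1"
      have "(z * r0) *\<^sub>R p s \<in> C"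
        unfolding C_def using s z r0 by (auto intro!: exI[of _ "[(s, z * r0)]"])
      from a[OF this] show "z * (r0 * (a \<bullet> p s)) \<le> a \<bullet> W" by (simp add: mult.assoc)
    qed
    then show ?thesis using ab(1) by (simp add: \<psi>_def divide_right_mono)
  qed
  moreover have "norm \<psi> = 1" using ab(1) by (simp add: \<psi>_def)
  ultimately show ?thesis using that[of \<psi>] by (simp add: r0_def W_def)
qed

text \<open>The descending case is the ascending one for \<open>- \<theta>\<close> and the weight
  \<open>g (- s)\<close>.\<close>

lemma adm_path_seg_exists:
  fixes g :: "real \<Rightarrow> real"
  assumes g: "continuous_on UNIV g" "\<And>s. s \<in> {c..d} \<Longrightarrow> 0 \<le> g s" and fin: "finite {s\<in>{c..d}. g s = 0}"
    and adm: "adm_path \<theta> T" and range: "\<theta> ` {0..T} \<subseteq> {c..d}" and xy: "0 \<le> x" "x \<le> y" "y \<le> T"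
    and \<sigma>: "\<sigma> = 1 \<or> \<sigma> = -1"
    and eq: "integral {x..y} (\<lambda>t. g (\<theta> t)) = \<sigma> * (prim g (\<theta> y) - prim g (\<theta> x))"
  shows "\<exists>D. seg \<sigma> \<theta> x y D"
proof -
  have lip: "\<bar>\<theta> t - \<theta> s\<bar> \<le> t - s" if "x \<le> s" "s \<le> t" "t \<le> y" for s t
    using adm_path_lipschitz[OF adm, of s t] that xy by auto
  have cont\<theta>: "continuous_on {x..y} \<theta>"
    using adm_path_continuous[OF adm] by (rule continuous_on_subset) (use xy in auto)
  have rng: "\<theta> t \<in> {c..d}" if "x \<le> t" "t \<le> y" for t
    using range that xy by (auto simp: image_subset_iff)
  have ge: "\<bar>prim g (\<theta> t) - prim g (\<theta> s)\<bar> \<le> integral {s..t} (\<lambda>t. g (\<theta> t))"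
    if st: "x \<le> s" "s \<le> t" "t \<le> y" for s t
  proof -
    have "\<bar>integral {c..\<theta> t} g - integral {c..\<theta> s} g\<bar> \<le> integral {s..t} (\<lambda>t. g (\<theta> t))"
      using st lip rng
      by (intro le_integral_comp_path[of c d] g continuous_on_subset[OF g(1)]) auto
    then show ?thesis
      using prim_diff[OF g(1), of c "\<theta> t"] prim_diff[OF g(1), of c "\<theta> s"] rng[of s] rng[of t] st by simp
  qed
  show ?thesis
  proof (cases "\<sigma> = 1")
    case True
    then show ?thesis
      using seg_exists[OF g fin lip cont\<theta> rng xy(2) ge] eq by auto
  next
    case False
    then have s: "\<sigma> = -1" using \<sigma> by auto
    let ?g = "\<lambda>s. g (- s)"
    have cg: "continuous_on UNIV ?g"
      by (intro continuous_on_compose2[OF g(1)] continuous_intros) auto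
    have prim: "prim ?g (- s) = - prim g s" for s
    proof -
      have "integral {- s..0} ?g = integral {0..s} g" "integral {0..- s} ?g = integral {s..0} g"
        using Henstock_Kurzweil_Integration.integral_reflect_real[of s 0 g]
        Henstock_Kurzweil_Integration.integral_reflect_real[of 0 s g] by simp_all
      then show ?thesis by (auto simp: prim_def)
    qed
    have fin': "finite {s\<in>{-d..-c}. ?g s = 0}"
    proof -
      have "{s\<in>{-d..-c}. ?g s = 0} = uminus ` {s\<in>{c..d}. g s = 0}"
        by (auto simp: image_iff) (metis add.inverse_inverse minus_le_iff le_minus_iff)
      then show ?thesis using fin by simp
    qed
    have "\<exists>D. seg 1 (\<lambda>t. - \<theta> t) x y D"
    proof (rule seg_exists[OF cg _ fin'])
      show "0 \<le> ?g s" if "s \<in> {-d..-c}" for s using g(2)[of "- s"] that by auto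
      show "continuous_on {x..y} (\<lambda>t. - \<theta> t)" by (intro continuous_intros cont\<theta>)
      show "\<bar>prim ?g (- \<theta> t) - prim ?g (- \<theta> s)\<bar> \<le> integral {s..t} (\<lambda>t. ?g (- \<theta> t))"
        if "x \<le> s" "s \<le> t" "t \<le> y" for s t
        using ge[OF that] by (simp add: prim abs_minus_commute)
      show "integral {x..y} (\<lambda>t. ?g (- \<theta> t)) = prim ?g (- \<theta> y) - prim ?g (- \<theta> x)"
        using eq by (simp add: prim s)
      show "\<bar>- \<theta> t - - \<theta> s\<bar> \<le> t - s" if "x \<le> s" "s \<le> t" "t \<le> y" for s t
        using lip[OF that] by auto
      show "- \<theta> t \<in> {-d..-c}" if "x \<le> t" "t \<le> y" for t
        using rng[OF that] by auto
    qed fact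
    then show ?thesis using s seg_uminus[of 1 "\<lambda>t. - \<theta> t" x y] by auto
  qed
qed

text \<open>The weight \<open>h - \<psi> \<bullet> p\<close> obtained by separation is nonnegative on the range of the path, and its
  integral along the path is the least possible one for a path with that range.\<close>

lemma optimal_path_segs:
  assumes opt: "optimal \<theta> T" and ab: "\<theta> 0 \<le> \<theta> T"
  obtains (zigzag) t1 t2 D1 D2 D3 where "0 \<le> t1" "t1 \<le> t2" "t2 \<le> T"
      "seg (-1) \<theta> 0 t1 D1" "seg 1 \<theta> t1 t2 D2" "seg (-1) \<theta> t2 T D3"
  | (zagzig) t1 t2 D1 D2 D3 where "0 \<le> t1" "t1 \<le> t2" "t2 \<le> T" "\<theta> 0 = \<theta> T"
      "seg 1 \<theta> 0 t1 D1" "seg (-1) \<theta> t1 t2 D2" "seg 1 \<theta> t2 T D3"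
proof -
  have adm: "adm_path \<theta> T" using opt by (simp add: optimal_def)
  note T = adm_path_nonneg[OF adm]
  have c\<theta>: "continuous_on {0..T} \<theta>" by (rule adm_path_continuous[OF adm])
  \<comment> \<open>The path is cut at times of minimal and maximal heading; the order of the two
    times decides between the two outcomes.\<close>
  obtain tc where tc: "tc \<in> {0..T}" "\<And>t. t \<in> {0..T} \<Longrightarrow> \<theta> tc \<le> \<theta> t"
    using continuous_attains_inf[OF compact_Icc _ c\<theta>] T by force
  obtain td where td: "td \<in> {0..T}" "\<And>t. t \<in> {0..T} \<Longrightarrow> \<theta> t \<le> \<theta> td"
    using continuous_attains_sup[OF compact_Icc _ c\<theta>] T by force
  define a b c d where "a = \<theta> 0" and "b = \<theta> T" and "c = \<theta> tc" and "d = \<theta> td"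
  have range: "\<theta> ` {0..T} \<subseteq> {c..d}" using tc td by (auto simp: c_def d_def)
  have abcd: "c \<le> a" "a \<le> d" "c \<le> b" "b \<le> d" "c \<le> d" "a \<le> b"
    using tc td T ab by (auto simp: a_def b_def c_def d_def intro: order_trans)
  have parts: "\<bar>prim g (\<theta> s) - prim g (\<theta> 0)\<bar> \<le> integral {0..s} (\<lambda>t. g (\<theta> t))"
    "\<bar>prim g (\<theta> t) - prim g (\<theta> s)\<bar> \<le> integral {s..t} (\<lambda>t. g (\<theta> t))"
    "\<bar>prim g (\<theta> T) - prim g (\<theta> t)\<bar> \<le> integral {t..T} (\<lambda>t. g (\<theta> t))"
    "integral {0..T} (\<lambda>t. g (\<theta> t)) = integral {0..s} (\<lambda>t. g (\<theta> t)) +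
       integral {s..t} (\<lambda>t. g (\<theta> t)) + integral {t..T} (\<lambda>t. g (\<theta> t))"
    if g: "continuous_on UNIV g" "\<And>s. s \<in> {c..d} \<Longrightarrow> 0 \<le> g s" and st: "0 \<le> s" "s \<le> t" "t \<le> T"
    for g :: "real \<Rightarrow> real" and s t
  proof -
    have ge: "\<bar>prim g (\<theta> y) - prim g (\<theta> x)\<bar> \<le> integral {x..y} (\<lambda>t. g (\<theta> t))"
      if "0 \<le> x" "x \<le> y" "y \<le> T" for x y
    proof -
      have "\<bar>integral {c..\<theta> y} g - integral {c..\<theta> x} g\<bar> \<le> integral {x..y} (\<lambda>t. g (\<theta> t))"
        using that adm_path_lipschitz[OF adm] range
        by (intro le_integral_comp_path[of c d] g continuous_on_subset[OF g(1)]) auto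
      then show ?thesis
        using prim_diff[OF g(1), of c "\<theta> y"] prim_diff[OF g(1), of c "\<theta> x"] range that
        by (auto simp: image_subset_iff)
    qed
    have i: "(\<lambda>t. g (\<theta> t)) integrable_on {x..y}" if "0 \<le> x" "y \<le> T" for x y
      using that by (intro integrable_continuous_interval continuous_on_compose2[OF g(1)]
          continuous_on_subset[OF c\<theta>]) auto
    have "integral {0..s} (\<lambda>t. g (\<theta> t)) + integral {s..t} (\<lambda>t. g (\<theta> t)) = integral {0..t} (\<lambda>t. g (\<theta> t))"
      "integral {0..t} (\<lambda>t. g (\<theta> t)) + integral {t..T} (\<lambda>t. g (\<theta> t)) = integral {0..T} (\<lambda>t. g (\<theta> t))"
      using st by (intro Henstock_Kurzweil_Integration.integral_combine i; simp)+
    then show "integral {0..T} (\<lambda>t. g (\<theta> t)) = integral {0..s} (\<lambda>t. g (\<theta> t)) +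
       integral {s..t} (\<lambda>t. g (\<theta> t)) + integral {t..T} (\<lambda>t. g (\<theta> t))" by simp
    show "\<bar>prim g (\<theta> s) - prim g (\<theta> 0)\<bar> \<le> integral {0..s} (\<lambda>t. g (\<theta> t))"
      "\<bar>prim g (\<theta> t) - prim g (\<theta> s)\<bar> \<le> integral {s..t} (\<lambda>t. g (\<theta> t))"
      "\<bar>prim g (\<theta> T) - prim g (\<theta> t)\<bar> \<le> integral {t..T} (\<lambda>t. g (\<theta> t))"
      using st by (intro ge; simp)+
  qed
  \<comment> \<open>When no time is left for dwelling, so that \<open>T = len a b c d\<close>, the
    constant weight 1 takes the place of \<open>h - \<psi> \<bullet> p\<close>.\<close>
  obtain g :: "real \<Rightarrow> real" where g: "continuous_on UNIV g" "\<And>s. s \<in> {c..d} \<Longrightarrow> 0 \<le> g s"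
    "finite {s\<in>{c..d}. g s = 0}"
    and eq: "integral {0..T} (\<lambda>t. g (\<theta> t)) =
      (prim g a - prim g c) + (prim g d - prim g c) + (prim g d - prim g b)"
  proof (cases "len a b c d < T")
    case False
    have one: "prim (\<lambda>_. 1) s = s" for s :: real by (auto simp: prim_def)
    have "len a b c d \<le> T"
    proof (cases "tc \<le> td")
      case True
      then show ?thesis
        using parts[of "\<lambda>_. 1" tc td] tc(1) td(1) unfolding one len_def a_def b_def c_def d_def by auto
    next
      case False
      then show ?thesis
        using parts[of "\<lambda>_. 1" td tc] tc(1) td(1) abcd unfolding one len_def a_def b_def c_def d_def by auto
    qed
    then have "T = len a b c d" using False by simp
    then show ?thesis
      using T by (intro that[of "\<lambda>_. 1"]) (auto simp: one len_def)
  next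
    case True
    define r where "r = T - len a b c d"
    have r: "0 < r" using True by (simp add: r_def)
    obtain \<psi> where \<psi>: "norm \<psi> = 1"
      "\<And>s. s \<in> {c..d} \<Longrightarrow> r * (\<psi> \<bullet> p s) \<le> \<psi> \<bullet> (disp \<theta> T - base a b c d)"
      using separation[OF opt, of c d] abcd True unfolding a_def[symmetric] b_def[symmetric] r_def by metis
    \<comment> \<open>Chosen so that \<open>h\<close> times the surplus time equals \<psi> of the
      surplus displacement; this is the equality of weighted integrals that follows.\<close>
    define h where "h = \<psi> \<bullet> (disp \<theta> T - base a b c d) / r"
    let ?g = "\<lambda>s. h - \<psi> \<bullet> p s"
    have cg: "continuous_on UNIV ?g" by (intro continuous_on_diff continuous_on_const cont_inner)
    have "finite {s\<in>{c..d}. \<psi> \<bullet> p s = h}"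
      using \<psi>(1) by (intro finite_level) auto
    then have fin: "finite {s\<in>{c..d}. ?g s = 0}"
      by (rule rev_finite_subset) auto
    have ip: "(\<lambda>t. p (\<theta> t)) integrable_on {0..T}"
      by (intro integrable_continuous_interval continuous_on_compose2[OF cont c\<theta>]) auto
    have "((\<lambda>t. h - \<psi> \<bullet> p (\<theta> t)) has_integral (T - 0) *\<^sub>R h - \<psi> \<bullet> disp \<theta> T) {0..T}"
      unfolding disp_def
      using T has_integral_linear[OF integrable_integral[OF ip] bounded_linear_inner_right[of \<psi>]]
        has_integral_const_real[of h 0 T]
      by (intro has_integral_diff) (simp_all add: o_def)
    then have "integral {0..T} (\<lambda>t. ?g (\<theta> t)) = h * T - \<psi> \<bullet> disp \<theta> T"
      by (simp add: integral_unique mult.commute)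
    also have "\<dots> = h * len a b c d - \<psi> \<bullet> base a b c d"
      using r unfolding h_def r_def by (simp add: field_simps inner_diff_right)
    also have "\<dots> = (prim ?g a - prim ?g c) + (prim ?g d - prim ?g c) + (prim ?g d - prim ?g b)"
      unfolding prim_affine[OF cont] len_def base_def inner_diff_right inner_add_right
      by (simp add: algebra_simps)
    finally show ?thesis
      using that[OF cg _ fin] \<psi>(2) r by (simp add: h_def field_simps)
  qed
  note ex = adm_path_seg_exists[OF g adm range]
  have monog: "prim g x \<le> prim g y" if "c \<le> x" "x \<le> y" "y \<le> d" for x y
    using prim_strict_mono[OF g, of x y] that by (cases "x = y") auto
  show ?thesis
  proof (cases "tc \<le> td")
    case True
    note pt = parts[OF g(1,2), of tc td]
    have "integral {0..tc} (\<lambda>t. g (\<theta> t)) = (-1) * (prim g (\<theta> tc) - prim g (\<theta> 0))"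
      "integral {tc..td} (\<lambda>t. g (\<theta> t)) = 1 * (prim g (\<theta> td) - prim g (\<theta> tc))"
      "integral {td..T} (\<lambda>t. g (\<theta> t)) = (-1) * (prim g (\<theta> T) - prim g (\<theta> td))"
      using pt eq tc(1) td(1) True unfolding a_def b_def c_def d_def by auto
    then show ?thesis
      using ex[of 0 tc "-1"] ex[of tc td 1] ex[of td T "-1"] tc(1) td(1) True zigzag[of tc td] by auto
  next
    case False
    \<comment> \<open>With the maximum first, the lower bounds of the three pieces add up to the
      least value plus \<open>2 * (prim g b - prim g a)\<close>. As \<open>a \<le> b\<close>, this
      forces \<open>a = b\<close>.\<close>
    note pt = parts[OF g(1,2), of td tc]
    have le: "prim g a \<le> prim g b" using abcd by (intro monog) auto
    have ints: "integral {0..td} (\<lambda>t. g (\<theta> t)) = 1 * (prim g (\<theta> td) - prim g (\<theta> 0))"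
      "integral {td..tc} (\<lambda>t. g (\<theta> t)) = (-1) * (prim g (\<theta> tc) - prim g (\<theta> td))"
      "integral {tc..T} (\<lambda>t. g (\<theta> t)) = 1 * (prim g (\<theta> T) - prim g (\<theta> tc))"
      and "prim g a = prim g b"
      using pt eq tc(1) td(1) False le unfolding a_def b_def c_def d_def by auto
    then have "a = b" using prim_strict_mono[OF g, of a b] abcd by force
    then show ?thesis
      using ints ex[of 0 td 1] ex[of td tc "-1"] ex[of tc T 1] tc(1) td(1) False zagzig[of td tc]
      by (auto simp: a_def b_def)
  qed
qed

end

subsection \<open>First-order conditions at the dwells\<close>

context sc_curve
begin

text \<open>The outcome of \<open>separation\<close> for all ranges at once. No path occurs in it,
  only endpoints, displacement and time, so the range can be varied freely and the statement can be
  reflected.\<close>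

definition separable :: "real \<Rightarrow> real \<Rightarrow> complex \<Rightarrow> real \<Rightarrow> bool" where
  "separable a b W T \<longleftrightarrow> (\<forall>c d. c \<le> a \<longrightarrow> c \<le> d \<longrightarrow> b \<le> d \<longrightarrow> len a b c d < T \<longrightarrow>
     (\<exists>\<psi>. norm \<psi> = 1 \<and> (\<forall>s\<in>{c..d}. (T - len a b c d) * (\<psi> \<bullet> p s) \<le> \<psi> \<bullet> (W - base a b c d))))"

lemma optimal_imp_separable:
  assumes "optimal \<theta> T"
  shows "separable (\<theta> 0) (\<theta> T) (disp \<theta> T) T"
  unfolding separable_def
proof (intro allI impI)
  fix c d assume *: "c \<le> \<theta> 0" "c \<le> d" "\<theta> T \<le> d" "len (\<theta> 0) (\<theta> T) c d < T"
  show "\<exists>\<psi>. norm \<psi> = 1 \<and> (\<forall>s\<in>{c..d}. (T - len (\<theta> 0) (\<theta> T) c d) * (\<psi> \<bullet> p s) \<le>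
      \<psi> \<bullet> (disp \<theta> T - base (\<theta> 0) (\<theta> T) c d))"
    by (rule separation[OF assms *]) (intro exI conjI ballI)
qed

lemma bounded_curve: obtains B where "0 < B" "\<And>s. norm (p s) \<le> B"
proof -
  have "compact (p ` {0..P})"
    by (intro compact_continuous_image continuous_on_subset[OF cont]) auto
  then obtain B where B: "0 < B" "\<forall>x\<in>p ` {0..P}. norm x \<le> B"
    using compact_imp_bounded bounded_pos by metis
  have "norm (p s) \<le> B" for s
    using reduce[of 0 s] B(2) per_int[of s]
    by (metis add_0 atLeastAtMost_iff image_eqI less_imp_le)
  then show ?thesis using that B(1) by blast
qed

lemma prim_mean_value:
  fixes F :: "real \<Rightarrow> real"
  assumes F: "continuous_on UNIV F"
  shows "\<exists>x. min u v \<le> x \<and> x \<le> max u v \<and> prim F v - prim F u = F x * (v - u)"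
proof -
  have *: "\<exists>x. u \<le> x \<and> x \<le> v \<and> prim F v - prim F u = F x * (v - u)" if "u < v" for u v
  proof -
    have "(prim F has_real_derivative F x) (at x)" for x
      using prim_has_vector_derivative[OF F, of x UNIV]
      by (simp add: has_real_derivative_iff_has_vector_derivative)
    then show ?thesis
      using MVT2[OF that, of "prim F" F] by (auto simp: mult.commute intro: less_imp_le)
  qed
  consider "u < v" | "v < u" | "u = v" by linarith
  then show ?thesis
  proof cases
    case 1
    then show ?thesis using *[of u v] by auto
  next
    case 2
    then obtain x where "v \<le> x" "x \<le> u" "prim F u - prim F v = F x * (u - v)" using *[of v u] by auto
    then show ?thesis using 2 by (intro exI[of _ x]) (auto simp: algebra_simps)
  qed auto
qed

lemma sum_list_affine:
  "(\<Sum>(l, r)\<leftarrow>D. r * (h - \<psi> \<bullet> p l)) = h * (\<Sum>(l, r)\<leftarrow>D. r) - \<psi> \<bullet> (\<Sum>(l, r)\<leftarrow>D. r *\<^sub>R p l)"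
  by (induction D) (auto simp: algebra_simps inner_add_right)

lemma sum_list_nonneg_ge:
  fixes f :: "'b \<times> real \<Rightarrow> real"
  assumes "\<And>x. x \<in> set D \<Longrightarrow> 0 \<le> f x" "y \<in> set D"
  shows "f y \<le> sum_list (map f D)"
  using assms
proof (induction D)
  case (Cons x D)
  have "0 \<le> sum_list (map f D)" "0 \<le> f x"
    using Cons.prems(1) by (auto intro!: sum_list_nonneg)
  moreover have "y = x \<or> f y \<le> sum_list (map f D)"
    using Cons.IH Cons.prems by auto
  ultimately show ?case by auto
qed simp

text \<open>The identity \<open>h * r' = \<psi> \<bullet> W'\<close> for the perturbed range,
  expanded around the old one. Each end of the range belongs to two arcs of
  \<open>a \<rightarrow> c \<rightarrow> d \<rightarrow> b\<close>, hence the factors 2, and the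
  mean values \<open>x\<close>, \<open>y\<close> replace integrals over the added or removed pieces.
  The margins \<open>R / 8\<close> leave a surplus time of at least \<open>R / 2\<close>, which
  bounds \<open>h\<close>.\<close>

lemma variation:
  assumes sep: "separable a b (base a b c d + (\<Sum>(l, r)\<leftarrow>D. r *\<^sub>R p l)) (len a b c d + R)"
    and R: "R = (\<Sum>(l, r)\<leftarrow>D. r)" "0 < R" "\<forall>(l, r)\<in>set D. 0 \<le> r" and ab: "a \<le> b"
    and c': "c' \<le> a" "b \<le> d'" "\<bar>c' - c\<bar> \<le> R / 8" "\<bar>d' - d\<bar> \<le> R / 8"
    and B: "0 < B" "\<And>s. norm (p s) \<le> B"
  shows "\<exists>\<psi> h x y. norm \<psi> = 1 \<and> (\<forall>s\<in>{c'..d'}. \<psi> \<bullet> p s \<le> h) \<and> \<bar>h\<bar> \<le> 4 * B \<and>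
    min c c' \<le> x \<and> x \<le> max c c' \<and> min d d' \<le> y \<and> y \<le> max d d' \<and>
    (\<Sum>(l, r)\<leftarrow>D. r * (h - \<psi> \<bullet> p l)) + 2 * (h - \<psi> \<bullet> p x) * (c' - c) + 2 * (h - \<psi> \<bullet> p y) * (d - d') = 0"
proof -
  define r' where "r' = R + 2 * (c' - c) + 2 * (d - d')"
  define W' where "W' = (\<Sum>(l, r)\<leftarrow>D. r *\<^sub>R p l) + 2 *\<^sub>R (prim p c' - prim p c) + 2 *\<^sub>R (prim p d - prim p d')"
  have r': "R / 2 \<le> r'" using c'(3,4) unfolding r'_def abs_le_iff by argo
  have r'0: "0 < r'" using r' R by simp
  have 1: "len a b c d + R - len a b c' d' = r'" by (simp add: r'_def len_def)
  have 2: "base a b c d + (\<Sum>(l, r)\<leftarrow>D. r *\<^sub>R p l) - base a b c' d' = W'"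
    unfolding W'_def base_def scaleR_2 by simp
  have 3: "len a b c' d' < len a b c d + R" using 1 r'0 by simp
  have "c' \<le> d'" using c' ab by simp
  with c'(1,2) 3 obtain \<psi> where \<psi>: "norm \<psi> = 1" "\<forall>s\<in>{c'..d'}. r' * (\<psi> \<bullet> p s) \<le> \<psi> \<bullet> W'"
    using sep unfolding separable_def 1[symmetric] 2[symmetric] by blast
  define h where "h = \<psi> \<bullet> W' / r'"
  have le: "\<forall>s\<in>{c'..d'}. \<psi> \<bullet> p s \<le> h"
    using \<psi>(2) r'0 by (simp add: h_def pos_le_divide_eq mult.commute)
  let ?F = "\<lambda>s. h - \<psi> \<bullet> p s"
  have cF: "continuous_on UNIV ?F" by (intro continuous_on_diff continuous_on_const cont_inner)
  obtain x where x: "min c c' \<le> x" "x \<le> max c c'" "prim ?F c' - prim ?F c = ?F x * (c' - c)"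
    using prim_mean_value[OF cF] by blast
  obtain y where y: "min d d' \<le> y" "y \<le> max d d'" "prim ?F d - prim ?F d' = ?F y * (d - d')"
    using prim_mean_value[OF cF, of d' d] by (auto simp: min.commute max.commute)
  have "h * r' = \<psi> \<bullet> W'" using r'0 by (simp add: h_def)
  then have eq: "(\<Sum>(l, r)\<leftarrow>D. r * ?F l) + 2 * ?F x * (c' - c) + 2 * ?F y * (d - d') = 0"
    unfolding sum_list_affine R(1)[symmetric]
    using x(3) y(3) unfolding prim_affine[OF cont] r'_def W'_def
    by (simp add: inner_add_right inner_diff_right algebra_simps)
  have bd: "\<bar>\<psi> \<bullet> p s\<bar> \<le> B" for s
    using Cauchy_Schwarz_ineq2[of \<psi> "p s"] B(2)[of s] \<psi>(1) by simp
  have "\<bar>\<psi> \<bullet> (\<Sum>(l, r)\<leftarrow>D. r *\<^sub>R p l)\<bar> \<le> B * (\<Sum>(l, r)\<leftarrow>D. r)"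
    using R(3)
  proof (induction D)
    case (Cons x D)
    obtain l r where [simp]: "x = (l, r)" by (cases x)
    have "\<bar>r * (\<psi> \<bullet> p l)\<bar> \<le> r * B"
      using Cons.prems bd[of l] by (simp add: abs_mult mult_left_mono)
    then show ?case using Cons by (simp add: inner_add_right algebra_simps)
  qed simp
  then have S: "\<bar>\<psi> \<bullet> (\<Sum>(l, r)\<leftarrow>D. r *\<^sub>R p l)\<bar> \<le> B * R" by (simp add: R(1))
  have "h * r' = \<psi> \<bullet> (\<Sum>(l, r)\<leftarrow>D. r *\<^sub>R p l) + 2 * ((\<psi> \<bullet> p x) * (c' - c)) + 2 * ((\<psi> \<bullet> p y) * (d - d'))"
    using eq unfolding sum_list_affine R(1)[symmetric] r'_def by (simp add: algebra_simps)
  moreover have "\<bar>(\<psi> \<bullet> p x) * (c' - c)\<bar> \<le> B * (R / 8)" "\<bar>(\<psi> \<bullet> p y) * (d - d')\<bar> \<le> B * (R / 8)"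
    using c'(3,4) bd B unfolding abs_mult by (intro mult_mono; simp add: abs_minus_commute)+
  ultimately have "\<bar>h * r'\<bar> \<le> 2 * (B * R)" using S by linarith
  moreover have "\<bar>h\<bar> * (R / 2) \<le> \<bar>h * r'\<bar>"
    unfolding abs_mult using r' r'0 by (intro mult_left_mono) auto
  ultimately have "\<bar>h\<bar> * R \<le> (4 * B) * R" by simp
  then have "\<bar>h\<bar> \<le> 4 * B" using R(2) by simp
  with \<psi>(1) le x(1,2) y(1,2) eq show ?thesis by blast
qed

text \<open>In the limit the end terms of the balance vanish, so the nonnegative defects weighted by
  the dwell times sum to 0 and every dwell sits at the maximum over \<open>{c..d}\<close>. The
  perturbed data are returned as well: their end terms, divided by the size of the perturbation,
  carry the first-order information.\<close>

lemma variation_limit: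
  assumes sep: "separable a b (base a b c d + (\<Sum>(l, r)\<leftarrow>D. r *\<^sub>R p l)) (len a b c d + R)"
    and R: "R = (\<Sum>(l, r)\<leftarrow>D. r)" "0 < R" and D: "\<forall>(l, r)\<in>set D. 0 \<le> r \<and> c \<le> l \<and> l \<le> d"
    and ab: "a \<le> b" and cd: "c < d"
    and cs: "\<And>n. cs n \<le> a" "\<And>n. b \<le> ds n" "\<And>n. \<bar>cs n - c\<bar> \<le> R / 8" "\<And>n. \<bar>ds n - d\<bar> \<le> R / 8"
    and lim: "cs \<longlonglongrightarrow> c" "ds \<longlonglongrightarrow> d"
    and B: "0 < B" "\<And>s. norm (p s) \<le> B"
  obtains \<phi> :: "nat \<Rightarrow> nat" and \<psi>s hs xs ys \<psi> h where "strict_mono \<phi>"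
    "\<And>n. norm (\<psi>s n) = 1" "\<And>n s. cs (\<phi> n) \<le> s \<Longrightarrow> s \<le> ds (\<phi> n) \<Longrightarrow> \<psi>s n \<bullet> p s \<le> hs n"
    "\<And>n. \<bar>hs n\<bar> \<le> 4 * B" "\<And>n. min c (cs (\<phi> n)) \<le> xs n" "\<And>n. xs n \<le> max c (cs (\<phi> n))"
    "xs \<longlonglongrightarrow> c" "ys \<longlonglongrightarrow> d"
    "\<And>n. (\<Sum>(l, r)\<leftarrow>D. r * (hs n - \<psi>s n \<bullet> p l)) + 2 * (hs n - \<psi>s n \<bullet> p (xs n)) * (cs (\<phi> n) - c) +
       2 * (hs n - \<psi>s n \<bullet> p (ys n)) * (d - ds (\<phi> n)) = 0"
    "\<psi>s \<longlonglongrightarrow> \<psi>" "hs \<longlonglongrightarrow> h" "norm \<psi> = 1" "\<And>s. c \<le> s \<Longrightarrow> s \<le> d \<Longrightarrow> \<psi> \<bullet> p s \<le> h"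
    "\<And>l r. (l, r) \<in> set D \<Longrightarrow> 0 < r \<Longrightarrow> \<psi> \<bullet> p l = h"
proof -
  have D0: "\<forall>(l, r)\<in>set D. 0 \<le> r" using D by auto
  have "\<exists>\<psi> h x y. norm \<psi> = 1 \<and> (\<forall>s\<in>{cs n..ds n}. \<psi> \<bullet> p s \<le> h) \<and> \<bar>h\<bar> \<le> 4 * B \<and>
    min c (cs n) \<le> x \<and> x \<le> max c (cs n) \<and> min d (ds n) \<le> y \<and> y \<le> max d (ds n) \<and>
    (\<Sum>(l, r)\<leftarrow>D. r * (h - \<psi> \<bullet> p l)) + 2 * (h - \<psi> \<bullet> p x) * (cs n - c) + 2 * (h - \<psi> \<bullet> p y) * (d - ds n) = 0" for n
    by (rule variation[OF sep R D0 ab cs B])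
  then obtain \<Psi> H X Y where all: "\<And>n. norm (\<Psi> n) = 1 \<and> (\<forall>s\<in>{cs n..ds n}. \<Psi> n \<bullet> p s \<le> H n) \<and> \<bar>H n\<bar> \<le> 4 * B \<and>
    min c (cs n) \<le> X n \<and> X n \<le> max c (cs n) \<and> min d (ds n) \<le> Y n \<and> Y n \<le> max d (ds n) \<and>
    (\<Sum>(l, r)\<leftarrow>D. r * (H n - \<Psi> n \<bullet> p l)) + 2 * (H n - \<Psi> n \<bullet> p (X n)) * (cs n - c) + 2 * (H n - \<Psi> n \<bullet> p (Y n)) * (d - ds n) = 0"
    by metis
  have all1: "norm (\<Psi> n) = 1" and all2: "\<And>s. cs n \<le> s \<Longrightarrow> s \<le> ds n \<Longrightarrow> \<Psi> n \<bullet> p s \<le> H n"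
    and all3: "\<bar>H n\<bar> \<le> 4 * B"
    and all4: "min c (cs n) \<le> X n" "X n \<le> max c (cs n)" "min d (ds n) \<le> Y n" "Y n \<le> max d (ds n)"
    and all5: "(\<Sum>(l, r)\<leftarrow>D. r * (H n - \<Psi> n \<bullet> p l)) + 2 * (H n - \<Psi> n \<bullet> p (X n)) * (cs n - c) +
      2 * (H n - \<Psi> n \<bullet> p (Y n)) * (d - ds n) = 0" for n
    using all[of n] by (simp_all only: atLeastAtMost_iff Ball_def)
  define S where "S = sphere (0::complex) 1 \<times> {-(4*B)..4*B}"
  have "compact S" unfolding S_def by (intro compact_Times) auto
  then have "seq_compact S" by (rule compact_imp_seq_compact)
  moreover have "\<forall>n. (\<Psi> n, H n) \<in> S"
    unfolding S_def using all1 all3 by (simp add: abs_le_iff minus_le_iff)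
  ultimately have "\<exists>q\<in>S. \<exists>\<phi>. strict_mono (\<phi> :: nat \<Rightarrow> nat) \<and> ((\<lambda>n. (\<Psi> n, H n)) \<circ> \<phi>) \<longlonglongrightarrow> q"
    unfolding seq_compact_def by (elim allE[of _ "\<lambda>n. (\<Psi> n, H n)"]) simp
  then obtain q \<phi> where q: "q \<in> S" "strict_mono (\<phi> :: nat \<Rightarrow> nat)" "((\<lambda>n. (\<Psi> n, H n)) \<circ> \<phi>) \<longlonglongrightarrow> q"
    by blast
  define \<psi> h where "\<psi> = fst q" and "h = snd q"
  have lim\<psi>: "(\<lambda>n. \<Psi> (\<phi> n)) \<longlonglongrightarrow> \<psi>" and limh: "(\<lambda>n. H (\<phi> n)) \<longlonglongrightarrow> h"
    using tendsto_fst[OF q(3)] tendsto_snd[OF q(3)] by (simp_all add: o_def \<psi>_def h_def)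
  have \<psi>1: "norm \<psi> = 1" using q(1) by (auto simp: \<psi>_def S_def)
  have limc: "(\<lambda>n. cs (\<phi> n)) \<longlonglongrightarrow> c" and limd: "(\<lambda>n. ds (\<phi> n)) \<longlonglongrightarrow> d"
    using LIMSEQ_subseq_LIMSEQ[OF lim(1) q(2)] LIMSEQ_subseq_LIMSEQ[OF lim(2) q(2)] by (simp_all add: o_def)
  have limx: "(\<lambda>n. X (\<phi> n)) \<longlonglongrightarrow> c"
  proof (rule tendsto_sandwich)
    show "(\<lambda>n. min c (cs (\<phi> n))) \<longlonglongrightarrow> c" "(\<lambda>n. max c (cs (\<phi> n))) \<longlonglongrightarrow> c"
      using tendsto_min[OF tendsto_const[of c] limc] tendsto_max[OF tendsto_const[of c] limc] by simp_all
  qed (use all4 in simp_all)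
  have limy: "(\<lambda>n. Y (\<phi> n)) \<longlonglongrightarrow> d"
  proof (rule tendsto_sandwich)
    show "(\<lambda>n. min d (ds (\<phi> n))) \<longlonglongrightarrow> d" "(\<lambda>n. max d (ds (\<phi> n))) \<longlonglongrightarrow> d"
      using tendsto_min[OF tendsto_const[of d] limd] tendsto_max[OF tendsto_const[of d] limd] by simp_all
  qed (use all4 in simp_all)
  have limF: "(\<lambda>n. H (\<phi> n) - \<Psi> (\<phi> n) \<bullet> p (z n)) \<longlonglongrightarrow> h - \<psi> \<bullet> p z0" if "z \<longlonglongrightarrow> z0" for z z0
  proof -
    have "isCont p z0" using cont by (simp add: continuous_on_eq_continuous_at)
    then have "(\<lambda>n. p (z n)) \<longlonglongrightarrow> p z0" using that by (rule isCont_tendsto_compose)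
    then show ?thesis by (intro tendsto_intros lim\<psi> limh)
  qed
  \<comment> \<open>The perturbed ranges may be smaller, so the inequality passes to the limit at
    interior headings first and reaches the ends by continuity.\<close>
  have le_open: "\<psi> \<bullet> p s \<le> h" if "c < s" "s < d" for s
  proof -
    have "eventually (\<lambda>n. cs (\<phi> n) < s) sequentially" "eventually (\<lambda>n. s < ds (\<phi> n)) sequentially"
      using order_tendstoD[OF limc] order_tendstoD[OF limd] that by auto
    then have "eventually (\<lambda>n. 0 \<le> H (\<phi> n) - \<Psi> (\<phi> n) \<bullet> p s) sequentially"
      by eventually_elim (simp add: all2)
    then have "0 \<le> h - \<psi> \<bullet> p s"
      by (rule tendsto_lowerbound[OF limF[OF tendsto_const]]) simp
    then show ?thesis by simp
  qed
  have le: "\<psi> \<bullet> p s \<le> h" if "c \<le> s" "s \<le> d" for s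
  proof -
    have "closure {c<..<d} \<subseteq> {s. \<psi> \<bullet> p s \<le> h}"
    proof (rule closure_minimal)
      show "closed {s. \<psi> \<bullet> p s \<le> h}"
        using continuous_closed_vimage[of "{..h}" "\<lambda>s. \<psi> \<bullet> p s"] cont_inner[of UNIV \<psi>]
        by (simp add: vimage_def continuous_on_eq_continuous_at)
    qed (use le_open in auto)
    then show ?thesis using cd that by (auto simp: closure_greaterThanLessThan)
  qed
  have "(\<lambda>n. (\<Sum>(l, r)\<leftarrow>D. r * (H (\<phi> n) - \<Psi> (\<phi> n) \<bullet> p l)) + 2 * (H (\<phi> n) - \<Psi> (\<phi> n) \<bullet> p (X (\<phi> n))) * (cs (\<phi> n) - c) +
       2 * (H (\<phi> n) - \<Psi> (\<phi> n) \<bullet> p (Y (\<phi> n))) * (d - ds (\<phi> n)))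
     \<longlonglongrightarrow> (h * (\<Sum>(l, r)\<leftarrow>D. r) - \<psi> \<bullet> (\<Sum>(l, r)\<leftarrow>D. r *\<^sub>R p l)) + 2 * (h - \<psi> \<bullet> p c) * (c - c) + 2 * (h - \<psi> \<bullet> p d) * (d - d)"
    unfolding sum_list_affine
    by (intro tendsto_intros lim\<psi> limh limc limd limF limx limy)
  moreover have "(\<Sum>(l, r)\<leftarrow>D. r * (H (\<phi> n) - \<Psi> (\<phi> n) \<bullet> p l)) + 2 * (H (\<phi> n) - \<Psi> (\<phi> n) \<bullet> p (X (\<phi> n))) * (cs (\<phi> n) - c) +
       2 * (H (\<phi> n) - \<Psi> (\<phi> n) \<bullet> p (Y (\<phi> n))) * (d - ds (\<phi> n)) = 0" for n
    by (rule all5)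
  ultimately have "h * (\<Sum>(l, r)\<leftarrow>D. r) - \<psi> \<bullet> (\<Sum>(l, r)\<leftarrow>D. r *\<^sub>R p l) = 0"
    by (simp add: LIMSEQ_const_iff)
  then have zero: "(\<Sum>(l, r)\<leftarrow>D. r * (h - \<psi> \<bullet> p l)) = 0" unfolding sum_list_affine .
  have atoms: "\<psi> \<bullet> p l = h" if lr: "(l, r) \<in> set D" "0 < r" for l r
  proof -
    have "(\<lambda>(l, r). r * (h - \<psi> \<bullet> p l)) (l, r) \<le> (\<Sum>(l, r)\<leftarrow>D. r * (h - \<psi> \<bullet> p l))"
      using D le by (intro sum_list_nonneg_ge lr) (auto intro!: mult_nonneg_nonneg)
    then have "r * (h - \<psi> \<bullet> p l) \<le> 0" using zero by simp
    then have "h - \<psi> \<bullet> p l \<le> 0" using lr(2) by (simp add: mult_le_0_iff)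
    moreover have "\<psi> \<bullet> p l \<le> h" using D lr by (intro le) auto
    ultimately show ?thesis by simp
  qed
  show ?thesis
    by (rule that[of \<phi> "\<lambda>n. \<Psi> (\<phi> n)" "\<lambda>n. H (\<phi> n)" "\<lambda>n. X (\<phi> n)" "\<lambda>n. Y (\<phi> n)" \<psi> h])
      (fact q(2) all1 all2 all3 all4 all5 lim\<psi> limh limx limy \<psi>1 le atoms)+
qed

text \<open>The new end is a point farthest from \<open>p c\<close>, so its chord dominates all
  chords on the extension. The bound \<open>P / 2\<close> makes this chord nonzero, and
  \<open>(\<delta> / (2 * B))\<^sup>2\<close> turns the trivial chord bound \<open>2 * B\<close>
  into the estimate with \<open>sqrt e\<close>.\<close>

lemma small_extension:
  assumes \<delta>: "0 < \<delta>" and B: "0 < B" "\<And>s. norm (p s) \<le> B"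
  obtains e where "0 < e" "e \<le> \<delta>" "p (c - e) \<noteq> p c" "sqrt e * norm (p (c - e) - p c) \<le> \<delta>"
    "\<And>s. c - e \<le> s \<Longrightarrow> s \<le> c \<Longrightarrow> norm (p s - p c) \<le> norm (p (c - e) - p c)"
proof -
  define \<delta>' where "\<delta>' = min (min \<delta> (P / 2)) ((\<delta> / (2 * B))\<^sup>2)"
  have \<delta>': "0 < \<delta>'" using \<delta> B P_pos by (simp add: \<delta>'_def)
  have "continuous_on {c-\<delta>'..c} (\<lambda>s. norm (p s - p c))"
    by (intro continuous_on_norm continuous_on_diff continuous_on_const continuous_on_subset[OF cont]) auto
  then obtain s0 where s0: "s0 \<in> {c-\<delta>'..c}" "\<forall>s\<in>{c-\<delta>'..c}. norm (p s - p c) \<le> norm (p s0 - p c)"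
    using continuous_attains_sup[OF compact_Icc, of "c - \<delta>'" c "\<lambda>s. norm (p s - p c)"] \<delta>' by auto
  have "p (c - \<delta>') \<noteq> p c"
    using \<delta>' P_pos by (intro inj_near) (auto simp: \<delta>'_def min_def)
  then have "0 < norm (p (c - \<delta>') - p c)" by simp
  moreover have "norm (p (c - \<delta>') - p c) \<le> norm (p s0 - p c)" using s0(2) \<delta>' by simp
  ultimately have ne: "0 < norm (p s0 - p c)" by linarith
  define e where "e = c - s0"
  have e: "0 < e" "e \<le> \<delta>'" using s0 ne by (auto simp: e_def less_le)
  have "sqrt e \<le> sqrt ((\<delta> / (2 * B))\<^sup>2)" using e(2) by (intro real_sqrt_le_mono) (simp add: \<delta>'_def)
  then have "sqrt e \<le> \<delta> / (2 * B)" using \<delta> B by simp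
  moreover have "norm (p s0 - p c) \<le> 2 * B"
    using norm_triangle_ineq4[of "p s0" "p c"] B(2)[of s0] B(2)[of c] by simp
  ultimately have "sqrt e * norm (p s0 - p c) \<le> \<delta> / (2 * B) * (2 * B)"
    using \<delta> B by (intro mult_mono) auto
  then have "sqrt e * norm (p s0 - p c) \<le> \<delta>" using B(1) by simp
  then show ?thesis
    using that[of e] e ne s0 by (auto simp: e_def \<delta>'_def)
qed

section \<open>Dwells inside the range and at its ends\<close>

context
  fixes a b c d R B :: real and D :: "(real \<times> real) list"
  assumes sep: "separable a b (base a b c d + (\<Sum>(l, r)\<leftarrow>D. r *\<^sub>R p l)) (len a b c d + R)"
    and R: "R = (\<Sum>(l, r)\<leftarrow>D. r)" "0 < R" and D: "\<forall>(l, r)\<in>set D. 0 \<le> r \<and> c \<le> l \<and> l \<le> d"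
    and ab: "c \<le> a" "a \<le> b" "b \<le> d" and cd: "c < d"
    and B: "0 < B" "\<And>s. norm (p s) \<le> B"
begin

definition atoms :: "real set" where
  "atoms = {l. \<exists>r. (l, r) \<in> set D \<and> 0 < r}"

text \<open>There are finitely many dwells, so an end of the range that carries none keeps a
  positive distance from all of them and may be moved inward by \<eta>.\<close>

lemma atoms_gap:
  obtains \<eta> where "0 < \<eta>" "d \<notin> atoms \<Longrightarrow> \<forall>l\<in>atoms. l \<le> d - \<eta>" "c \<notin> atoms \<Longrightarrow> \<forall>l\<in>atoms. c + \<eta> \<le> l"
proof -
  have "atoms \<subseteq> fst ` set D" by (force simp: atoms_def)
  then have fin: "finite atoms" by (rule finite_subset) auto
  have rng: "\<forall>l\<in>atoms. c \<le> l \<and> l \<le> d" using D by (fastforce simp: atoms_def)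
  define m where "m = Max (insert c (atoms - {d}))"
  define m' where "m' = Min (insert d (atoms - {c}))"
  have "m \<in> insert c (atoms - {d})" unfolding m_def by (rule Max_in) (use fin in auto)
  then have m: "m < d" using rng cd by fastforce
  have "m' \<in> insert d (atoms - {c})" unfolding m'_def by (rule Min_in) (use fin in auto)
  then have m': "c < m'" using rng cd by fastforce
  have "l \<le> m" if "d \<notin> atoms" "l \<in> atoms" for l
    unfolding m_def using fin that by (intro Max_ge) auto
  moreover have "m' \<le> l" if "c \<notin> atoms" "l \<in> atoms" for l
    unfolding m'_def using fin that by (intro Min_le) auto
  ultimately show ?thesis
    using m m' by (intro that[of "min (d - m) (m' - c)"]) force+
qed

lemma atoms_sum_nonneg:
  assumes "\<And>l. l \<in> atoms \<Longrightarrow> \<psi> \<bullet> p l \<le> h"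
  shows "0 \<le> (\<Sum>(l, r)\<leftarrow>D. r * (h - \<psi> \<bullet> p l))" 
    "(l1, r1) \<in> set D \<Longrightarrow> r1 * (h - \<psi> \<bullet> p l1) \<le> (\<Sum>(l, r)\<leftarrow>D. r * (h - \<psi> \<bullet> p l))"
proof -
  have *: "0 \<le> (\<lambda>(l, r). r * (h - \<psi> \<bullet> p l)) x" if "x \<in> set D" for x
  proof -
    obtain l r where x: "x = (l, r)" by (cases x)
    have "r = 0 \<or> l \<in> atoms" "0 \<le> r" using D that x by (auto simp: atoms_def less_le)
    then show ?thesis using assms[of l] by (auto simp: x)
  qed
  show "0 \<le> (\<Sum>(l, r)\<leftarrow>D. r * (h - \<psi> \<bullet> p l))"
    using * by (intro sum_list_nonneg) auto
  show "(l1, r1) \<in> set D \<Longrightarrow> r1 * (h - \<psi> \<bullet> p l1) \<le> (\<Sum>(l, r)\<leftarrow>D. r * (h - \<psi> \<bullet> p l))"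
    using sum_list_nonneg_ge[of D "\<lambda>(l, r). r * (h - \<psi> \<bullet> p l)" "(l1, r1)"] * by auto
qed

lemma tendsto_defect:
  assumes "\<psi>s \<longlonglongrightarrow> \<psi>" "hs \<longlonglongrightarrow> h" "z \<longlonglongrightarrow> z0"
  shows "(\<lambda>n. hs n - \<psi>s n \<bullet> p (z n)) \<longlonglongrightarrow> h - \<psi> \<bullet> p z0"
proof -
  have "isCont p z0" using cont by (simp add: continuous_on_eq_continuous_at)
  then have "(\<lambda>n. p (z n)) \<longlonglongrightarrow> p z0" using assms(3) by (rule isCont_tendsto_compose)
  then show ?thesis by (intro tendsto_intros assms)
qed

text \<open>Ends where the path turns without dwelling are moved inward by a common \<epsilon>. All
  dwells stay in range, so the balance makes the sum of the end defects nonpositive. In the limit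
  each defect is nonnegative, hence 0: the turns lie on the level of the dwells. That level is
  globally maximal, because an interior dwell is a local maximum.\<close>

lemma interior_atom:
  assumes s1: "s1 \<in> atoms" "c < s1" "s1 < d"
  shows "\<exists>\<psi> h. norm \<psi> = 1 \<and> argmax \<psi> s1 \<and> \<psi> \<bullet> p s1 = h \<and> (\<forall>l\<in>atoms. \<psi> \<bullet> p l = h) \<and>
    (c < a \<longrightarrow> \<psi> \<bullet> p c = h) \<and> (b < d \<longrightarrow> \<psi> \<bullet> p d = h)"
proof -
  obtain \<eta> where \<eta>: "0 < \<eta>" "d \<notin> atoms \<Longrightarrow> \<forall>l\<in>atoms. l \<le> d - \<eta>" "c \<notin> atoms \<Longrightarrow> \<forall>l\<in>atoms. c + \<eta> \<le> l"
    using atoms_gap by blast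
  define C where "C \<longleftrightarrow> c < a \<and> c \<notin> atoms"
  define E where "E \<longleftrightarrow> b < d \<and> d \<notin> atoms"
  \<comment> \<open>\<open>R / 8\<close> is the margin of \<open>variation\<close>, \<eta> keeps the
    dwells in range, and \<open>a - c\<close>, \<open>d - b\<close> keep the moved ends below
    \<open>a\<close> and above \<open>b\<close>.\<close>
  define \<delta> where "\<delta> = min (min (R / 8) \<eta>) (min (if C then a - c else 1) (if E then d - b else 1))"
  have \<delta>: "0 < \<delta>" "\<delta> \<le> R / 8" "\<delta> \<le> \<eta>" "C \<Longrightarrow> \<delta> \<le> a - c" "E \<Longrightarrow> \<delta> \<le> d - b"
    using R(2) \<eta>(1) by (auto simp: \<delta>_def C_def E_def)
  define \<epsilon> where "\<epsilon> n = \<delta> * inverse (real (Suc n))" for n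
  have \<epsilon>: "0 < \<epsilon> n" "\<epsilon> n \<le> \<delta>" for n
    using \<delta>(1) by (auto simp: \<epsilon>_def field_simps)
  have lim\<epsilon>: "\<epsilon> \<longlonglongrightarrow> 0"
    unfolding \<epsilon>_def using tendsto_mult_right_zero[OF LIMSEQ_inverse_real_of_nat] by blast
  define cs where "cs n = c + of_bool C * \<epsilon> n" for n
  define ds where "ds n = d - of_bool E * \<epsilon> n" for n
  have limcs: "cs \<longlonglongrightarrow> c" "ds \<longlonglongrightarrow> d"
    unfolding cs_def ds_def using lim\<epsilon> by (auto intro!: tendsto_eq_intros)
  have sd: "cs n \<le> a" "b \<le> ds n" "\<bar>cs n - c\<bar> \<le> R / 8" "\<bar>ds n - d\<bar> \<le> R / 8" for n
    using \<epsilon>[of n] \<delta> ab R by (auto simp: cs_def ds_def)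
  obtain \<phi> :: "nat \<Rightarrow> nat" and \<psi>s hs xs ys \<psi> h where L: "strict_mono \<phi>"
    "\<And>n. norm (\<psi>s n) = 1" "\<And>n s. cs (\<phi> n) \<le> s \<Longrightarrow> s \<le> ds (\<phi> n) \<Longrightarrow> \<psi>s n \<bullet> p s \<le> hs n"
    "xs \<longlonglongrightarrow> c" "ys \<longlonglongrightarrow> d"
    "\<And>n. (\<Sum>(l, r)\<leftarrow>D. r * (hs n - \<psi>s n \<bullet> p l)) + 2 * (hs n - \<psi>s n \<bullet> p (xs n)) * (cs (\<phi> n) - c) +
       2 * (hs n - \<psi>s n \<bullet> p (ys n)) * (d - ds (\<phi> n)) = 0"
    "\<psi>s \<longlonglongrightarrow> \<psi>" "hs \<longlonglongrightarrow> h" "norm \<psi> = 1" "\<And>s. c \<le> s \<Longrightarrow> s \<le> d \<Longrightarrow> \<psi> \<bullet> p s \<le> h"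
    "\<And>l r. (l, r) \<in> set D \<Longrightarrow> 0 < r \<Longrightarrow> \<psi> \<bullet> p l = h"
    by (rule variation_limit[OF sep R D ab(2) cd sd limcs B]; rule that; assumption)
  have at: "\<psi> \<bullet> p l = h" if "l \<in> atoms" for l using L(11) that by (auto simp: atoms_def)
  have in_range: "cs n \<le> l" "l \<le> ds n" if "l \<in> atoms" for l n
  proof -
    have "c \<le> l" "l \<le> d" using D that by (auto simp: atoms_def)
    then show "cs n \<le> l" "l \<le> ds n"
      using \<eta>(2,3) \<epsilon>[of n] \<delta>(3) that by (force simp: cs_def ds_def C_def E_def)+
  qed
  have le0: "of_bool C * (hs n - \<psi>s n \<bullet> p (xs n)) + of_bool E * (hs n - \<psi>s n \<bullet> p (ys n)) \<le> 0" (is "?l \<le> 0") for n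
  proof -
    have "0 \<le> (\<Sum>(l, r)\<leftarrow>D. r * (hs n - \<psi>s n \<bullet> p l))"
      using in_range by (intro atoms_sum_nonneg(1) L(3))
    then have "2 * (hs n - \<psi>s n \<bullet> p (xs n)) * (cs (\<phi> n) - c) + 2 * (hs n - \<psi>s n \<bullet> p (ys n)) * (d - ds (\<phi> n)) \<le> 0"
      using L(6)[of n] by linarith
    then have "(2 * \<epsilon> (\<phi> n)) * ?l \<le> 0" by (simp add: cs_def ds_def algebra_simps)
    then show ?thesis using \<epsilon>[of "\<phi> n"] by (simp add: mult_le_0_iff)
  qed
  have "(\<lambda>n. of_bool C * (hs n - \<psi>s n \<bullet> p (xs n)) + of_bool E * (hs n - \<psi>s n \<bullet> p (ys n))) \<longlonglongrightarrow>
     of_bool C * (h - \<psi> \<bullet> p c) + of_bool E * (h - \<psi> \<bullet> p d)"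
    by (intro tendsto_intros tendsto_defect L)
  then have "of_bool C * (h - \<psi> \<bullet> p c) + of_bool E * (h - \<psi> \<bullet> p d) \<le> 0"
    using le0 by (intro tendsto_upperbound) auto
  moreover have "0 \<le> h - \<psi> \<bullet> p c" "0 \<le> h - \<psi> \<bullet> p d" using L(10) cd by auto
  ultimately have "C \<Longrightarrow> \<psi> \<bullet> p c = h" "E \<Longrightarrow> \<psi> \<bullet> p d = h"
    by (auto simp: of_bool_def split: if_splits)
  then have ends: "c < a \<longrightarrow> \<psi> \<bullet> p c = h" "b < d \<longrightarrow> \<psi> \<bullet> p d = h"
    using at by (auto simp: C_def E_def)
  have "argmax \<psi> s1"
  proof (rule local_max_imp_argmax)
    show "\<psi> \<noteq> 0" using L(9) by auto
    show "0 < min (s1 - c) (d - s1)" using s1 by auto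
    show "\<psi> \<bullet> p s \<le> \<psi> \<bullet> p s1" if "\<bar>s - s1\<bar> < min (s1 - c) (d - s1)" for s
      using L(10)[of s] at[OF s1(1)] that by auto
  qed
  then show ?thesis using L(9) at ends s1(1) by blast
qed

text \<open>If the path dwells at the end \<open>c\<close> of its range, the range is extended by a small \<open>e\<close> beyond
  \<open>c\<close> and, where possible, shrunk at \<open>d\<close> by \<open>sqrt e * \<omega>\<close>, where \<open>\<omega>\<close> is the largest distance from
  \<open>p c\<close> on the added piece.  The cost of the extension is of order \<open>e * \<omega>\<close>, which is small compared
  to the shrinking, which in turn is small compared to the gain \<open>\<omega>\<close> that a non-normal \<open>\<psi>\<close> would allow.\<close>

lemma end_atom:
  assumes s1: "c \<in> atoms"
  shows "\<exists>\<psi> h. norm \<psi> = 1 \<and> argmax \<psi> c \<and> \<psi> \<bullet> p c = h \<and> (\<forall>l\<in>atoms. \<psi> \<bullet> p l = h) \<and>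
    (b < d \<longrightarrow> \<psi> \<bullet> p d = h)"
proof -
  obtain r1 where r1: "(c, r1) \<in> set D" "0 < r1" using s1 by (auto simp: atoms_def)
  obtain \<eta> where \<eta>: "0 < \<eta>" "d \<notin> atoms \<Longrightarrow> \<forall>l\<in>atoms. l \<le> d - \<eta>" "c \<notin> atoms \<Longrightarrow> \<forall>l\<in>atoms. c + \<eta> \<le> l"
    using atoms_gap by blast
  define E where "E \<longleftrightarrow> b < d \<and> d \<notin> atoms"
  \<comment> \<open>With \<open>e n \<le> r1 / 4\<close>, the part of the extension cost
    proportional to the defect at \<open>c\<close> is absorbed by half of the dwell term at
    \<open>c\<close>.\<close>
  define \<delta> where "\<delta> = min (min (R / 8) \<eta>) (min (r1 / 4) (if E then d - b else 1))"
  have \<delta>: "0 < \<delta>" "\<delta> \<le> R / 8" "\<delta> \<le> \<eta>" "\<delta> \<le> r1 / 4" "E \<Longrightarrow> \<delta> \<le> d - b"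
    using R(2) \<eta>(1) r1 by (auto simp: \<delta>_def E_def)
  have "\<exists>e. 0 < e \<and> e \<le> \<delta> * inverse (real (Suc n)) \<and> p (c - e) \<noteq> p c \<and>
      sqrt e * norm (p (c - e) - p c) \<le> \<delta> * inverse (real (Suc n)) \<and>
      (\<forall>s. c - e \<le> s \<longrightarrow> s \<le> c \<longrightarrow> norm (p s - p c) \<le> norm (p (c - e) - p c))" for n
    by (rule small_extension[of "\<delta> * inverse (real (Suc n))" B c, OF _ B]) (use \<delta>(1) in \<open>simp, blast\<close>)
  then obtain e where e: "\<And>n. 0 < e n" "\<And>n. e n \<le> \<delta> * inverse (real (Suc n))" "\<And>n. p (c - e n) \<noteq> p c"
    "\<And>n. sqrt (e n) * norm (p (c - e n) - p c) \<le> \<delta> * inverse (real (Suc n))"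
    "\<And>n s. c - e n \<le> s \<Longrightarrow> s \<le> c \<Longrightarrow> norm (p s - p c) \<le> norm (p (c - e n) - p c)"
    by metis
  define \<omega> where "\<omega> n = norm (p (c - e n) - p c)" for n
  define \<epsilon> where "\<epsilon> n = sqrt (e n) * \<omega> n" for n
  have \<omega>: "0 < \<omega> n" for n using e(3) by (simp add: \<omega>_def)
  have \<epsilon>0: "0 < \<epsilon> n" for n using e(1) \<omega> by (simp add: \<epsilon>_def)
  have inv: "\<delta> * inverse (real (Suc n)) \<le> \<delta>" for n using \<delta>(1) by (auto simp: field_simps)
  have e\<delta>: "e n \<le> \<delta>" "\<epsilon> n \<le> \<delta>" for n
    using e(2,4)[of n] inv[of n] by (auto simp: \<epsilon>_def \<omega>_def)
  have lim\<delta>: "(\<lambda>n. \<delta> * inverse (real (Suc n))) \<longlonglongrightarrow> 0"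
    using tendsto_mult_right_zero[OF LIMSEQ_inverse_real_of_nat] by blast
  have lime: "e \<longlonglongrightarrow> 0"
    by (rule tendsto_sandwich[OF _ _ tendsto_const lim\<delta>]) (use e(1,2) in \<open>auto simp: less_imp_le\<close>)
  have lim\<epsilon>: "\<epsilon> \<longlonglongrightarrow> 0"
    by (rule tendsto_sandwich[OF _ _ tendsto_const lim\<delta>])
      (use \<epsilon>0 e(4) in \<open>auto simp: less_imp_le \<epsilon>_def \<omega>_def\<close>)
  define cs where "cs n = c - e n" for n
  define ds where "ds n = d - of_bool E * \<epsilon> n" for n
  have limcs: "cs \<longlonglongrightarrow> c" "ds \<longlonglongrightarrow> d"
    unfolding cs_def ds_def using lim\<epsilon> lime by (auto intro!: tendsto_eq_intros)
  have sd: "cs n \<le> a" "b \<le> ds n" "\<bar>cs n - c\<bar> \<le> R / 8" "\<bar>ds n - d\<bar> \<le> R / 8" for n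
    using e(1)[of n] e\<delta>[of n] \<epsilon>0[of n] \<delta> ab R by (auto simp: cs_def ds_def)
  obtain \<phi> :: "nat \<Rightarrow> nat" and \<psi>s hs xs ys \<psi> h where L: "strict_mono \<phi>"
    "\<And>n. norm (\<psi>s n) = 1" "\<And>n s. cs (\<phi> n) \<le> s \<Longrightarrow> s \<le> ds (\<phi> n) \<Longrightarrow> \<psi>s n \<bullet> p s \<le> hs n"
    "\<And>n. \<bar>hs n\<bar> \<le> 4 * B" "\<And>n. min c (cs (\<phi> n)) \<le> xs n" "\<And>n. xs n \<le> max c (cs (\<phi> n))"
    "xs \<longlonglongrightarrow> c" "ys \<longlonglongrightarrow> d"
    "\<And>n. (\<Sum>(l, r)\<leftarrow>D. r * (hs n - \<psi>s n \<bullet> p l)) + 2 * (hs n - \<psi>s n \<bullet> p (xs n)) * (cs (\<phi> n) - c) +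
       2 * (hs n - \<psi>s n \<bullet> p (ys n)) * (d - ds (\<phi> n)) = 0"
    "\<psi>s \<longlonglongrightarrow> \<psi>" "hs \<longlonglongrightarrow> h" "norm \<psi> = 1" "\<And>s. c \<le> s \<Longrightarrow> s \<le> d \<Longrightarrow> \<psi> \<bullet> p s \<le> h"
    "\<And>l r. (l, r) \<in> set D \<Longrightarrow> 0 < r \<Longrightarrow> \<psi> \<bullet> p l = h"
    by (rule variation_limit[OF sep R D ab(2) cd sd limcs B]; rule that; assumption)
  have at: "\<psi> \<bullet> p l = h" if "l \<in> atoms" for l using L(14) that by (auto simp: atoms_def)
  have in_range: "cs n \<le> l" "l \<le> ds n" if "l \<in> atoms" for l n
  proof -
    have "c \<le> l" "l \<le> d" using D that by (auto simp: atoms_def)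
    then show "cs n \<le> l" "l \<le> ds n"
      using \<eta>(2) e(1)[of n] e\<delta>[of n] \<delta>(3) that by (force simp: cs_def ds_def E_def)+
  qed
  define u where "u n = e (\<phi> n)" for n
  define w where "w n = \<omega> (\<phi> n)" for n
  have uw: "0 < u n" "0 < w n" "u n \<le> r1 / 4" for n
    using e(1) \<omega> e\<delta>(1)[of "\<phi> n"] \<delta>(4) by (auto simp: u_def w_def)
  have limu: "u \<longlonglongrightarrow> 0"
    using LIMSEQ_subseq_LIMSEQ[OF lime L(1)] by (simp add: o_def u_def[abs_def])
  have limsu: "(\<lambda>n. sqrt (u n)) \<longlonglongrightarrow> 0" using tendsto_real_sqrt[OF limu] by simp
  have bd: "\<bar>\<psi>s n \<bullet> v\<bar> \<le> norm v" for n v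
    using Cauchy_Schwarz_ineq2[of "\<psi>s n" v] L(2)[of n] by simp
  \<comment> \<open>The balance with all dwells but the one at \<open>c\<close> dropped. The defect
    at \<open>xs n\<close> is replaced by the one at \<open>c\<close>, at the price of the chord
    \<open>w n\<close>.\<close>
  have main: "(r1 / 2) * (hs n - \<psi>s n \<bullet> p c) + 2 * (hs n - \<psi>s n \<bullet> p (ys n)) * (of_bool E * (sqrt (u n) * w n)) \<le> 2 * (u n * w n)" for n
  proof -
    define Fc where "Fc = hs n - \<psi>s n \<bullet> p c"
    define Fx where "Fx = hs n - \<psi>s n \<bullet> p (xs n)"
    have "r1 * Fc \<le> (\<Sum>(l, r)\<leftarrow>D. r * (hs n - \<psi>s n \<bullet> p l))"
      unfolding Fc_def using in_range r1(1) by (intro atoms_sum_nonneg(2) L(3))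
    then have 1: "r1 * Fc + 2 * (hs n - \<psi>s n \<bullet> p (ys n)) * (of_bool E * (sqrt (u n) * w n)) \<le> 2 * (u n * Fx)"
      using L(9)[of n] by (simp add: cs_def ds_def u_def w_def \<epsilon>_def Fx_def algebra_simps)
    have "norm (p (xs n) - p c) \<le> w n"
      unfolding w_def \<omega>_def using L(5,6)[of n] e(1)[of "\<phi> n"] by (intro e(5)) (auto simp: cs_def)
    then have "Fx \<le> Fc + w n"
      using bd[of n "p (xs n) - p c"] by (simp add: Fx_def Fc_def inner_diff_right)
    then have "u n * Fx \<le> u n * Fc + u n * w n"
      using uw(1)[of n] by (simp flip: distrib_left)
    moreover have "0 \<le> Fc" using L(3)[OF in_range[OF s1]] by (simp add: Fc_def)
    then have "u n * Fc \<le> (r1 / 4) * Fc" using uw(3) by (intro mult_right_mono)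
    ultimately show ?thesis using 1 by (simp add: Fc_def[symmetric])
  qed
  have Fc0: "0 \<le> hs n - \<psi>s n \<bullet> p c" for n using L(3)[OF in_range[OF s1]] by simp
  have "\<psi> \<bullet> p d = h" if E
  proof -
    \<comment> \<open>The factor \<open>w n\<close> cancels, and the ratio of extension to shrinking
      leaves only \<open>sqrt (u n)\<close>.\<close>
    have "hs n - \<psi>s n \<bullet> p (ys n) \<le> sqrt (u n)" for n
    proof -
      have "0 \<le> r1 / 2 * (hs n - \<psi>s n \<bullet> p c)"
        using Fc0[of n] r1(2) by simp
      then have "2 * (hs n - \<psi>s n \<bullet> p (ys n)) * (sqrt (u n) * w n) \<le> 2 * (u n * w n)"
        using main[of n] that by simp
      also have "\<dots> = (2 * sqrt (u n)) * (sqrt (u n) * w n)"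
        using uw(1)[of n] by simp
      finally show ?thesis
        using uw[of n] by (simp add: mult_le_cancel_right)
    qed
    then have "h - \<psi> \<bullet> p d \<le> 0"
      by (intro tendsto_le[OF _ limsu tendsto_defect[OF L(10,11,8)]]) auto
    moreover have "\<psi> \<bullet> p d \<le> h" using L(13) cd by simp
    ultimately show ?thesis by simp
  qed
  then have ends: "b < d \<longrightarrow> \<psi> \<bullet> p d = h" using at by (auto simp: E_def)
  have "argmax \<psi> c"
  proof (rule ccontr)
    assume neg: "\<not> argmax \<psi> c"
    have \<psi>0: "\<psi> \<noteq> 0" using L(12) by auto
    have mx: "\<psi> \<bullet> p s \<le> \<psi> \<bullet> p c" if "c \<le> s" "s \<le> d" for s using L(13)[OF that] at[OF s1] by simp
    obtain \<kappa> \<zeta> where \<kappa>: "0 < \<kappa>" "0 < \<zeta>"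
      "\<And>s. c - \<zeta> < s \<Longrightarrow> s \<le> c \<Longrightarrow> \<kappa> * norm (p s - p c) \<le> \<psi> \<bullet> p s - \<psi> \<bullet> p c"
      using left_increase[OF \<psi>0 cd mx neg] by blast
    have "(\<lambda>n. norm (\<psi>s n - \<psi>)) \<longlonglongrightarrow> 0"
      using tendsto_norm[OF tendsto_diff[OF L(10) tendsto_const[of \<psi>]]] by simp
    then have ev1: "eventually (\<lambda>n. norm (\<psi>s n - \<psi>) < \<kappa> / 2) sequentially"
      using \<kappa>(1) by (intro order_tendstoD) auto
    have ev2: "eventually (\<lambda>n. u n < \<zeta>) sequentially"
      using \<kappa>(2) limu by (intro order_tendstoD) auto
    \<comment> \<open>If \<open>c\<close> were no global maximum, the perturbed functionals would
      eventually have a defect of at least \<open>\<kappa> / 2 * w n\<close> at \<open>c\<close>.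
      The balance bounds this defect by terms of smaller order than \<open>w n\<close>; dividing by
      \<open>w n\<close> leaves a positive constant below a null sequence.\<close>
    have "eventually (\<lambda>n. r1 * \<kappa> / 4 \<le> 2 * u n + 10 * B * sqrt (u n)) sequentially"
      using ev1 ev2
    proof eventually_elim
      case (elim n)
      let ?v = "p (c - u n) - p c"
      have w: "w n = norm ?v" by (simp add: w_def \<omega>_def u_def)
      have "\<kappa> * w n \<le> \<psi> \<bullet> ?v"
        using \<kappa>(3)[of "c - u n"] elim uw(1)[of n] by (simp add: w inner_diff_right)
      moreover have "\<psi> \<bullet> ?v \<le> \<psi>s n \<bullet> ?v + \<kappa> / 2 * w n"
      proof -
        have "\<bar>(\<psi>s n - \<psi>) \<bullet> ?v\<bar> \<le> norm (\<psi>s n - \<psi>) * w n"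
          unfolding w by (rule Cauchy_Schwarz_ineq2)
        also have "\<dots> \<le> \<kappa> / 2 * w n" using elim uw(2)[of n] by (intro mult_right_mono) auto
        finally show ?thesis unfolding inner_diff_left by linarith
      qed
      moreover have "\<psi>s n \<bullet> p (c - u n) \<le> hs n"
      proof (rule L(3))
        show "cs (\<phi> n) \<le> c - u n" by (simp add: cs_def u_def)
        show "c - u n \<le> ds (\<phi> n)" using in_range(2)[OF s1, of "\<phi> n"] uw(1)[of n] by simp
      qed
      ultimately have "\<kappa> / 2 * w n \<le> hs n - \<psi>s n \<bullet> p c" by (simp add: inner_diff_right)
      then have "(r1 / 2) * (\<kappa> / 2 * w n) \<le> (r1 / 2) * (hs n - \<psi>s n \<bullet> p c)"
        using r1(2) by (intro mult_left_mono) auto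
      also have "\<dots> \<le> 2 * (u n * w n) + 10 * B * (sqrt (u n) * w n)"
      proof -
        have "\<bar>hs n - \<psi>s n \<bullet> p (ys n)\<bar> \<le> 5 * B"
          using L(4)[of n] bd[of n "p (ys n)"] B(2)[of "ys n"] by linarith
        then have "\<bar>hs n - \<psi>s n \<bullet> p (ys n)\<bar> * (of_bool E * (sqrt (u n) * w n)) \<le> (5 * B) * (1 * (sqrt (u n) * w n))"
          using uw[of n] B(1) by (intro mult_mono) auto
        moreover have "- ((hs n - \<psi>s n \<bullet> p (ys n)) * (of_bool E * (sqrt (u n) * w n))) \<le>
          \<bar>hs n - \<psi>s n \<bullet> p (ys n)\<bar> * (of_bool E * (sqrt (u n) * w n))"
          unfolding minus_mult_left using uw[of n] by (intro mult_right_mono) auto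
        ultimately show ?thesis using main[of n] unfolding mult.assoc mult_1 by linarith
      qed
      finally have "(r1 * \<kappa> / 4) * w n \<le> (2 * u n + 10 * B * sqrt (u n)) * w n"
        by (simp add: algebra_simps)
      then show ?case using uw(2)[of n] by (simp add: mult_le_cancel_right)
    qed
    moreover have "(\<lambda>n. 2 * u n + 10 * B * sqrt (u n)) \<longlonglongrightarrow> 2 * 0 + 10 * B * 0"
      by (intro tendsto_intros limu limsu)
    ultimately have "r1 * \<kappa> / 4 \<le> 0"
      by (intro tendsto_lowerbound[of "\<lambda>n. 2 * u n + 10 * B * sqrt (u n)"]) auto
    then show False using r1(2) \<kappa>(1) by (simp add: mult_le_0_iff)
  qed
  then show ?thesis using L(12) at ends s1 by blast
qed

end

end

subsection \<open>Classification of optimal paths\<close>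

definition arc_on :: "(real \<Rightarrow> real) \<Rightarrow> real \<Rightarrow> real \<Rightarrow> real \<Rightarrow> bool" where
  "arc_on \<theta> \<sigma> x y \<longleftrightarrow> x \<le> y \<and> (\<forall>t. x \<le> t \<longrightarrow> t \<le> y \<longrightarrow> \<theta> t - \<theta> x = \<sigma> * (t - x))"

text \<open>Type (a) admits straight pieces of length \<open>0\<close>, so full loops may follow each other directly.\<close>

inductive loops :: "real \<Rightarrow> (real \<Rightarrow> real) \<Rightarrow> real \<Rightarrow> real \<Rightarrow> bool" for P \<theta> where
  rest: "arc_on \<theta> 0 x y \<Longrightarrow> loops P \<theta> x y"
| loop: "\<sigma> = 1 \<or> \<sigma> = -1 \<Longrightarrow> arc_on \<theta> \<sigma> x (x + P) \<Longrightarrow> loops P \<theta> x (x + P)"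
| trans: "loops P \<theta> x y \<Longrightarrow> loops P \<theta> y z \<Longrightarrow> loops P \<theta> x z"

text \<open>The first and the last arc may be empty, with arbitrary sign.\<close>

definition path_type_a :: "real \<Rightarrow> (real \<Rightarrow> real) \<Rightarrow> real \<Rightarrow> bool" where
  "path_type_a P \<theta> T \<longleftrightarrow> (\<exists>\<sigma> \<tau> x y. (\<sigma> = 1 \<or> \<sigma> = -1) \<and> (\<tau> = 1 \<or> \<tau> = -1) \<and>
     arc_on \<theta> \<sigma> 0 x \<and> x \<le> P \<and> loops P \<theta> x y \<and> arc_on \<theta> \<tau> y T \<and> T - y \<le> P)"

definition path_type_b :: "real \<Rightarrow> (real \<Rightarrow> real) \<Rightarrow> real \<Rightarrow> bool" where
  "path_type_b P \<theta> T \<longleftrightarrow> (\<exists>\<sigma> x y. (\<sigma> = 1 \<or> \<sigma> = -1) \<and>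
     arc_on \<theta> \<sigma> 0 x \<and> arc_on \<theta> (- \<sigma>) x y \<and> arc_on \<theta> \<sigma> y T \<and> x \<le> y - x \<and> T - y \<le> y - x \<and> y - x \<le> P)"

lemma arc_on_le: "arc_on \<theta> \<sigma> x y \<Longrightarrow> x \<le> y"
  by (simp add: arc_on_def)

lemma arc_on_end: "arc_on \<theta> \<sigma> x y \<Longrightarrow> \<theta> y - \<theta> x = \<sigma> * (y - x)"
  by (auto simp: arc_on_def)

lemma arc_on_refl: "arc_on \<theta> \<sigma> x x"
  by (auto simp: arc_on_def)

lemma arc_on_join:
  assumes "arc_on \<theta> \<sigma> x y" "arc_on \<theta> \<sigma> y z"
  shows "arc_on \<theta> \<sigma> x z"
  unfolding arc_on_def
proof (intro conjI allI impI)
  show "x \<le> z" using assms by (auto simp: arc_on_def)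
  fix t assume t: "x \<le> t" "t \<le> z"
  show "\<theta> t - \<theta> x = \<sigma> * (t - x)"
  proof (cases "t \<le> y")
    case True
    then show ?thesis using assms t by (auto simp: arc_on_def)
  next
    case False
    then have "\<theta> t - \<theta> y = \<sigma> * (t - y)" using assms t by (auto simp: arc_on_def)
    then show ?thesis using arc_on_end[OF assms(1)] by (simp add: algebra_simps)
  qed
qed

lemma arc_on_sub:
  assumes "arc_on \<theta> \<sigma> x y" "x \<le> x'" "x' \<le> y'" "y' \<le> y"
  shows "arc_on \<theta> \<sigma> x' y'"
  unfolding arc_on_def
proof (intro conjI allI impI)
  fix t assume t: "x' \<le> t" "t \<le> y'"
  have "\<theta> t - \<theta> x = \<sigma> * (t - x)" "\<theta> x' - \<theta> x = \<sigma> * (x' - x)"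
    using assms t by (auto simp: arc_on_def)
  then show "\<theta> t - \<theta> x' = \<sigma> * (t - x')" by (simp add: algebra_simps)
qed fact

lemma arc_on_uminus: "arc_on (\<lambda>t. - \<theta> t) \<sigma> x y \<longleftrightarrow> arc_on \<theta> (- \<sigma>) x y"
proof -
  have "- \<theta> t - - \<theta> x = \<sigma> * (t - x) \<longleftrightarrow> \<theta> t - \<theta> x = - \<sigma> * (t - x)" for t
    by (simp add: algebra_simps) linarith
  then show ?thesis by (simp only: arc_on_def)
qed

lemma loops_uminus: "loops P (\<lambda>t. - \<theta> t) x y \<Longrightarrow> loops P \<theta> x y"
proof (induction rule: loops.induct)
  case (rest x y)
  then show ?case by (intro loops.rest) (simp add: arc_on_uminus)
next
  case (loop \<sigma> x)
  then show ?case by (intro loops.loop[of "- \<sigma>"]) (auto simp: arc_on_uminus)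
next
  case (trans x y z)
  then show ?case by (blast intro: loops.trans)
qed

lemma path_type_a_uminus:
  assumes "path_type_a P (\<lambda>t. - \<theta> t) T"
  shows "path_type_a P \<theta> T"
proof -
  obtain \<sigma> \<tau> x y where *: "\<sigma> = 1 \<or> \<sigma> = -1" "\<tau> = 1 \<or> \<tau> = -1" "arc_on (\<lambda>t. - \<theta> t) \<sigma> 0 x" "x \<le> P"
    "loops P (\<lambda>t. - \<theta> t) x y" "arc_on (\<lambda>t. - \<theta> t) \<tau> y T" "T - y \<le> P"
    using assms unfolding path_type_a_def by blast
  have "arc_on \<theta> (- \<sigma>) 0 x" "arc_on \<theta> (- \<tau>) y T" "loops P \<theta> x y"
    using *(3,6) loops_uminus[OF *(5)] by (simp_all only: arc_on_uminus)
  moreover have "- \<sigma> = 1 \<or> - \<sigma> = -1" "- \<tau> = 1 \<or> - \<tau> = -1" using *(1,2) by auto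
  ultimately show ?thesis
    unfolding path_type_a_def using *(4,7) by blast
qed

lemma path_type_b_uminus:
  assumes "path_type_b P (\<lambda>t. - \<theta> t) T"
  shows "path_type_b P \<theta> T"
proof -
  obtain \<sigma> x y where *: "\<sigma> = 1 \<or> \<sigma> = -1" "arc_on (\<lambda>t. - \<theta> t) \<sigma> 0 x" "arc_on (\<lambda>t. - \<theta> t) (- \<sigma>) x y"
    "arc_on (\<lambda>t. - \<theta> t) \<sigma> y T" "x \<le> y - x" "T - y \<le> y - x" "y - x \<le> P"
    using assms unfolding path_type_b_def by blast
  have "arc_on \<theta> (- \<sigma>) 0 x" "arc_on \<theta> (- (- \<sigma>)) x y" "arc_on \<theta> (- \<sigma>) y T"
    using *(2-4) by (simp_all only: arc_on_uminus)
  moreover have "- \<sigma> = 1 \<or> - \<sigma> = -1" using *(1) by auto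
  ultimately show ?thesis
    unfolding path_type_b_def using *(5-7) by blast
qed

section \<open>Full loops and the recognition of type (a)\<close>

lemma arc_loops:
  assumes \<sigma>: "\<sigma> = 1 \<or> \<sigma> = -1" and P: "0 < P"
  shows "arc_on \<theta> \<sigma> x (x + P * real n) \<Longrightarrow> loops P \<theta> x (x + P * real n)"
proof (induction n)
  case 0
  then show ?case by (auto intro: loops.rest arc_on_refl)
next
  case (Suc n)
  let ?y = "x + P * real n"
  have y: "x \<le> ?y" "?y \<le> ?y + P" "?y + P = x + P * real (Suc n)" using P by (auto simp: algebra_simps)
  have "loops P \<theta> x ?y"
    using y by (intro Suc.IH arc_on_sub[OF Suc.prems]) auto
  moreover have "loops P \<theta> ?y (?y + P)"
    using y by (intro loops.loop[OF \<sigma>] arc_on_sub[OF Suc.prems]) auto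
  ultimately show ?case unfolding y(3)[symmetric] by (rule loops.trans)
qed

lemma loop_count:
  assumes "0 < P" "0 \<le> L"
  obtains n :: nat where "0 \<le> L - P * real n" "L - P * real n < P"
proof -
  have "L / P \<ge> 0" using assms by simp
  then have "real (nat \<lfloor>L / P\<rfloor>) \<le> L / P" "L / P < real (nat \<lfloor>L / P\<rfloor>) + 1" by linarith+
  then have "P * real (nat \<lfloor>L / P\<rfloor>) \<le> P * (L / P)" "P * (L / P) < P * (real (nat \<lfloor>L / P\<rfloor>) + 1)"
    using assms(1) by (auto intro: mult_left_mono mult_strict_left_mono simp del: times_divide_eq_right)
  moreover have "P * (L / P) = L" using assms(1) by simp
  moreover have "P * (real (nat \<lfloor>L / P\<rfloor>) + 1) = P * real (nat \<lfloor>L / P\<rfloor>) + P" by (simp add: distrib_left)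
  ultimately show ?thesis
    by (intro that[of "nat \<lfloor>L / P\<rfloor>"]) linarith+
qed

text \<open>Longer end arcs are harmless: full loops are split off at the end of the first arc and
  at the beginning of the last one until less than a period remains.\<close>

lemma path_type_aI:
  assumes P: "0 < P" and \<sigma>: "\<sigma> = 1 \<or> \<sigma> = -1" "\<tau> = 1 \<or> \<tau> = -1"
    and *: "arc_on \<theta> \<sigma> 0 x" "loops P \<theta> x y" "arc_on \<theta> \<tau> y T"
  shows "path_type_a P \<theta> T"
proof -
  have le: "0 \<le> x" "y \<le> T" using * by (auto simp: arc_on_def)
  obtain n where n: "0 \<le> x - P * real n" "x - P * real n < P" using loop_count[OF P le(1)] .
  obtain m where m: "0 \<le> (T - y) - P * real m" "(T - y) - P * real m < P"
    using loop_count[OF P, of "T - y"] le by auto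
  let ?x = "x - P * real n" and ?y = "y + P * real m"
  have ge: "0 \<le> P * real n" "0 \<le> P * real m" using P by auto
  have "loops P \<theta> ?x (?x + P * real n)"
    using n ge by (intro arc_loops[OF \<sigma>(1) P] arc_on_sub[OF *(1)]) auto
  then have "loops P \<theta> ?x x" by simp
  moreover have "loops P \<theta> y ?y"
    using m ge by (intro arc_loops[OF \<sigma>(2) P] arc_on_sub[OF *(3)]) auto
  ultimately have "loops P \<theta> ?x ?y" using loops.trans[OF loops.trans[OF _ *(2)]] by blast
  moreover have "arc_on \<theta> \<sigma> 0 ?x" "arc_on \<theta> \<tau> ?y T"
    using n m ge by (intro arc_on_sub[OF *(1)] arc_on_sub[OF *(3)]; simp)+
  ultimately show ?thesis
    unfolding path_type_a_def using n m \<sigma>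
    by (intro exI[of _ \<sigma>] exI[of _ \<tau>] exI[of _ ?x] exI[of _ ?y]) auto
qed

text \<open>An invariant for reading a path from left to right. \<open>Z\<close> describes the
  headings at which dwells and turns may occur; the second alternative records the last such event
  at \<open>y\<close>, followed by an unfinished arc.\<close>

definition type_a_until :: "real \<Rightarrow> (real \<Rightarrow> bool) \<Rightarrow> (real \<Rightarrow> real) \<Rightarrow> real \<Rightarrow> real \<Rightarrow> bool" where
  "type_a_until P Z \<theta> \<sigma> t \<longleftrightarrow> arc_on \<theta> \<sigma> 0 t \<or> (\<exists>\<tau> x y. (\<tau> = 1 \<or> \<tau> = -1) \<and>
     arc_on \<theta> \<tau> 0 x \<and> loops P \<theta> x y \<and> Z (\<theta> y) \<and> arc_on \<theta> \<sigma> y t)"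

text \<open>Two headings in \<open>Z\<close> differ by a multiple of \<open>P\<close>, so the arc
  since the last event consists of full loops. If there was no earlier event, the whole path so far
  becomes the first arc.\<close>

lemma type_a_until_event:
  assumes P: "0 < P" and Z: "\<And>l l'. Z l \<Longrightarrow> Z l' \<Longrightarrow> \<exists>k::int. l' = l + P * of_int k"
    and \<sigma>: "\<sigma> = 1 \<or> \<sigma> = -1" and u: "type_a_until P Z \<theta> \<sigma> t" "Z (\<theta> t)"
  obtains \<tau> x where "\<tau> = 1 \<or> \<tau> = -1" "arc_on \<theta> \<tau> 0 x" "loops P \<theta> x t"
proof -
  from u(1) consider "arc_on \<theta> \<sigma> 0 t" | \<tau> x y where "\<tau> = 1 \<or> \<tau> = -1"
    "arc_on \<theta> \<tau> 0 x" "loops P \<theta> x y" "Z (\<theta> y)" "arc_on \<theta> \<sigma> y t"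
    unfolding type_a_until_def by blast
  then show ?thesis
  proof cases
    case 1
    then show ?thesis using that[OF \<sigma> 1] loops.rest[OF arc_on_refl] by blast
  next
    case 2
    obtain k :: int where "\<theta> t = \<theta> y + P * of_int k" using Z[OF 2(4) u(2)] by blast
    then have k: "\<sigma> * (t - y) = P * of_int k" using arc_on_end[OF 2(5)] by simp
    have "y \<le> t" using 2 by (simp add: arc_on_def)
    then have "t - y = P * real (nat \<bar>k\<bar>)"
    proof -
      have "\<bar>\<sigma> * (t - y)\<bar> = P * \<bar>of_int k\<bar>" using P by (simp add: k abs_mult)
      then show ?thesis using \<sigma> \<open>y \<le> t\<close> by (auto simp: abs_mult)
    qed
    then have t: "t = y + P * real (nat \<bar>k\<bar>)" by simp
    have "loops P \<theta> y t"
      using arc_loops[OF \<sigma> P, of \<theta> y "nat \<bar>k\<bar>"] 2(5) t by simp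
    then show ?thesis using that[OF 2(1,2)] loops.trans[OF 2(3)] by blast
  qed
qed

text \<open>Arcs prolong the unfinished arc, while a dwell of positive length is an event, after
  which a new arc of length 0 begins.\<close>

lemma type_a_until_seg:
  assumes P: "0 < P" and Z: "\<And>l l'. Z l \<Longrightarrow> Z l' \<Longrightarrow> \<exists>k::int. l' = l + P * of_int k"
    and \<sigma>: "\<sigma> = 1 \<or> \<sigma> = -1" and seg: "seg \<sigma> \<theta> x y D"
    and "type_a_until P Z \<theta> \<sigma> x" "\<And>l r. (l, r) \<in> set D \<Longrightarrow> 0 < r \<Longrightarrow> Z l"
  shows "type_a_until P Z \<theta> \<sigma> y"
  using seg assms(5,6)
proof (induction rule: seg.induct)
  case (dwell x y)
  have arc: "arc_on \<theta> 0 x y"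
    unfolding arc_on_def using dwell.hyps(1) by (auto intro: dwell.hyps(2))
  have y: "\<theta> y = \<theta> x" using dwell.hyps(1) by (intro dwell.hyps(2)) auto
  show ?case
  proof (cases "x = y")
    case False
    then have Zx: "Z (\<theta> x)" using dwell.prems(2)[of "\<theta> x" "y - x"] dwell.hyps(1) by simp
    show ?thesis
    proof (rule type_a_until_event[OF P Z \<sigma> dwell.prems(1) Zx])
      fix \<tau> x' assume *: "\<tau> = 1 \<or> \<tau> = -1" "arc_on \<theta> \<tau> 0 x'" "loops P \<theta> x' x"
      have "loops P \<theta> x' y" using loops.trans[OF *(3) loops.rest[OF arc]] .
      moreover have "Z (\<theta> y)" using Zx unfolding y .
      ultimately show ?thesis
        unfolding type_a_until_def using * arc_on_refl by blast
    qed
  qed (use dwell.prems in simp)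
next
  case (arc x y)
  have a: "arc_on \<theta> \<sigma> x y"
    unfolding arc_on_def using arc.hyps(1) by (auto simp: diff_eq_eq add.commute intro: arc.hyps(2))
  then show ?case
    using arc.prems(1) arc_on_join[OF _ a] unfolding type_a_until_def by blast
next
  case (trans x y D z E)
  show ?case
    using trans.prems by (intro trans.IH(2) trans.IH(1)) auto
qed

lemma seg_no_dwell:
  assumes "seg \<sigma> \<theta> x y D" "\<And>l r. (l, r) \<in> set D \<Longrightarrow> r \<le> 0"
  shows "arc_on \<theta> \<sigma> x y"
  using assms
proof (induction rule: seg.induct)
  case (dwell x y)
  have "y = x" using dwell.hyps(1) dwell.prems[of "\<theta> x" "y - x"] by simp
  then show ?case by (simp add: arc_on_refl)
next
  case (arc x y)
  show ?case
    unfolding arc_on_def using arc.hyps(1) by (auto simp: diff_eq_eq add.commute intro: arc.hyps(2))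
next
  case (trans x y D z E)
  show ?case
    using trans.prems by (intro arc_on_join[OF trans.IH]) auto
qed

lemma seg_empty:
  assumes "seg \<sigma> \<theta> x y D" "\<sigma> = 1 \<or> \<sigma> = -1" "\<theta> x = \<theta> y"
  shows "arc_on \<theta> 0 x y"
  unfolding arc_on_def
proof (intro conjI allI impI)
  show "x \<le> y" by (rule seg_le[OF assms(1)])
  fix t assume "x \<le> t" "t \<le> y"
  then have "\<sigma> * \<theta> x \<le> \<sigma> * \<theta> t" "\<sigma> * \<theta> t \<le> \<sigma> * \<theta> y"
    using seg_mono[OF assms(1,2), of x t] seg_mono[OF assms(1,2), of t y] by auto
  then show "\<theta> t - \<theta> x = 0 * (t - x)" using assms(2,3) by auto
qed

text \<open>Without a dwell a segment moves at unit speed, so positive duration without net motion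
  requires one. This covers turns at the initial or final heading itself.\<close>

lemma seg_empty_dwell:
  assumes "seg \<sigma> \<theta> x y D" "\<sigma> = 1 \<or> \<sigma> = -1" "\<theta> x = \<theta> y" "x < y"
  obtains r where "(\<theta> x, r) \<in> set D" "0 < r"
proof (rule ccontr)
  assume neg: "\<not> thesis"
  then have none: "\<not> 0 < r" if "(\<theta> x, r) \<in> set D" for r
    using \<open>\<And>r. (\<theta> x, r) \<in> set D \<Longrightarrow> 0 < r \<Longrightarrow> thesis\<close> that by blast
  have "\<theta> t = \<theta> x" if "t \<in> {x..y}" for t
  proof -
    have "\<theta> t - \<theta> x = 0 * (t - x)"
      using seg_empty[OF assms(1-3)] that unfolding arc_on_def atLeastAtMost_iff by blast
    then show ?thesis by simp
  qed
  then have "\<theta> ` {x..y} \<subseteq> {\<theta> x}" by blast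
  then have "r \<le> 0" if "(l, r) \<in> set D" for l r
  proof -
    have "l = \<theta> x" using seg_levels[OF assms(1) that] \<open>\<theta> ` {x..y} \<subseteq> {\<theta> x}\<close> by blast
    then show ?thesis using none that by (simp add: not_less)
  qed
  then have "arc_on \<theta> \<sigma> x y" by (rule seg_no_dwell[OF assms(1)])
  then have "\<sigma> * (y - x) = 0" using arc_on_end assms(3) by fastforce
  then show False using assms(2,4) by auto
qed

context sc_curve
begin

lemma argmax_level: "argmax \<psi> s \<Longrightarrow> \<psi> \<bullet> p t = \<psi> \<bullet> p s \<Longrightarrow> argmax \<psi> t"
  by (simp add: argmax_def)

lemma prim_reflect: "prim (\<lambda>s. p (- s)) (- s) = - prim p s"
  using Henstock_Kurzweil_Integration.integral_reflect_real[of s 0 p]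
    Henstock_Kurzweil_Integration.integral_reflect_real[of 0 s p]
  by (simp add: prim_def)

text \<open>The path \<open>a \<rightarrow> c \<rightarrow> d \<rightarrow> b\<close> is negated and
  run backwards, which gives \<open>-b \<rightarrow> -d \<rightarrow> -c \<rightarrow> -a\<close>.
  Duration and displacement do not change.\<close>

lemma separable_reflect:
  assumes "separable a b W T"
  shows "sc_curve.separable (\<lambda>s. p (- s)) (- b) (- a) W T"
proof -
  interpret r: sc_curve "\<lambda>s. p (- s)" P \<Omega> by (rule reflect)
  show ?thesis
    unfolding r.separable_def
  proof (intro allI impI)
    fix c d assume *: "c \<le> - b" "c \<le> d" "- a \<le> d" "r.len (- b) (- a) c d < T"
    have len: "r.len (- b) (- a) c d = len a b (- d) (- c)"
      by (simp add: r.len_def len_def)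
    have base: "r.base (- b) (- a) c d = base a b (- d) (- c)"
      using prim_reflect[of a] prim_reflect[of b] prim_reflect[of "- c"] prim_reflect[of "- d"]
      by (simp add: r.base_def base_def)
    obtain \<psi> where \<psi>: "norm \<psi> = 1" "\<forall>s\<in>{-d..-c}. (T - len a b (- d) (- c)) * (\<psi> \<bullet> p s) \<le> \<psi> \<bullet> (W - base a b (- d) (- c))"
      using assms * unfolding separable_def len by (metis le_minus_iff minus_le_iff neg_le_iff_le)
    then show "\<exists>\<psi>. norm \<psi> = 1 \<and> (\<forall>s\<in>{c..d}. (T - r.len (- b) (- a) c d) * (\<psi> \<bullet> p (- s)) \<le> \<psi> \<bullet> (W - r.base (- b) (- a) c d))"
      unfolding len base by (intro exI[of _ \<psi>]) auto
  qed
qed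

text \<open>A single functional serves all dwells and turns. The position of the chosen dwell
  \<open>s1\<close> decides which variation produces it; an upper end becomes a lower one by
  reflection.\<close>

lemma dwell_conditions:
  assumes sep: "separable a b (base a b c d + (\<Sum>(l, r)\<leftarrow>D. r *\<^sub>R p l)) (len a b c d + (\<Sum>(l, r)\<leftarrow>D. r))"
    and D: "\<forall>(l, r)\<in>set D. 0 \<le> r \<and> c \<le> l \<and> l \<le> d"
    and ab: "c \<le> a" "a \<le> b" "b \<le> d" and cd: "c < d" and s1: "(s1, r1) \<in> set D" "0 < r1"
  shows "\<exists>\<psi>. \<psi> \<noteq> 0 \<and> (\<forall>(l, r)\<in>set D. 0 < r \<longrightarrow> argmax \<psi> l) \<and> (c < a \<longrightarrow> argmax \<psi> c) \<and> (b < d \<longrightarrow> argmax \<psi> d)"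
proof -
  obtain B where B: "0 < B" "\<And>s. norm (p s) \<le> B" using bounded_curve by blast
  have "(\<lambda>(l, r). r) (s1, r1) \<le> (\<Sum>(l, r)\<leftarrow>D. r)"
    using D by (intro sum_list_nonneg_ge s1) auto
  then have R: "0 < (\<Sum>(l, r)\<leftarrow>D. r)" using s1 by simp
  have s1a: "s1 \<in> atoms D" using s1 atoms_def[OF sep refl R D ab cd B] by blast
  have at: "\<forall>(l, r)\<in>set D. 0 < r \<longrightarrow> argmax \<psi> l" if "\<forall>l\<in>atoms D. argmax \<psi> l" for \<psi>
    using that atoms_def[OF sep refl R D ab cd B] by blast
  have s1r: "c \<le> s1" "s1 \<le> d" using D s1 by auto
  consider "c < s1" "s1 < d" | "s1 = c" | "s1 = d" using s1r by linarith
  then show ?thesis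
  proof cases
    case 1
    obtain \<psi> h where *: "norm \<psi> = 1" "argmax \<psi> s1" "\<psi> \<bullet> p s1 = h" "\<forall>l\<in>atoms D. \<psi> \<bullet> p l = h"
      "c < a \<longrightarrow> \<psi> \<bullet> p c = h" "b < d \<longrightarrow> \<psi> \<bullet> p d = h"
      using interior_atom[OF sep refl R D ab cd B s1a 1] by blast
    have "\<psi> \<noteq> 0" using *(1) by auto
    then show ?thesis using * argmax_level[OF *(2)] by (intro exI[of _ \<psi>] conjI at) auto
  next
    case 2
    obtain \<psi> h where *: "norm \<psi> = 1" "argmax \<psi> s1" "\<psi> \<bullet> p s1 = h" "\<forall>l\<in>atoms D. \<psi> \<bullet> p l = h"
      "b < d \<longrightarrow> \<psi> \<bullet> p d = h"
      using end_atom[OF sep refl R D ab cd B] s1a 2 by blast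
    have "\<psi> \<noteq> 0" using *(1) by auto
    then show ?thesis using * 2 argmax_level[OF *(2)] by (intro exI[of _ \<psi>] conjI at) auto
  next
    case 3
    interpret r: sc_curve "\<lambda>s. p (- s)" P \<Omega> by (rule reflect)
    define D' where "D' = map (\<lambda>(l, r). (- l, r)) D"
    have sum': "(\<Sum>(l, r)\<leftarrow>D'. r) = (\<Sum>(l, r)\<leftarrow>D. r)" "(\<Sum>(l, r)\<leftarrow>D'. r *\<^sub>R p (- l)) = (\<Sum>(l, r)\<leftarrow>D. r *\<^sub>R p l)"
      unfolding D'_def by (induction D) auto
    have len: "r.len (- b) (- a) (- d) (- c) = len a b c d"
      by (simp add: r.len_def len_def)
    have base: "r.base (- b) (- a) (- d) (- c) = base a b c d"
      using prim_reflect[of a] prim_reflect[of b] prim_reflect[of c] prim_reflect[of d]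
      by (simp add: r.base_def base_def)
    have sep': "r.separable (- b) (- a) (r.base (- b) (- a) (- d) (- c) + (\<Sum>(l, r)\<leftarrow>D'. r *\<^sub>R p (- l)))
        (r.len (- b) (- a) (- d) (- c) + (\<Sum>(l, r)\<leftarrow>D'. r))"
      unfolding len base sum' by (rule separable_reflect[OF sep])
    have R': "0 < (\<Sum>(l, r)\<leftarrow>D'. r)" using R sum' by simp
    have D0: "\<forall>(l, r)\<in>set D'. 0 \<le> r \<and> - d \<le> l \<and> l \<le> - c" using D by (auto simp: D'_def)
    have ab': "- d \<le> - b" "- b \<le> - a" "- a \<le> - c" "- d < - c" using ab cd by auto
    note rdef = r.atoms_def[OF sep' refl R' D0 ab' B(1) B(2)]
    have "(- d, r1) \<in> set D'" using s1 3 by (force simp: D'_def)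
    then have "- d \<in> r.atoms D'" using s1(2) rdef by blast
    then obtain \<psi> h where *: "norm \<psi> = 1" "r.argmax \<psi> (- d)" "\<psi> \<bullet> p (- (- d)) = h"
      "\<forall>l\<in>r.atoms D'. \<psi> \<bullet> p (- l) = h" "- a < - c \<longrightarrow> \<psi> \<bullet> p (- (- c)) = h"
      using r.end_atom[OF sep' refl R' D0 ab' B(1) B(2)] by blast
    have "\<psi> \<noteq> 0" using *(1) by auto
    have am: "argmax \<psi> d"
      using *(2) unfolding r.argmax_def argmax_def by (metis minus_minus)
    moreover have "\<psi> \<bullet> p l = h" if "(l, r) \<in> set D" "0 < r" for l r
    proof -
      have "(- l, r) \<in> set D'" using that by (force simp: D'_def)
      then have "- l \<in> r.atoms D'" using that rdef by blast
      then show ?thesis using *(4) by fastforce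
    qed
    ultimately show ?thesis
      using \<open>\<psi> \<noteq> 0\<close> *(3,5) argmax_level[OF am] by (intro exI[of _ \<psi>]) auto
  qed
qed

text \<open>Unlike in \<open>separable_reflect\<close>, time is not reversed: the heading changes
  sign and the start remains the start.\<close>

lemma optimal_reflect:
  assumes "optimal \<theta> T"
  shows "sc_curve.optimal (\<lambda>s. p (- s)) P (\<lambda>t. - \<theta> t) T"
proof -
  interpret r: sc_curve "\<lambda>s. p (- s)" P \<Omega> by (rule reflect)
  have d: "r.disp \<theta>' T' = disp (\<lambda>t. - \<theta>' t) T'" for \<theta>' T' by (simp add: r.disp_def disp_def)
  show ?thesis
    unfolding r.optimal_def
  proof (intro conjI allI impI)
    show "adm_path (\<lambda>t. - \<theta> t) T" using assms by (simp add: optimal_def adm_path_uminus)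
    fix \<theta>' T' and k :: int
    assume *: "adm_path \<theta>' T'" "\<theta>' 0 = - \<theta> 0" "\<theta>' T' = - \<theta> T + P * of_int k" "r.disp \<theta>' T' = r.disp (\<lambda>t. - \<theta> t) T"
    have "adm_path (\<lambda>t. - \<theta>' t) T'" by (rule adm_path_uminus[OF *(1)])
    moreover have "- \<theta>' 0 = \<theta> 0" "- \<theta>' T' = \<theta> T + P * of_int (- k)" "disp (\<lambda>t. - \<theta>' t) T' = disp \<theta> T"
      using * d by simp_all
    ultimately show "T \<le> T'" using assms unfolding optimal_def by blast
  qed
qed

lemma prim_shift: "prim p (s + P * of_int k) - prim p (t + P * of_int k) = prim p s - prim p t"
proof -
  have *: "prim p (s + P * of_int k) - prim p (t + P * of_int k) = prim p s - prim p t" if "t \<le> s" for s t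
  proof -
    have "integral {t..s} (p \<circ> (+) (P * of_int k)) = integral {t..s} p"
      by (simp add: o_def per_int add.commute)
    then show ?thesis
      using integral_shift_Icc_real[of t s p "P * of_int k"] that
        prim_diff[OF cont that] prim_diff[OF cont, of "t + P * of_int k" "s + P * of_int k"] by simp
  qed
  show ?thesis using *[of t s] *[of s t] by (cases "t \<le> s") (auto simp: algebra_simps)
qed

text \<open>A full loop contributes the same displacement wherever and in whichever direction it is run,
  so loops of the middle arc may be moved to the first arc.  This reverses the order of the
  endpoints, and then the turns are in the wrong order for an optimal path.\<close>

lemma no_long_middle_arc:
  assumes opt: "optimal \<theta> T" and ab: "\<theta> 0 \<le> \<theta> T"
    and arcs: "arc_on \<theta> (-1) 0 x" "arc_on \<theta> 1 x y" "arc_on \<theta> (-1) y T"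
    and pos: "0 < x" "y < T" and long: "P < y - x" and nz: "\<And>n. y - x \<noteq> P * real n"
  shows False
proof -
  obtain n where n: "0 \<le> (y - x) - P * real n" "(y - x) - P * real n < P"
    using loop_count[OF P_pos, of "y - x"] long P_pos by auto
  \<comment> \<open>If nothing remained of the middle arc, the new path would be a single monotone
    arc, with no turn left to contradict.\<close>
  have n0: "0 < (y - x) - P * real n" using n nz[of n] by auto
  have n1: "1 \<le> real n" using n long by (cases n) auto
  define a where "a = \<theta> 0"
  \<comment> \<open>The descending first arc grows by \<open>n\<close> periods and the ascending one
    shrinks by as many, so the total time is kept while the two turns are lowered by
    \<open>P * n\<close> and \<open>2 * (P * n)\<close>.\<close>
  define b1 where "b1 = \<theta> x - P * real n"
  define b2 where "b2 = \<theta> y - 2 * (P * real n)"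
  define b3 where "b3 = \<theta> T - 2 * (P * real n)"
  have ev: "\<theta> x = a - x" "\<theta> y = a - x + (y - x)" "\<theta> T = a - x + (y - x) - (T - y)"
    using arc_on_end[OF arcs(1)] arc_on_end[OF arcs(2)] arc_on_end[OF arcs(3)] by (auto simp: a_def)
  define L1 L2 L3 where "L1 = x + P * real n" and "L2 = y - x - P * real n" and "L3 = T - y"
  have Pn: "0 \<le> P * real n" using P_pos by simp
  have L: "0 < L1" "0 < L2" "0 < L3" using pos n0 Pn by (auto simp: L1_def L2_def L3_def)
  have sumL: "L1 + L2 + L3 = T" by (simp add: L1_def L2_def L3_def)
  have e: "b1 = a + (-1) * L1" "b2 = b1 - (-1) * L2" "b3 = b2 + (-1) * L3"
    by (simp_all add: b1_def b2_def b3_def ev L1_def L2_def L3_def)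
  have sh: "prim p (s + P * of_int k) = prim p s + (prim p (P * of_int k) - prim p 0)" for s k
    using prim_shift[of s k 0] by (simp add: algebra_simps)
  have b: "b1 = \<theta> x + P * of_int (- int n)" "b2 = \<theta> y + P * of_int (- 2 * int n)" "b3 = \<theta> T + P * of_int (- 2 * int n)"
    by (simp_all add: b1_def b2_def b3_def)
  have double: "prim p (P * of_int (- 2 * int n)) - prim p 0 = 2 *\<^sub>R (prim p (P * of_int (- int n)) - prim p 0)"
    using sh[of "P * of_int (- int n)" "- int n"] by (simp add: scaleR_2 algebra_simps)
  have "disp \<theta> T = base (\<theta> 0) (\<theta> T) (\<theta> x) (\<theta> y)"
  proof -
    have hi: "((\<lambda>t. p (\<theta> t)) has_integral \<sigma> *\<^sub>R (prim p (\<theta> v) - prim p (\<theta> u))) {u..v}"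
      if "arc_on \<theta> \<sigma> u v" "\<sigma> = 1 \<or> \<sigma> = -1" for \<sigma> u v
    proof -
      have "((\<lambda>t. p (\<theta> u + \<sigma> * (t - u))) has_integral \<sigma> *\<^sub>R (prim p (\<theta> u + \<sigma> * (v - u)) - prim p (\<theta> u))) {u..v}"
        by (rule has_integral_comp_line[OF cont arc_on_le[OF that(1)] that(2)])
      then have "((\<lambda>t. p (\<theta> t)) has_integral \<sigma> *\<^sub>R (prim p (\<theta> u + \<sigma> * (v - u)) - prim p (\<theta> u))) {u..v}"
      proof (rule has_integral_eq[rotated])
        fix t assume "t \<in> {u..v}"
        then have "\<theta> t - \<theta> u = \<sigma> * (t - u)" using that(1) unfolding arc_on_def by simp
        then have "\<theta> u + \<sigma> * (t - u) = \<theta> t" by linarith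
        then show "p (\<theta> u + \<sigma> * (t - u)) = p (\<theta> t)" by simp
      qed
      moreover have "\<theta> u + \<sigma> * (v - u) = \<theta> v" using arc_on_end[OF that(1)] by simp
      ultimately show ?thesis by simp
    qed
    have xy: "0 \<le> x" "x \<le> y" "0 \<le> y" "y \<le> T" using pos long P_pos by auto
    note I = has_integral_combine[OF xy(3,4) has_integral_combine[OF xy(1,2) hi[OF arcs(1)] hi[OF arcs(2)]] hi[OF arcs(3)]]
    show ?thesis unfolding disp_def base_def by (subst integral_unique[OF I]) (simp_all add: algebra_simps)
  qed
  show False
  proof (rule three_arcs[OF disjI2[OF refl] less_imp_le[OF L(1)] less_imp_le[OF L(2)] less_imp_le[OF L(3)] e])
    fix \<theta>'
    assume \<theta>': "adm_path \<theta>' (L1 + L2 + L3)" "\<theta>' 0 = a" "\<theta>' (L1 + L2 + L3) = b3"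
      and A1: "\<And>t. 0 \<le> t \<Longrightarrow> t \<le> L1 \<Longrightarrow> \<theta>' t = a + (-1) * t"
      and A2: "\<And>t. L1 \<le> t \<Longrightarrow> t \<le> L1 + L2 \<Longrightarrow> \<theta>' t = b1 - (-1) * (t - L1)"
      and A3: "\<And>t. L1 + L2 \<le> t \<Longrightarrow> \<theta>' t = b2 + (-1) * (t - L1 - L2)"
      and d: "disp \<theta>' (L1 + L2 + L3) =
        (-1) *\<^sub>R ((prim p b1 - prim p a) - (prim p b2 - prim p b1) + (prim p b3 - prim p b2))"
    have "disp \<theta>' T = disp \<theta> T"
    proof -
      define \<kappa> where "\<kappa> = prim p (P * of_int (- int n)) - prim p 0"
      have "prim p b1 = prim p (\<theta> x) + \<kappa>" "prim p b2 = prim p (\<theta> y) + 2 *\<^sub>R \<kappa>" "prim p b3 = prim p (\<theta> T) + 2 *\<^sub>R \<kappa>"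
        unfolding b sh double \<kappa>_def by (rule refl)+
      then show ?thesis
        using d unfolding sumL \<open>disp \<theta> T = base (\<theta> 0) (\<theta> T) (\<theta> x) (\<theta> y)\<close> base_def a_def
        by (simp add: scaleR_2 algebra_simps)
    qed
    have "optimal \<theta>' T"
      unfolding optimal_def
    proof (intro conjI allI impI)
      show "adm_path \<theta>' T" using \<theta>'(1) unfolding sumL .
      fix \<theta>'' T'' and k :: int
      assume *: "adm_path \<theta>'' T''" "\<theta>'' 0 = \<theta>' 0" "\<theta>'' T'' = \<theta>' T + P * of_int k" "disp \<theta>'' T'' = disp \<theta>' T"
      have "\<theta>'' T'' = b3 + P * of_int k" using *(3) \<theta>'(3) unfolding sumL by simp
      then have "\<theta>'' T'' = \<theta> T + P * of_int (k - 2 * int n)" by (simp add: b3_def algebra_simps)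
      moreover have "\<theta>'' 0 = \<theta> 0" using *(2) \<theta>'(2) by (simp add: a_def)
      moreover have "disp \<theta>'' T'' = disp \<theta> T" using *(4) \<open>disp \<theta>' T = disp \<theta> T\<close> by simp
      ultimately show "T \<le> T''" using opt *(1) unfolding optimal_def by blast
    qed
    then have opt_r: "sc_curve.optimal (\<lambda>s. p (- s)) P (\<lambda>t. - \<theta>' t) T" by (rule optimal_reflect)
    interpret r: sc_curve "\<lambda>s. p (- s)" P \<Omega> by (rule reflect)
    \<comment> \<open>Since \<open>y - x < P * (n + 1) \<le> 2 * (P * n)\<close> by
      \<open>n \<ge> 1\<close>, the final heading falls below the initial one. Strictness rules out
      the alternative with equal endpoints.\<close>
    have b3a: "b3 < a"
    proof -
      have "\<theta> T - a < 2 * (P * real n)"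
      proof -
        have "P * 1 \<le> P * real n" using n1 P_pos by (intro mult_left_mono) auto
        then show ?thesis using ev(3) n(2) pos by linarith
      qed
      then show ?thesis by (simp add: b3_def)
    qed
    have lt: "- \<theta>' 0 \<le> - \<theta>' T" using b3a \<theta>' by (simp add: sumL)
    \<comment> \<open>\<open>- \<theta>'\<close> ascends, descends and ascends. A first descending
      segment must thus be empty, the ascending one must end by \<open>L1\<close>, and the last
      segment would have to descend on the final ascending arc.\<close>
    have no: False if seg: "seg (-1) (\<lambda>t. - \<theta>' t) 0 t1 D1" "seg 1 (\<lambda>t. - \<theta>' t) t1 t2 D2" "seg (-1) (\<lambda>t. - \<theta>' t) t2 T D3"
      and t12: "0 \<le> t1" "t1 \<le> t2" "t2 \<le> T" for t1 t2 D1 D2 D3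
    proof -
      have "t1 = 0"
      proof (rule ccontr)
        assume "t1 \<noteq> 0"
        then have "\<theta>' 0 \<le> \<theta>' (min t1 L1)"
          using seg_mono[OF seg(1), of 0 "min t1 L1"] t12 L by auto
        then show False using A1[of 0] A1[of "min t1 L1"] \<open>t1 \<noteq> 0\<close> t12 L by auto
      qed
      have "t2 \<le> L1"
      proof (rule ccontr)
        assume "\<not> t2 \<le> L1"
        then have "\<theta>' (min t2 (L1 + L2)) \<le> \<theta>' L1"
          using seg_mono[OF seg(2), of L1 "min t2 (L1 + L2)"] t12 L \<open>t1 = 0\<close> by auto
        then show False using A2[of L1] A2[of "min t2 (L1 + L2)"] \<open>\<not> t2 \<le> L1\<close> L by auto
      qed
      then have "\<theta>' (L1 + L2) \<le> \<theta>' T"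
        using seg_mono[OF seg(3), of "L1 + L2" T] t12 L sumL by auto
      then show False using A3[of "L1 + L2"] A3[of T] L sumL by auto
    qed
    show False
    proof (rule r.optimal_path_segs[OF opt_r lt])
      show False if "- \<theta>' 0 = - \<theta>' T" using that b3a \<theta>' by (simp add: sumL)
    qed (use no in blast)
  qed
qed

lemma zigzag_types:
  assumes opt: "optimal \<theta> T" and ab: "\<theta> 0 \<le> \<theta> T" and t12: "0 \<le> t1" "t1 \<le> t2" "t2 \<le> T"
    and seg: "seg (-1) \<theta> 0 t1 D1" "seg 1 \<theta> t1 t2 D2" "seg (-1) \<theta> t2 T D3"
  shows "path_type_a P \<theta> T \<or> path_type_b P \<theta> T"
proof -
  define D where "D = D1 @ D2 @ D3"
  define a b c d where "a = \<theta> 0" and "b = \<theta> T" and "c = \<theta> t1" and "d = \<theta> t2"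
  have abcd: "c \<le> a" "a \<le> b" "b \<le> d" "c \<le> d"
    using seg_mono[OF seg(1), of 0 t1] seg_mono[OF seg(2), of t1 t2] seg_mono[OF seg(3), of t2 T] t12 ab
    by (auto simp: a_def b_def c_def d_def)
  show ?thesis
  proof (cases "\<exists>l r. (l, r) \<in> set D \<and> 0 < r")
    case False
    then have arcs: "arc_on \<theta> (-1) 0 t1" "arc_on \<theta> 1 t1 t2" "arc_on \<theta> (-1) t2 T"
      using seg by (auto intro!: seg_no_dwell simp: D_def not_less)
    have len: "t1 = a - c" "t2 - t1 = d - c" "T - t2 = d - b"
      using arc_on_end[OF arcs(1)] arc_on_end[OF arcs(2)] arc_on_end[OF arcs(3)]
      by (auto simp: a_def b_def c_def d_def)
    note I = path_type_aI[OF P_pos]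
    \<comment> \<open>A short middle arc is type (b). If an outer arc is missing or the middle arc
      consists of full loops, the path is type (a). The last case is excluded by
      \<open>no_long_middle_arc\<close>.\<close>
    consider "t2 - t1 \<le> P" | "t1 = 0" | "t2 = T" | n where "t2 - t1 = P * real n" |
      "0 < t1" "t2 < T" "P < t2 - t1" "\<And>n. t2 - t1 \<noteq> P * real n"
      using t12 by force
    then show ?thesis
    proof cases
      case 1
      have "t1 \<le> t2 - t1" "T - t2 \<le> t2 - t1" using len abcd by linarith+
      then have "path_type_b P \<theta> T"
        unfolding path_type_b_def using arcs 1 by (intro exI[of _ "-1"] exI[of _ t1] exI[of _ t2]) auto
      then show ?thesis ..
    next
      case 2
      then show ?thesis using I[of 1 "-1" \<theta> t2 t2 T] arcs loops.rest[OF arc_on_refl] by auto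
    next
      case 3
      then show ?thesis using I[of "-1" 1 \<theta> t1 t1 T] arcs loops.rest[OF arc_on_refl] by auto
    next
      case (4 n)
      then have "loops P \<theta> t1 t2" using arc_loops[OF _ P_pos, of 1 \<theta> t1 n] arcs(2) by (simp add: algebra_simps)
      then show ?thesis using I[of "-1" "-1" \<theta> t1 t2 T] arcs by auto
    next
      case 5
      then show ?thesis using no_long_middle_arc[OF opt ab arcs] by blast
    qed
  next
    case True
    then obtain s1 r1 where s1: "(s1, r1) \<in> set D" "0 < r1" by blast
    show ?thesis
    proof (cases "c = d")
      case True
      then have "arc_on \<theta> 0 0 T"
        using arc_on_join[OF arc_on_join[OF seg_empty[OF seg(1)] seg_empty[OF seg(2)]] seg_empty[OF seg(3)]] abcd
        by (auto simp: a_def b_def c_def d_def)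
      then show ?thesis
        using path_type_aI[OF P_pos, of 1 1 \<theta> 0 T T] arc_on_refl loops.rest by blast
    next
      case False
      then have cd: "c < d" using abcd by auto
      have rng: "c \<le> \<theta> t \<and> \<theta> t \<le> d" if "0 \<le> t" "t \<le> T" for t
      proof -
        consider "t \<le> t1" | "t1 \<le> t" "t \<le> t2" | "t2 \<le> t" by linarith
        then show ?thesis
        proof cases
          case 1
          then show ?thesis using seg_mono[OF seg(1), of 0 t] seg_mono[OF seg(1), of t t1] that abcd
            by (auto simp: a_def c_def)
        next
          case 2
          then show ?thesis using seg_mono[OF seg(2), of t1 t] seg_mono[OF seg(2), of t t2] that abcd
            by (auto simp: d_def c_def)
        next
          case 3
          then show ?thesis using seg_mono[OF seg(3), of t2 t] seg_mono[OF seg(3), of t T] that abcd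
            by (auto simp: b_def d_def)
        qed
      qed
      have Dr: "\<forall>(l, r)\<in>set D. 0 \<le> r \<and> c \<le> l \<and> l \<le> d"
      proof safe
        fix l r assume "(l, r) \<in> set D"
        then have "0 \<le> r \<and> l \<in> \<theta> ` {0..T}"
          unfolding D_def using seg_levels[OF seg(1)] seg_levels[OF seg(2)] seg_levels[OF seg(3)] t12
          by (fastforce simp: image_iff)
        then show "0 \<le> r" "c \<le> l" "l \<le> d" using rng by auto
      qed
      have "((\<lambda>t. p (\<theta> t)) has_integral
         ((-1) *\<^sub>R (prim p (\<theta> t1) - prim p (\<theta> 0)) + (\<Sum>(l, r)\<leftarrow>D1. r *\<^sub>R p l) +
         (1 *\<^sub>R (prim p (\<theta> t2) - prim p (\<theta> t1)) + (\<Sum>(l, r)\<leftarrow>D2. r *\<^sub>R p l)) +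
         ((-1) *\<^sub>R (prim p (\<theta> T) - prim p (\<theta> t2)) + (\<Sum>(l, r)\<leftarrow>D3. r *\<^sub>R p l)))) {0..T}"
        using t12 seg cont
        by (intro has_integral_combine[where a = 0 and c = t2 and b = T]
            has_integral_combine[where a = 0 and c = t1 and b = t2] seg_has_integral) auto
      then have W: "disp \<theta> T = base a b c d + (\<Sum>(l, r)\<leftarrow>D. r *\<^sub>R p l)"
        unfolding disp_def base_def D_def a_def b_def c_def d_def
        by (simp add: integral_unique algebra_simps)
      have T: "T = len a b c d + (\<Sum>(l, r)\<leftarrow>D. r)"
        using seg_duration[OF seg(1)] seg_duration[OF seg(2)] seg_duration[OF seg(3)]
        by (simp add: len_def D_def a_def b_def c_def d_def)
      have "separable a b (base a b c d + (\<Sum>(l, r)\<leftarrow>D. r *\<^sub>R p l)) (len a b c d + (\<Sum>(l, r)\<leftarrow>D. r))"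
        using optimal_imp_separable[OF opt] W T by (metis a_def b_def)
      from dwell_conditions[OF this Dr abcd(1-3) cd s1] obtain \<psi> where \<psi>: "\<psi> \<noteq> 0" "\<forall>(l, r)\<in>set D. 0 < r \<longrightarrow> argmax \<psi> l"
        "c < a \<longrightarrow> argmax \<psi> c" "b < d \<longrightarrow> argmax \<psi> d"
        by blast
      have Z: "\<exists>k::int. l' = l + P * of_int k" if "argmax \<psi> l" "argmax \<psi> l'" for l l'
        by (rule argmax_unique[OF \<psi>(1) that]) blast
      let ?U = "type_a_until P (argmax \<psi>) \<theta>"
      \<comment> \<open>An event closes the unfinished arc, so the next one may start with any
        velocity.\<close>
      have switch: "?U \<tau> t" if "?U \<sigma> t" "argmax \<psi> (\<theta> t)" "\<sigma> = 1 \<or> \<sigma> = -1" for \<sigma> \<tau> t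
      proof (rule type_a_until_event[OF P_pos Z that(3,1,2)])
        fix \<tau>' x assume "\<tau>' = 1 \<or> \<tau>' = -1" "arc_on \<theta> \<tau>' 0 x" "loops P \<theta> x t"
        then show ?thesis
          unfolding type_a_until_def using that(2) arc_on_refl
          by (intro disjI2 exI[of _ \<tau>'] exI[of _ x] exI[of _ t]) simp
      qed
      have dw: "argmax \<psi> l" if "(l, r) \<in> set D1 \<union> set D2 \<union> set D3" "0 < r" for l r
        using \<psi>(2) that by (auto simp: D_def)
      have U1: "?U (-1) t1"
        using dw by (intro type_a_until_seg[OF P_pos Z _ seg(1)]) (auto simp: type_a_until_def arc_on_refl)
      \<comment> \<open>For \<open>c = a\<close> the condition on turns says nothing; but a first
        segment of positive duration then contains a dwell at \<open>c\<close>.\<close>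
      have "t1 = 0 \<or> argmax \<psi> c"
      proof (cases "c < a")
        case False
        then have "\<theta> 0 = \<theta> t1" using abcd by (simp add: a_def c_def)
        then show ?thesis
          using seg_empty_dwell[OF seg(1)] dw t12(1)
          by (metis UnCI c_def less_eq_real_def)
      qed (use \<psi> in simp)
      then have U1': "?U 1 t1"
        using switch[OF U1] arc_on_refl by (auto simp: c_def type_a_until_def)
      have U2: "?U 1 t2"
        using dw by (intro type_a_until_seg[OF P_pos Z _ seg(2) U1']) auto
      have "t2 = T \<or> argmax \<psi> d"
      proof (cases "b < d")
        case False
        then have "\<theta> t2 = \<theta> T" using abcd by (simp add: b_def d_def)
        then show ?thesis
          using seg_empty_dwell[OF seg(3)] dw t12(3)
          by (metis UnCI d_def less_eq_real_def)
      qed (use \<psi> in simp)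
      then have "\<exists>\<sigma>. (\<sigma> = 1 \<or> \<sigma> = -1) \<and> ?U \<sigma> T"
      proof
        assume "t2 = T"
        then show ?thesis using U2 by auto
      next
        assume "argmax \<psi> d"
        then have "?U (-1) t2" using switch[OF U2] by (simp add: d_def)
        then have "?U (-1) T"
          using dw by (intro type_a_until_seg[OF P_pos Z _ seg(3)]) auto
        then show ?thesis by auto
      qed
      then obtain \<sigma> where \<sigma>: "\<sigma> = 1 \<or> \<sigma> = -1" "?U \<sigma> T" by blast
      from \<sigma>(2) have "path_type_a P \<theta> T"
        unfolding type_a_until_def
      proof (elim disjE exE conjE)
        assume "arc_on \<theta> \<sigma> 0 T"
        then show ?thesis
          using path_type_aI[OF P_pos \<sigma>(1) \<sigma>(1), of \<theta> T T T] arc_on_refl loops.rest by blast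
      qed (use path_type_aI[OF P_pos _ \<sigma>(1)] in blast)+
      then show ?thesis ..
    qed
  qed
qed

text \<open>In the second alternative the endpoints agree, so the reflected path again satisfies the
  order hypothesis of \<open>zigzag_types\<close>.\<close>

lemma optimal_types_le:
  assumes opt: "optimal \<theta> T" and ab: "\<theta> 0 \<le> \<theta> T"
  shows "path_type_a P \<theta> T \<or> path_type_b P \<theta> T"
proof (rule optimal_path_segs[OF opt ab])
  fix t1 t2 D1 D2 D3
  assume *: "0 \<le> t1" "t1 \<le> t2" "t2 \<le> T" "\<theta> 0 = \<theta> T" "seg 1 \<theta> 0 t1 D1" "seg (-1) \<theta> t1 t2 D2" "seg 1 \<theta> t2 T D3"
  interpret r: sc_curve "\<lambda>s. p (- s)" P \<Omega> by (rule reflect)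
  have "path_type_a P (\<lambda>t. - \<theta> t) T \<or> path_type_b P (\<lambda>t. - \<theta> t) T"
    using *(4) seg_uminus[OF *(5)] seg_uminus[OF *(6)] seg_uminus[OF *(7)]
    by (intro r.zigzag_types[OF optimal_reflect[OF opt] _ *(1-3)]) auto
  then show ?thesis using path_type_a_uminus path_type_b_uminus by blast
qed (rule zigzag_types[OF opt ab])

theorem optimal_types:
  assumes opt: "optimal \<theta> T"
  shows "path_type_a P \<theta> T \<or> path_type_b P \<theta> T"
proof (cases "\<theta> 0 \<le> \<theta> T")
  case True
  then show ?thesis by (rule optimal_types_le[OF opt])
next
  case False
  interpret r: sc_curve "\<lambda>s. p (- s)" P \<Omega> by (rule reflect)
  have "path_type_a P (\<lambda>t. - \<theta> t) T \<or> path_type_b P (\<lambda>t. - \<theta> t) T"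
    using False by (intro r.optimal_types_le[OF optimal_reflect[OF opt]]) auto
  then show ?thesis using path_type_a_uminus path_type_b_uminus by blast
qed

end

subsection \<open>Rotations preserve area\<close>

text \<open>Orthogonal invariance of Lebesgue measure is applied in \<open>real^2\<close>;
  \<open>vec2\<close> and \<open>cpx\<close> transport sets there and back as measure-preserving
  linear isometries.\<close>

definition vec2 :: "complex \<Rightarrow> real^2" where
  "vec2 z = (\<chi> i. if i = 1 then Re z else Im z)"

definition cpx :: "real^2 \<Rightarrow> complex" where
  "cpx v = Complex (v $ 1) (v $ 2)"

lemma cpx_vec2: "cpx (vec2 z) = z"
  by (simp add: cpx_def vec2_def complex_eq_iff)

lemma vec2_cpx: "vec2 (cpx v) = v"
  by (simp add: cpx_def vec2_def vec_eq_iff forall_2)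

lemma cpx_measurable: "cpx \<in> borel_measurable borel"
proof -
  have "continuous_on UNIV cpx"
    unfolding cpx_def by (intro continuous_intros)
  then show ?thesis by (rule borel_measurable_continuous_onI)
qed

text \<open>Lebesgue measure is determined by its values on boxes, and \<open>cpx\<close> matches
  boxes with equal side lengths.\<close>

lemma lborel_complex: "(lborel :: complex measure) = distr (lborel :: (real^2) measure) borel cpx"
proof (rule lborel_eqI)
  fix l u :: complex
  assume le: "\<And>b. b \<in> Basis \<Longrightarrow> l \<bullet> b \<le> u \<bullet> b"
  then have le': "Re l \<le> Re u" "Im l \<le> Im u" using le[of 1] le[of \<i>] by (auto simp: Basis_complex_def)
  have "cpx -` box l u = box (vec2 l) (vec2 u)"
    by (auto simp: box_def cpx_def vec2_def Basis_complex_def Basis_vec_def inner_axis forall_2)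
  then have "emeasure (distr lborel borel cpx) (box l u) = emeasure lborel (box (vec2 l) (vec2 u))"
    using cpx_measurable by (subst emeasure_distr) auto
  also have "\<dots> = ennreal (\<Prod>b\<in>Basis. (vec2 u - vec2 l) \<bullet> b)"
    using le' by (intro emeasure_lborel_box) (auto simp: Basis_vec_def vec2_def inner_axis)
  also have "(\<Prod>b\<in>Basis. (vec2 u - vec2 l) \<bullet> b) = (\<Prod>b\<in>Basis. (u - l) \<bullet> b)"
  proof -
    have B: "(Basis :: (real^2) set) = (\<lambda>i. axis i 1) ` UNIV"
      by (auto simp: Basis_vec_def)
    have "(\<Prod>b\<in>Basis. (vec2 u - vec2 l) \<bullet> b) = (\<Prod>i\<in>UNIV. (vec2 u - vec2 l) \<bullet> axis i (1::real))"
      unfolding B by (subst prod.reindex) (auto simp: inj_on_def axis_eq_axis)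
    also have "\<dots> = (Re u - Re l) * (Im u - Im l)"
      by (simp add: UNIV_2 inner_axis vec2_def)
    finally show ?thesis
      by (simp add: Basis_complex_def)
  qed
  finally show "emeasure (distr lborel borel cpx) (box l u) = ennreal (\<Prod>b\<in>Basis. (u - l) \<bullet> b)" .
qed simp

lemma measure_vec2_image:
  assumes "S \<in> sets borel"
  shows "measure lebesgue (vec2 ` S) = measure lebesgue S" "vec2 ` S \<in> sets borel"
proof -
  have eq: "vec2 ` S = cpx -` S"
  proof safe
    fix v assume "cpx v \<in> S"
    then show "v \<in> vec2 ` S" using vec2_cpx[of v] by (metis image_eqI)
  qed (simp add: cpx_vec2)
  show sets: "vec2 ` S \<in> sets borel"
    unfolding eq using measurable_sets[OF cpx_measurable assms] by simp
  have "measure lborel S = measure lborel (vec2 ` S)"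
    unfolding eq by (subst lborel_complex, subst measure_distr) (use cpx_measurable assms in auto)
  then show "measure lebesgue (vec2 ` S) = measure lebesgue S"
    using assms sets by (simp add: measure_completion)
qed

lemma norm_vec2: "norm (vec2 z) = norm z"
  by (simp add: norm_eq_sqrt_inner inner_vec_def sum_2 vec2_def inner_complex_def)

lemma linear_vec2: "linear vec2"
  by (rule linearI) (auto simp: vec2_def vec_eq_iff forall_2)

lemma linear_cpx: "linear cpx"
  by (rule linearI) (auto simp: cpx_def complex_eq_iff)

lemma measure_rotation:
  assumes "compact S"
  shows "measure lebesgue ((\<lambda>z. cis \<alpha> * z) ` S) = measure lebesgue S"
proof -
  let ?R = "\<lambda>z. cis \<alpha> * z"
  let ?f = "\<lambda>v. vec2 (?R (cpx v))"
  have bS: "S \<in> sets borel" using assms by (simp add: borel_closed compact_imp_closed)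
  have "compact (?R ` S)"
    by (intro compact_continuous_image continuous_intros assms)
  then have bRS: "?R ` S \<in> sets borel" by (simp add: borel_closed compact_imp_closed)
  have norm_cpx: "norm (cpx v) = norm v" for v
    using norm_vec2[of "cpx v"] by (simp add: vec2_cpx)
  have lin: "linear ?f"
    using linear_compose[OF linear_compose[OF linear_cpx, of ?R] linear_vec2]
    by (simp add: o_def linear_times)
  have f: "orthogonal_transformation ?f"
    unfolding orthogonal_transformation using lin by (simp add: norm_vec2 norm_mult norm_cpx)
  have "compact (vec2 ` S)"
    using linear_vec2 assms by (simp add: compact_continuous_image linear_continuous_on linear_conv_bounded_linear)
  then have "vec2 ` S \<in> lmeasurable" by (rule lmeasurable_compact)
  then have "measure lebesgue (?f ` vec2 ` S) = measure lebesgue (vec2 ` S)"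
    by (rule measure_orthogonal_image[OF f])
  also have "?f ` vec2 ` S = vec2 ` ?R ` S"
    by (simp add: image_image cpx_vec2)
  finally show ?thesis
    using measure_vec2_image(1)[OF bS] measure_vec2_image(1)[OF bRS] by simp
qed

lemma area_rot: "compact \<Omega> \<Longrightarrow> area (rot \<alpha> \<Omega>) = area \<Omega>"
  by (simp add: area_def rot_def measure_rotation)

subsection \<open>The polar parametrization of the boundary\<close>

locale strictly_convex_body =
  fixes \<Omega> :: "complex set"
  assumes compact: "compact \<Omega>" and conv: "convex \<Omega>" and zero: "0 \<in> interior \<Omega>"
    and strict: "strictly_convex_set \<Omega>"
begin

text \<open>A sector with arbitrary initial angle, so that increments of the sector area can be
  estimated.\<close>

definition wedge :: "real \<Rightarrow> real \<Rightarrow> complex set" where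
  "wedge a b = {z \<in> \<Omega>. \<exists>r t. 0 \<le> r \<and> a \<le> t \<and> t \<le> b \<and> z = of_real r * cis t}"

lemma sector_eq_wedge: "sector \<Omega> \<phi> = wedge 0 \<phi>"
  by (auto simp: sector_def wedge_def)

lemma wedgeI: "z \<in> \<Omega> \<Longrightarrow> z = of_real r * cis t \<Longrightarrow> 0 \<le> r \<Longrightarrow> a \<le> t \<Longrightarrow> t \<le> b \<Longrightarrow> z \<in> wedge a b"
  by (auto simp: wedge_def)

lemma wedge_mono:
  assumes "a' \<le> a" "b \<le> b'"
  shows "wedge a b \<subseteq> wedge a' b'"
proof
  fix z assume "z \<in> wedge a b"
  then obtain r t where "z \<in> \<Omega>" "z = of_real r * cis t" "0 \<le> r" "a \<le> t" "t \<le> b" by (auto simp: wedge_def)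
  then show "z \<in> wedge a' b'" using assms by (intro wedgeI[of z r t]) auto
qed

lemma bounded_body: obtains B where "0 < B" "\<And>z. z \<in> \<Omega> \<Longrightarrow> norm z \<le> B"
  using compact_imp_bounded[OF compact] bounded_pos by metis

lemma wedge_compact: "compact (wedge a b)"
proof -
  obtain B where B: "0 < B" "\<And>z. z \<in> \<Omega> \<Longrightarrow> norm z \<le> B" using bounded_body by blast
  have eq: "wedge a b = \<Omega> \<inter> (\<lambda>(r, t). of_real r * cis t) ` ({0..B} \<times> {a..b})"
  proof safe
    fix z assume "z \<in> wedge a b"
    then obtain r t where z: "z \<in> \<Omega>" "0 \<le> r" "a \<le> t" "t \<le> b" "z = of_real r * cis t"
      by (auto simp: wedge_def)
    then have "r \<le> B" using B(2)[OF z(1)] by (simp add: norm_mult)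
    then show "z \<in> (\<lambda>(r, t). of_real r * cis t) ` ({0..B} \<times> {a..b})" using z by force
  qed (auto simp: wedge_def)
  have "continuous_on ({0..B} \<times> {a..b}) (\<lambda>(r, t). of_real r * cis t :: complex)"
    unfolding case_prod_unfold by (intro continuous_intros)
  then have "compact ((\<lambda>(r, t). of_real r * cis t :: complex) ` ({0..B} \<times> {a..b}))"
    by (intro compact_continuous_image compact_Times) auto
  then show ?thesis unfolding eq by (intro compact_Int compact)
qed

lemma wedge_measurable: "wedge a b \<in> lmeasurable"
  by (rule lmeasurable_compact[OF wedge_compact])

text \<open>Rotated to start at the positive real axis, a wedge of opening \<delta> lies in a box
  with half sides \<open>B\<close> and \<open>B * \<delta>\<close>. Continuity of the sector area
  and its vanishing at angle 0 both follow from this linear bound.\<close>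

lemma wedge_measure_bound:
  obtains C where "0 < C" "\<And>a b. a \<le> b \<Longrightarrow> measure lebesgue (wedge a b) \<le> C * (b - a)"
proof -
  obtain B where B: "0 < B" "\<And>z. z \<in> \<Omega> \<Longrightarrow> norm z \<le> B" using bounded_body by blast
  have "measure lebesgue (wedge a b) \<le> (4 * B * B) * (b - a)" if ab: "a \<le> b" for a b
  proof -
    define \<delta> where "\<delta> = b - a"
    let ?Q = "cbox (Complex (- B) (- (B * \<delta>))) (Complex B (B * \<delta>))"
    have sub: "(\<lambda>z. cis (- a) * z) ` wedge a b \<subseteq> ?Q"
    proof safe
      fix z assume "z \<in> wedge a b"
      then obtain r t where z: "z \<in> \<Omega>" "0 \<le> r" "a \<le> t" "t \<le> b" "z = of_real r * cis t"
        by (auto simp: wedge_def)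
      have r: "r \<le> B" using B(2)[OF z(1)] z(2,5) by (simp add: norm_mult)
      have eq: "cis (- a) * z = of_real r * cis (t - a)"
        unfolding z(5) by (metis cis_mult mult.left_commute uminus_add_conv_diff)
      have "\<bar>r * cos (t - a)\<bar> \<le> B * 1"
        unfolding abs_mult using r z(2) B(1) by (intro mult_mono) auto
      moreover have "\<bar>r * sin (t - a)\<bar> \<le> B * \<delta>"
        unfolding abs_mult using r z(2,3,4) B(1) abs_sin_x_le_abs_x[of "t - a"]
        by (intro mult_mono) (auto simp: \<delta>_def)
      ultimately show "cis (- a) * z \<in> ?Q"
        unfolding eq by (auto simp: in_cbox_complex_iff abs_le_iff)
    qed
    have "measure lebesgue (wedge a b) = measure lebesgue ((\<lambda>z. cis (- a) * z) ` wedge a b)"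
      using measure_rotation[OF wedge_compact] by simp
    also have "\<dots> \<le> measure lebesgue ?Q"
    proof (rule measure_mono_fmeasurable[OF sub])
      have "compact ((\<lambda>z. cis (- a) * z) ` wedge a b)"
        by (intro compact_continuous_image continuous_intros wedge_compact)
      then show "(\<lambda>z. cis (- a) * z) ` wedge a b \<in> sets lebesgue"
        using lmeasurable_compact by blast
    qed (rule lmeasurable_cbox)
    also have "\<dots> = (2 * B) * (2 * (B * \<delta>))"
    proof -
      have "\<delta> \<ge> 0" using ab by (simp add: \<delta>_def)
      then show ?thesis
        using B(1) by (subst measure_completion) (auto simp: measure_lborel_cbox_eq Basis_complex_def)
    qed
    finally show ?thesis by (simp add: \<delta>_def algebra_simps)
  qed
  then show ?thesis using B(1) that[of "4 * B * B"] by simp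
qed

lemma body_polar:
  assumes "z \<in> \<Omega>"
  obtains r t where "0 \<le> r" "0 \<le> t" "t < 2 * pi" "z = of_real r * cis t"
proof -
  have "z = of_real (norm z) * cis (Arg2pi z)"
    using Arg2pi_eq[of z] by (simp add: cis_conv_exp)
  then show ?thesis using that[of "norm z" "Arg2pi z"] Arg2pi by simp
qed

section \<open>Sector area as a function of the polar angle\<close>

definition A :: "real \<Rightarrow> real" where
  "A \<phi> = measure lebesgue (wedge 0 \<phi>)"

lemma A_0: "A 0 = 0"
proof -
  obtain C where C: "\<And>a b. a \<le> b \<Longrightarrow> measure lebesgue (wedge a b) \<le> C * (b - a)"
    using wedge_measure_bound by metis
  show ?thesis using C[of 0 0] measure_nonneg[of lebesgue "wedge 0 0"] by (simp add: A_def)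
qed

lemma A_2pi: "A (2 * pi) = area \<Omega>"
proof -
  have "wedge 0 (2 * pi) = \<Omega>"
  proof
    show "\<Omega> \<subseteq> wedge 0 (2 * pi)"
    proof
      fix z assume z: "z \<in> \<Omega>"
      then obtain r t where "0 \<le> r" "0 \<le> t" "t < 2 * pi" "z = of_real r * cis t" by (rule body_polar)
      then show "z \<in> wedge 0 (2 * pi)" using z by (force simp: wedge_def)
    qed
  qed (auto simp: wedge_def)
  then show ?thesis by (simp add: A_def area_def)
qed

lemma A_continuous: "continuous_on {0..2*pi} A"
proof -
  obtain C where C: "0 < C" "\<And>a b. a \<le> b \<Longrightarrow> measure lebesgue (wedge a b) \<le> C * (b - a)"
    using wedge_measure_bound by metis
  have *: "\<bar>A y - A x\<bar> \<le> C * (y - x)" if "0 \<le> x" "x \<le> y" for x y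
  proof -
    have "A x \<le> A y"
      unfolding A_def using that
      by (intro measure_mono_fmeasurable wedge_measurable fmeasurableD) (force simp: wedge_def)
    moreover have "A y \<le> measure lebesgue (wedge 0 x \<union> wedge x y)"
      unfolding A_def using that
      by (intro measure_mono_fmeasurable fmeasurableD fmeasurable.Un wedge_measurable) (force simp: wedge_def)
    moreover have "\<dots> \<le> A x + measure lebesgue (wedge x y)"
      unfolding A_def by (intro measure_Un_le fmeasurableD wedge_measurable)
    ultimately show ?thesis using C(2)[OF that(2)] by linarith
  qed
  show ?thesis
  proof (rule continuous_onI)
    fix x e :: real assume x: "x \<in> {0..2*pi}" "0 < e"
    show "\<exists>d>0. \<forall>x'\<in>{0..2*pi}. dist x' x < d \<longrightarrow> dist (A x') (A x) \<le> e"
    proof (intro exI[of _ "e / C"] conjI ballI impI)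
      fix x' assume x': "x' \<in> {0..2*pi}" "dist x' x < e / C"
      then have "C * \<bar>x' - x\<bar> \<le> e" using C(1) by (simp add: dist_real_def field_simps)
      then show "dist (A x') (A x) \<le> e"
        using *[of x x'] *[of x' x] x x' by (cases "x \<le> x'") (auto simp: dist_real_def)
    qed (use x C in auto)
  qed
qed

lemma cis_eq_imp:
  assumes "cis s = cis t" "\<bar>s - t\<bar> < 2 * pi"
  shows "s = t"
proof -
  have "cis (s - t) = 1" using assms(1) by (simp add: cis_divide[symmetric])
  then have "cos (s - t) = 1" by (simp add: complex_eq_iff)
  then obtain k :: int where k: "s - t = of_int k * 2 * pi"
    by (auto simp: cos_one_2pi_int)
  then have "\<bar>of_int k :: real\<bar> * (2 * pi) < 1 * (2 * pi)" using assms(2) by (simp add: abs_mult)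
  then have "k = 0" by (simp add: mult_less_cancel_right)
  then show ?thesis using k by simp
qed

lemma polar_unique:
  assumes "of_real r * cis s = of_real r' * cis t" "0 < r" "0 \<le> r'"
  shows "r = r'" "cis s = cis t"
proof -
  have "norm (of_real r * cis s) = norm (of_real r' * cis t)" using assms(1) by simp
  then show "r = r'" using assms(2,3) by (simp add: norm_mult)
  then show "cis s = cis t" using assms by auto
qed

text \<open>Removing the two complementary closed wedges from the interior leaves an open set
  \<open>V\<close> with polar angles between \<open>x\<close> and \<open>y\<close>. A short vector
  in the bisecting direction lies in it, because 0 is interior, so \<open>V\<close> has positive
  measure.\<close>

lemma A_strict_mono:
  assumes "0 \<le> x" "x < y" "y \<le> 2 * pi"
  shows "A x < A y"
proof -
  obtain e where e: "0 < e" "ball 0 e \<subseteq> \<Omega>"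
    using zero by (meson mem_interior)
  define V where "V = interior \<Omega> - (wedge 0 x \<union> wedge y (2 * pi))"
  have "closed (wedge 0 x \<union> wedge y (2 * pi))"
    by (intro closed_Un compact_imp_closed wedge_compact)
  then have oV: "open V" unfolding V_def by (intro open_Diff open_interior)
  define m where "m = (x + y) / 2"
  define z where "z = of_real (e / 2) * cis m"
  have m: "x < m" "m < y" using assms by (auto simp: m_def)
  have "z \<in> ball 0 e" using e by (simp add: z_def norm_mult)
  then have "z \<in> interior \<Omega>" using e interior_maximal[OF e(2) open_ball] by blast
  moreover have "z \<notin> wedge 0 x" "z \<notin> wedge y (2 * pi)"
  proof -
    have "False" if "z = of_real r * cis t" "0 \<le> r" "t \<noteq> m" "\<bar>m - t\<bar> < 2 * pi" for r t
      using polar_unique[of "e / 2" m r t] cis_eq_imp[of m t] that e by (auto simp: z_def)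
    note no = this
    show "z \<notin> wedge 0 x"
    proof
      assume "z \<in> wedge 0 x"
      then obtain r t where "z = of_real r * cis t" "0 \<le> r" "0 \<le> t" "t \<le> x" by (auto simp: wedge_def)
      moreover then have "t \<noteq> m" "\<bar>m - t\<bar> < 2 * pi" using m assms unfolding abs_less_iff by linarith+
      ultimately show False using no by blast
    qed
    show "z \<notin> wedge y (2 * pi)"
    proof
      assume "z \<in> wedge y (2 * pi)"
      then obtain r t where "z = of_real r * cis t" "0 \<le> r" "y \<le> t" "t \<le> 2 * pi" by (auto simp: wedge_def)
      moreover then have "t \<noteq> m" "\<bar>m - t\<bar> < 2 * pi" using m assms unfolding abs_less_iff by linarith+
      ultimately show False using no by blast
    qed
  qed
  ultimately have "z \<in> V" by (simp add: V_def)
  then have nV: "\<not> negligible V" using open_not_negligible[OF oV] by auto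
  have VW: "V \<subseteq> wedge 0 y"
  proof
    fix w assume w: "w \<in> V"
    then have "w \<in> \<Omega>" using interior_subset by (auto simp: V_def)
    then obtain r t where rt: "0 \<le> r" "0 \<le> t" "t < 2 * pi" "w = of_real r * cis t" by (rule body_polar)
    have "w \<notin> wedge y (2 * pi)" using w by (simp add: V_def)
    then have "\<not> y \<le> t" using wedgeI[OF \<open>w \<in> \<Omega>\<close> rt(4,1)] rt(3) by (meson less_imp_le)
    then show "w \<in> wedge 0 y" using wedgeI[OF \<open>w \<in> \<Omega>\<close> rt(4,1,2)] by (simp add: not_le less_imp_le)
  qed
  have lV: "V \<in> lmeasurable"
    using VW by (intro bounded_set_imp_lmeasurable bounded_subset[OF compact_imp_bounded[OF wedge_compact] VW])
      (simp add: oV borel_open sets_completionI_sets)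
  have pos: "0 < measure lebesgue V"
    using nV negligible_iff_measure0[OF lV] measure_nonneg[of lebesgue V] by (simp add: less_le)
  have "wedge 0 x \<inter> V = {}" by (auto simp: V_def)
  then have "A x + measure lebesgue V = measure lebesgue (wedge 0 x \<union> V)"
    unfolding A_def using measure_Un3[OF wedge_measurable lV, of 0 x] by simp
  also have "\<dots> \<le> A y"
    unfolding A_def using VW wedge_mono[of 0 0 x y] assms
    by (intro measure_mono_fmeasurable wedge_measurable fmeasurableD fmeasurable.Un lV Un_least) auto
  finally show ?thesis using pos by simp
qed

lemma area_pos: "0 < area \<Omega>"
  using A_strict_mono[of 0 "2 * pi"] A_0 A_2pi by simp

lemma frontier_subset: "frontier \<Omega> \<subseteq> \<Omega>"
  using compact_imp_closed[OF compact] by (rule frontier_subset_closed)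

lemma frontier_disjoint: "z \<in> frontier \<Omega> \<Longrightarrow> z \<notin> interior \<Omega>"
  by (simp add: frontier_def)

text \<open>The nearer of two boundary points on a ray would lie strictly between 0 and the farther
  one, hence in the interior by strict convexity.\<close>

lemma frontier_ray_unique:
  assumes "0 < r" "0 < r'" "of_real r * cis s \<in> frontier \<Omega>" "of_real r' * cis s \<in> frontier \<Omega>"
  shows "r = r'"
proof -
  have *: "\<not> r < r'" if "0 < r" "of_real r * cis s \<in> frontier \<Omega>" "of_real r' * cis s \<in> frontier \<Omega>" for r r'
  proof
    assume lt: "r < r'"
    define z where "z = of_real r' * cis s"
    have "z \<in> \<Omega>" "0 \<in> \<Omega>" using that(3) frontier_subset zero interior_subset by (auto simp: z_def)
    moreover have "z \<noteq> 0" using that lt by (simp add: z_def)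
    moreover have "0 < r / r'" "r / r' < 1" using that lt by auto
    ultimately have "(1 - r / r') *\<^sub>R 0 + (r / r') *\<^sub>R z \<in> interior \<Omega>"
      using strict unfolding strictly_convex_set_def by metis
    moreover have "(r / r') *\<^sub>R z = of_real r * cis s"
      using that lt by (simp add: z_def scaleR_conv_of_real)
    ultimately show False using frontier_disjoint[OF that(2)] by simp
  qed
  show ?thesis using *[of r r'] *[of r' r] assms by linarith
qed

definition radial :: "complex \<Rightarrow> complex" where
  "radial w = (SOME z. z \<in> frontier \<Omega> \<and> (\<exists>r>0. z = of_real r * w))"

lemma radial:
  assumes "norm w = 1"
  shows "radial w \<in> frontier \<Omega>" "\<exists>r>0. radial w = of_real r * w"
proof -
  have "w \<noteq> 0" using assms by auto
  then obtain d where "0 < d" "0 + d *\<^sub>R w \<in> frontier \<Omega>"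
    using ray_to_frontier[OF compact_imp_bounded[OF compact] zero] by metis
  then have "\<exists>z. z \<in> frontier \<Omega> \<and> (\<exists>r>0. z = of_real r * w)"
    by (auto simp: scaleR_conv_of_real)
  then have "radial w \<in> frontier \<Omega> \<and> (\<exists>r>0. radial w = of_real r * w)"
    unfolding radial_def by (rule someI_ex)
  then show "radial w \<in> frontier \<Omega>" "\<exists>r>0. radial w = of_real r * w" by blast+
qed

lemma radial_eq:
  assumes "0 < r" "of_real r * cis s \<in> frontier \<Omega>"
  shows "radial (cis s) = of_real r * cis s"
proof -
  obtain r' where "0 < r'" "radial (cis s) = of_real r' * cis s" using radial(2)[of "cis s"] by auto
  then show ?thesis using frontier_ray_unique[OF assms(1), of r' s] assms radial(1)[of "cis s"] by auto
qed

text \<open>\<open>radial\<close> inverts the continuous map \<open>sgn\<close> on the compact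
  frontier.\<close>

lemma radial_continuous: "continuous_on (sphere 0 1) radial"
proof -
  have nz: "z \<noteq> 0" if "z \<in> frontier \<Omega>" for z using frontier_disjoint[OF that] zero by auto
  have cf: "continuous_on (frontier \<Omega>) sgn"
    by (intro continuous_on_sgn continuous_on_id) (use nz in auto)
  have inv: "\<forall>z\<in>frontier \<Omega>. radial (sgn z) = z"
  proof
    fix z assume z: "z \<in> frontier \<Omega>"
    have sz: "sgn z = cis (Arg z)" using nz[OF z] by (simp add: cis_Arg)
    have "of_real (norm z) * cis (Arg z) = z" using nz[OF z]
      by (simp add: cis_Arg sgn_eq)
    then show "radial (sgn z) = z"
      using radial_eq[of "norm z" "Arg z"] z nz[OF z] by (simp add: sz)
  qed
  have "sphere 0 1 \<subseteq> sgn ` frontier \<Omega>"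
  proof
    fix w :: complex assume w: "w \<in> sphere 0 1"
    then obtain r where r: "r > 0" "radial w = of_real r * w" using radial(2)[of w] by auto
    have "w = sgn (radial w)" using r w by (simp add: sgn_div_norm norm_mult scaleR_conv_of_real)
    then show "w \<in> sgn ` frontier \<Omega>" using radial(1)[of w] w by auto
  qed
  then show ?thesis
    using continuous_on_inv[OF cf compact_frontier[OF compact] inv] continuous_on_subset by blast
qed

abbreviation "P \<equiv> 2 * area \<Omega>"

definition angle :: "real \<Rightarrow> real" where
  "angle = the_inv_into {0..2*pi} (\<lambda>\<phi>. 2 * A \<phi>)"

lemma A_inj: "inj_on (\<lambda>\<phi>. 2 * A \<phi>) {0..2*pi}"
proof (rule inj_onI)
  fix x y assume "x \<in> {0..2*pi}" "y \<in> {0..2*pi}" "2 * A x = 2 * A y"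
  then show "x = y"
    using A_strict_mono[of x y] A_strict_mono[of y x] by (cases x y rule: linorder_cases) auto
qed

lemma double_A_continuous: "continuous_on {0..2*pi} (\<lambda>\<phi>. 2 * A \<phi>)"
  by (intro continuous_on_mult_left A_continuous)

lemma A_image: "(\<lambda>\<phi>. 2 * A \<phi>) ` {0..2*pi} = {0..P}"
proof
  have "0 \<le> A \<phi>" "A \<phi> \<le> area \<Omega>" if "0 \<le> \<phi>" "\<phi> \<le> 2 * pi" for \<phi>
    using A_strict_mono[of 0 \<phi>] A_strict_mono[of \<phi> "2 * pi"] that A_0 A_2pi
    by (cases "\<phi> = 0"; cases "\<phi> = 2 * pi"; force)+
  then show "(\<lambda>\<phi>. 2 * A \<phi>) ` {0..2*pi} \<subseteq> {0..P}" by auto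
  show "{0..P} \<subseteq> (\<lambda>\<phi>. 2 * A \<phi>) ` {0..2*pi}"
  proof
    fix s assume "s \<in> {0..P}"
    then obtain \<phi> where "0 \<le> \<phi>" "\<phi> \<le> 2 * pi" "2 * A \<phi> = s"
      using IVT'[of "\<lambda>\<phi>. 2 * A \<phi>" 0 s "2 * pi"] A_0 A_2pi double_A_continuous by auto
    then show "s \<in> (\<lambda>\<phi>. 2 * A \<phi>) ` {0..2*pi}" by auto
  qed
qed

lemma angle_A: "\<phi> \<in> {0..2*pi} \<Longrightarrow> angle (2 * A \<phi>) = \<phi>"
  unfolding angle_def using A_inj by (rule the_inv_into_f_f)

lemma angle_range_A:
  assumes "s \<in> {0..P}"
  shows "angle s \<in> {0..2*pi} \<and> 2 * A (angle s) = s"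
proof -
  obtain \<phi> where \<phi>: "\<phi> \<in> {0..2*pi}" "s = 2 * A \<phi>"
    using assms unfolding A_image[symmetric] by blast
  show ?thesis unfolding \<phi>(2) angle_A[OF \<phi>(1)] using \<phi>(1) by simp
qed

lemmas angle_range = angle_range_A[THEN conjunct1] and A_angle = angle_range_A[THEN conjunct2]

lemma angle_continuous: "continuous_on {0..P} angle"
  unfolding A_image[symmetric]
  by (rule continuous_on_inv[OF double_A_continuous compact_Icc]) (rule ballI, rule angle_A)

text \<open>The floor term brings the argument back to \<open>s\<close>, and strict monotonicity of
  \<open>A\<close> determines the polar angle. The bound \<open>s < P\<close> keeps this angle below
  \<open>2 * pi\<close>, as the description in \<open>gen_pt\<close> demands.\<close>

lemma gen_pt_eq:
  assumes s: "0 \<le> s" "s < P"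
  shows "gen_pt \<Omega> (s + P * of_int k) = radial (cis (angle s))"
proof -
  have ang: "angle s \<in> {0..2*pi}" "2 * A (angle s) = s" using angle_range[of s] A_angle[of s] s by simp_all
  have ne: "angle s \<noteq> 2 * pi" using ang(2) s A_2pi by auto
  have "(s + P * of_int k) / P = s / P + of_int k" using area_pos by (simp add: add_divide_distrib)
  moreover have "0 \<le> s / P" "s / P < 1" using s area_pos by auto
  ultimately have "\<lfloor>(s + P * of_int k) / P\<rfloor> = k" by linarith
  then have fl: "s + P * of_int k - 2 * area \<Omega> * of_int \<lfloor>(s + P * of_int k) / (2 * area \<Omega>)\<rfloor> = s" by simp
  show ?thesis
    unfolding gen_pt_def fl
  proof (rule the_equality)
    obtain r where r: "r > 0" "radial (cis (angle s)) = of_real r * cis (angle s)"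
      using radial(2)[of "cis (angle s)"] by auto
    show "radial (cis (angle s)) \<in> frontier \<Omega> \<and> (\<exists>\<phi> r. 0 \<le> \<phi> \<and> \<phi> < 2 * pi \<and> 0 < r \<and>
        radial (cis (angle s)) = of_real r * cis \<phi> \<and> 2 * measure lebesgue (sector \<Omega> \<phi>) = s)"
      unfolding sector_eq_wedge A_def[symmetric] using radial(1)[of "cis (angle s)"] r ang ne
      by (intro conjI exI[of _ "angle s"] exI[of _ r]) auto
  next
    fix z assume "z \<in> frontier \<Omega> \<and> (\<exists>\<phi> r. 0 \<le> \<phi> \<and> \<phi> < 2 * pi \<and> 0 < r \<and>
        z = of_real r * cis \<phi> \<and> 2 * measure lebesgue (sector \<Omega> \<phi>) = s)"
    then obtain \<phi> r where *: "z \<in> frontier \<Omega>" "0 \<le> \<phi>" "\<phi> < 2 * pi" "0 < r" "z = of_real r * cis \<phi>" "2 * A \<phi> = s"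
      by (auto simp: sector_eq_wedge A_def)
    then have "angle s = \<phi>" using angle_A[of \<phi>] by auto
    then show "z = radial (cis (angle s))" using radial_eq[of r \<phi>] * by simp
  qed
qed

lemma gen_pt_reduce:
  obtains s k where "0 \<le> s" "s < P" "t = s + P * of_int k"
proof -
  define k where "k = \<lfloor>t / P\<rfloor>"
  have "of_int k \<le> t / P" "t / P < of_int k + 1" unfolding k_def by linarith+
  then have "P * of_int k \<le> P * (t / P)" "P * (t / P) < P * (of_int k + 1)"
    using area_pos by (auto intro: mult_left_mono mult_strict_left_mono simp del: times_divide_eq_right)
  moreover have "P * (t / P) = t" using area_pos by simp
  moreover have "P * (of_int k + 1) = P * of_int k + P" by (simp add: distrib_left)
  ultimately show ?thesis by (intro that[of "t - P * of_int k" k]) linarith+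
qed

text \<open>At \<open>s = P\<close> the angles 0 and \<open>2 * pi\<close> give the same boundary
  point; closed period intervals are what the gluing for continuity uses.\<close>

lemma gen_pt_Icc:
  assumes s: "0 \<le> s" "s \<le> P"
  shows "gen_pt \<Omega> (s + P * of_int k) = radial (cis (angle s))"
proof (cases "s = P")
  case False
  then show ?thesis using gen_pt_eq s by simp
next
  case True
  have "angle P = 2 * pi" using angle_A[of "2 * pi"] A_2pi by simp
  moreover have "angle 0 = 0" using angle_A[of 0] A_0 by simp
  ultimately have "radial (cis (angle P)) = radial (cis (angle 0))" by simp
  moreover have "s + P * of_int k = 0 + P * of_int (k + 1)" using True by (simp add: algebra_simps)
  ultimately show ?thesis using gen_pt_eq[of 0 "k + 1"] area_pos True by simp
qed

lemma gen_pt_continuous: "continuous_on UNIV (gen_pt \<Omega>)"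
proof -
  have base: "continuous_on {0..P} (\<lambda>s. radial (cis (angle s)))"
    by (rule continuous_on_compose2[OF radial_continuous])
      (auto intro!: continuous_intros angle_continuous simp: cis.code continuous_on_Complex)
  have piece: "continuous_on {P * of_int k..P * of_int k + P} (gen_pt \<Omega>)" for k
  proof -
    have "continuous_on {P * of_int k..P * of_int k + P} (\<lambda>t. radial (cis (angle (t - P * of_int k))))"
      by (rule continuous_on_compose2[OF base]) (auto intro!: continuous_intros)
    then show ?thesis
    proof (rule continuous_on_eq)
      fix t assume "t \<in> {P * of_int k..P * of_int k + P}"
      then show "radial (cis (angle (t - P * of_int k))) = gen_pt \<Omega> t"
        using gen_pt_Icc[of "t - P * of_int k" k] by auto
    qed
  qed
  have "isCont (gen_pt \<Omega>) t" for t
  proof -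
    obtain s k where sk: "0 \<le> s" "s < P" "t = s + P * of_int k" using gen_pt_reduce .
    \<comment> \<open>Two adjacent period intervals, so that \<open>t\<close> is interior to their
      union even when it is a multiple of \<open>P\<close>.\<close>
    let ?a = "P * of_int (k - 1)" and ?b = "P * of_int k" and ?c = "P * of_int k + P"
    have eq: "?a + P = ?b" by (simp add: algebra_simps)
    have "continuous_on ({?a..?b} \<union> {?b..?c}) (gen_pt \<Omega>)"
      using piece[of "k - 1"] piece[of k] unfolding eq by (intro continuous_on_closed_Un) auto
    moreover have "t \<in> interior ({?a..?b} \<union> {?b..?c})"
    proof -
      have "{?a<..<?c} \<subseteq> {?a..?b} \<union> {?b..?c}" by auto
      moreover have "t \<in> {?a<..<?c}" using sk area_pos eq by auto
      ultimately show ?thesis by (meson interiorI open_greaterThanLessThan)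
    qed
    ultimately show ?thesis by (rule continuous_on_interior)
  qed
  then show ?thesis by (simp add: continuous_on_eq_continuous_at)
qed

lemma gen_pt_periodic: "gen_pt \<Omega> (t + P) = gen_pt \<Omega> t"
proof -
  obtain s k where sk: "0 \<le> s" "s < P" "t = s + P * of_int k" using gen_pt_reduce .
  have "t + P = s + P * of_int (k + 1)" using sk by (simp add: algebra_simps)
  then show ?thesis using gen_pt_eq[OF sk(1,2)] sk(3) by metis
qed

lemma gen_pt_frontier: "gen_pt \<Omega> t \<in> frontier \<Omega>"
proof -
  obtain s k where sk: "0 \<le> s" "s < P" "t = s + P * of_int k" using gen_pt_reduce .
  show ?thesis unfolding sk(3) gen_pt_eq[OF sk(1,2)] by (rule radial(1)) simp
qed

lemma gen_pt_inj:
  assumes "gen_pt \<Omega> t = gen_pt \<Omega> t'"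
  shows "\<exists>k::int. t' = t + P * of_int k"
proof -
  obtain s k where sk: "0 \<le> s" "s < P" "t = s + P * of_int k" using gen_pt_reduce .
  obtain s' k' where sk': "0 \<le> s'" "s' < P" "t' = s' + P * of_int k'" using gen_pt_reduce .
  have eq: "radial (cis (angle s)) = radial (cis (angle s'))"
    using assms gen_pt_eq sk sk' by metis
  obtain r where r: "r > 0" "radial (cis (angle s)) = of_real r * cis (angle s)"
    using radial(2)[of "cis (angle s)"] by auto
  obtain r' where r': "r' > 0" "radial (cis (angle s')) = of_real r' * cis (angle s')"
    using radial(2)[of "cis (angle s')"] by auto
  have "cis (angle s) = cis (angle s')"
    using polar_unique(2)[of r "angle s" r' "angle s'"] r r' eq by simp
  moreover have "angle s \<in> {0..2*pi}" "angle s' \<in> {0..2*pi}" "angle s \<noteq> 2 * pi" "angle s' \<noteq> 2 * pi"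
    using angle_range[of s] angle_range[of s'] A_angle[of s] A_angle[of s'] A_2pi sk sk' by auto
  then have "\<bar>angle s - angle s'\<bar> < 2 * pi" by auto
  ultimately have "angle s = angle s'" by (rule cis_eq_imp)
  moreover have "2 * A (angle s) = s" "2 * A (angle s') = s'"
    using sk sk' by (intro A_angle; simp)+
  ultimately have "s = s'" by metis
  then show ?thesis using sk sk' by (intro exI[of _ "k' - k"]) (simp add: algebra_simps)
qed

end

lemma strictly_convex_body_rot:
  assumes "strictly_convex_body \<Omega>"
  shows "strictly_convex_body (rot \<alpha> \<Omega>)"
proof -
  interpret strictly_convex_body \<Omega> by fact
  let ?R = "\<lambda>z. cis (- \<alpha>) * z"
  have lin: "linear ?R" by (rule linear_times)
  have inj: "inj ?R" by (rule injI) auto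
  have int: "interior (?R ` \<Omega>) = ?R ` interior \<Omega>"
    using interior_injective_linear_image[OF lin inj] .
  show ?thesis
  proof
    show "compact (rot \<alpha> \<Omega>)"
      unfolding rot_def by (intro compact_continuous_image continuous_intros compact)
    show "convex (rot \<alpha> \<Omega>)"
      unfolding rot_def by (rule convex_linear_image[OF lin conv])
    show "0 \<in> interior (rot \<alpha> \<Omega>)"
      unfolding rot_def int using zero by (auto intro!: image_eqI[of _ _ 0])
    show "strictly_convex_set (rot \<alpha> \<Omega>)"
      unfolding strictly_convex_set_def
    proof (intro conjI ballI impI allI)
      show "convex (rot \<alpha> \<Omega>)" by fact
      fix x y and u :: real assume *: "x \<in> rot \<alpha> \<Omega>" "y \<in> rot \<alpha> \<Omega>" "x \<noteq> y" "0 < u \<and> u < 1"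
      then obtain x' y' where xy: "x' \<in> \<Omega>" "y' \<in> \<Omega>" "x = ?R x'" "y = ?R y'" by (auto simp: rot_def)
      then have "(1 - u) *\<^sub>R x' + u *\<^sub>R y' \<in> interior \<Omega>"
        using strict[unfolded strictly_convex_set_def, THEN conjunct2, rule_format, OF xy(1,2)] * xy(3,4) by auto
      moreover have "(1 - u) *\<^sub>R x + u *\<^sub>R y = ?R ((1 - u) *\<^sub>R x' + u *\<^sub>R y')"
        using xy by (simp add: algebra_simps)
      ultimately show "(1 - u) *\<^sub>R x + u *\<^sub>R y \<in> interior (rot \<alpha> \<Omega>)"
        unfolding rot_def int by (metis image_eqI)
    qed
  qed
qed

subsection \<open>From paths to controls\<close>

text \<open>Adding 1 makes \<open>f\<close> nonnegative and hence absolutely integrable. The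
  measures with densities \<open>f + 1\<close> and \<open>\<sigma> + 1\<close> on
  \<open>{x..y}\<close> agree on all half-lines, so they coincide, and densities are unique almost
  everywhere.\<close>

lemma AE_eq_const:
  fixes f :: "real \<Rightarrow> real"
  assumes f: "f integrable_on {x..y}" and bd: "\<And>t. t \<in> {x..y} \<Longrightarrow> \<bar>f t\<bar> \<le> 1" and \<sigma>: "\<bar>\<sigma>\<bar> \<le> 1"
    and int: "\<And>t. t \<in> {x..y} \<Longrightarrow> integral {x..t} f = \<sigma> * (t - x)" and xy: "x \<le> y"
  shows "AE t in lborel. x < t \<and> t < y \<longrightarrow> f t = \<sigma>"
proof -
  let ?g = "\<lambda>t. f t + 1"
  let ?I = "indicator {x..y} :: real \<Rightarrow> real"
  have g: "?g integrable_on {x..y}" using f by (intro integrable_add) auto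
  have g0: "0 \<le> ?g t" if "t \<in> {x..y}" for t using bd[OF that] by auto
  have "set_integrable lebesgue {x..y} ?g"
    using g g0 by (rule nonnegative_absolutely_integrable_1)
  then have meas: "(\<lambda>t. ?I t * ?g t) \<in> borel_measurable lebesgue"
    by (simp add: set_integrable_def borel_measurable_integrable)
  \<comment> \<open>A density over \<open>lborel\<close> has to be Borel; \<open>g'\<close> is a
    Borel version of \<open>f + 1\<close> cut off to \<open>{x..y}\<close>.\<close>
  obtain g' where g': "g' \<in> borel_measurable lborel" "AE t in lborel. ?I t * ?g t = g' t"
    using completion_ex_borel_measurable_real[OF meas] by blast
  define M1 where "M1 = density lborel (\<lambda>t. ennreal (g' t))"
  define M2 where "M2 = density lborel (\<lambda>t. ennreal ((\<sigma> + 1) * ?I t))"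
  have val: "emeasure M1 {s<..} = ennreal ((\<sigma> + 1) * (y - min y (max x s))) \<and>
    emeasure M2 {s<..} = ennreal ((\<sigma> + 1) * (y - min y (max x s)))" for s
  proof -
    \<comment> \<open>The cut point \<open>s\<close> clamped to \<open>{x..y}\<close>.\<close>
    define m where "m = min y (max x s)"
    have m: "x \<le> m" "m \<le> y" using xy by (auto simp: m_def)
    have hi: "(h has_integral integral {m..y} h) ({x..y} \<inter> {s<..})" if "h integrable_on {x..y}" for h :: "real \<Rightarrow> real"
    proof -
      have h: "(h has_integral integral {m..y} h) {m..y}"
        using that m by (intro integrable_integral integrable_on_subinterval[OF that]) auto
      have "negligible ({m, y} :: real set)" by (rule negligible_finite) auto
      then have "(h has_integral integral {m..y} h) ({x..y} \<inter> {s<..}) \<longleftrightarrow> (h has_integral integral {m..y} h) {m..y}"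
        by (intro has_integral_spike_set_eq; rule negligible_subset) (auto simp: m_def min_def max_def)
      then show ?thesis using h by blast
    qed
    have emb: "emeasure (density lborel (\<lambda>t. ennreal (h' t))) {s<..} = ennreal (integral {m..y} h)"
      if h': "h' \<in> borel_measurable lborel" "AE t in lborel. ?I t * h t = h' t"
        and h: "h integrable_on {x..y}" "\<And>t. t \<in> {x..y} \<Longrightarrow> 0 \<le> h t" for h h' :: "real \<Rightarrow> real"
    proof -
      have "emeasure (density lborel (\<lambda>t. ennreal (h' t))) {s<..} = (\<integral>\<^sup>+t. ennreal (h' t) * indicator {s<..} t \<partial>lborel)"
        using h'(1) by (intro emeasure_density) auto
      also have "\<dots> = (\<integral>\<^sup>+t. ennreal (indicator ({x..y} \<inter> {s<..}) t * h t) \<partial>lborel)"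
        using h'(2) by (intro nn_integral_cong_AE) (elim eventually_mono, auto simp: indicator_def)
      also have "\<dots> = ennreal (integral {m..y} h)"
        using hi[OF h(1)] h(2) by (intro nn_integral_has_integral_lebesgue) auto
      finally show ?thesis .
    qed
    have "integral {x..m} f + integral {m..y} f = integral {x..y} f"
      using m f by (intro Henstock_Kurzweil_Integration.integral_combine) auto
    then have "integral {m..y} f = \<sigma> * (y - m)" using int[of m] int[of y] m by (auto simp: algebra_simps)
    moreover have "f integrable_on {m..y}" using m by (intro integrable_on_subinterval[OF f]) auto
    ultimately have i1: "integral {m..y} ?g = (\<sigma> + 1) * (y - m)"
      using m by (subst integral_add) (auto simp: algebra_simps)
    have i2: "integral {m..y} (\<lambda>t. \<sigma> + 1) = (\<sigma> + 1) * (y - m)"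
      using m by simp
    have "emeasure M1 {s<..} = ennreal ((\<sigma> + 1) * (y - m))"
      unfolding M1_def i1[symmetric] by (rule emb[OF g' g g0])
    moreover have "emeasure M2 {s<..} = ennreal ((\<sigma> + 1) * (y - m))"
      unfolding M2_def i2[symmetric]
      using \<sigma> by (intro emb[of "\<lambda>t. (\<sigma> + 1) * ?I t" "\<lambda>t. \<sigma> + 1"]) (auto simp: mult.commute abs_le_iff)
    ultimately show ?thesis by (simp add: m_def)
  qed
  have "M1 = M2"
    by (rule measure_eqI_lessThan) (use val in \<open>simp_all add: M1_def M2_def\<close>)
  then have "AE t in lborel. ennreal (g' t) = ennreal ((\<sigma> + 1) * ?I t)"
    unfolding M1_def M2_def using g'(1) by (intro sigma_finite_measure.density_unique[OF lborel.sigma_finite_measure_axioms]) auto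
  with g'(2) show ?thesis
  proof eventually_elim
    case (elim t)
    show ?case
    proof
      assume "x < t \<and> t < y"
      then have "ennreal (f t + 1) = ennreal (\<sigma> + 1)" "0 \<le> f t + 1" "0 \<le> \<sigma> + 1"
        using elim g0[of t] \<sigma> by (auto simp: indicator_def)
      then show "f t = \<sigma>" by (simp add: ennreal_inj)
    qed
  qed
qed

section \<open>Paths as lists of constant-velocity pieces\<close>

fun runs :: "(real \<Rightarrow> real) \<Rightarrow> real \<Rightarrow> (real \<times> real) list \<Rightarrow> real \<Rightarrow> bool" where
  "runs \<theta> x [] y \<longleftrightarrow> x = y"
| "runs \<theta> x ((l, v) # ps) y \<longleftrightarrow> arc_on \<theta> v x (x + l) \<and> runs \<theta> (x + l) ps y"

lemma runs_append: "runs \<theta> x ps y \<Longrightarrow> runs \<theta> y qs z \<Longrightarrow> runs \<theta> x (ps @ qs) z"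
  by (induction ps arbitrary: x) auto

lemma runs_end: "runs \<theta> x ps y \<Longrightarrow> y = x + sum_list (map fst ps)"
  by (induction ps arbitrary: x) fastforce+

lemma runs_le: "runs \<theta> x ps y \<Longrightarrow> x \<le> y"
  by (induction ps arbitrary: x) (fastforce simp: arc_on_def)+

lemma runs_nth:
  assumes "runs \<theta> x ps y" "i < length ps"
  shows "arc_on \<theta> (snd (ps ! i)) (x + sum_list (map fst (take i ps))) (x + sum_list (map fst (take (Suc i) ps))) \<and>
    x \<le> x + sum_list (map fst (take i ps)) \<and> x + sum_list (map fst (take (Suc i) ps)) \<le> y"
  using assms
proof (induction ps arbitrary: x i)
  case (Cons a ps)
  obtain l v where a: "a = (l, v)" by (cases a)
  have *: "arc_on \<theta> v x (x + l)" "runs \<theta> (x + l) ps y" using Cons.prems by (auto simp: a)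
  then have l: "0 \<le> l" "x + l \<le> y" using runs_le by (auto simp: arc_on_def)
  show ?case
  proof (cases i)
    case 0
    then show ?thesis using * l by (simp add: a)
  next
    case (Suc j)
    then show ?thesis using Cons.IH[OF *(2), of j] Cons.prems l by (simp add: a add.assoc)
  qed
qed simp

lemma sum_take:
  "i \<le> length ps \<Longrightarrow> (\<Sum>j=1..<Suc i. fst (ps ! (j - 1))) = sum_list (map fst (take i ps))"
  for ps :: "(real \<times> real) list"
  by (induction i) (auto simp: take_Suc_conv_app_nth)

lemma runs_piecewise_const:
  assumes adm: "admissible T u" and runs: "runs (heading \<theta>0 u) 0 ps T"
    and v: "\<And>l v. (l, v) \<in> set ps \<Longrightarrow> \<bar>v\<bar> \<le> 1"
  shows "piecewise_const u T (length ps) (\<lambda>i. fst (ps ! (i - 1))) (\<lambda>i. snd (ps ! (i - 1)))"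
  unfolding piecewise_const_def
proof (intro conjI ballI)
  let ?s = "\<lambda>i. sum_list (map fst (take i ps))"
  have s1: "(\<Sum>j=1..<i. fst (ps ! (j - 1))) = ?s (i - 1)" "(\<Sum>j=1..i. fst (ps ! (j - 1))) = ?s i"
    if i: "i \<in> {1..length ps}" for i
  proof -
    obtain k where k: "i = Suc k" "Suc k \<le> length ps" using i by (cases i) auto
    show "(\<Sum>j=1..<i. fst (ps ! (j - 1))) = ?s (i - 1)"
      using sum_take[of k ps] k by simp
    show "(\<Sum>j=1..i. fst (ps ! (j - 1))) = ?s i"
      using sum_take[of i ps] k by (simp add: atLeastLessThanSuc_atLeastAtMost)
  qed
  show "(\<Sum>i=1..length ps. fst (ps ! (i - 1))) = T"
    using sum_take[of "length ps" ps] runs_end[OF runs] by (simp add: atLeastLessThanSuc_atLeastAtMost)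
  fix i assume i: "i \<in> {1..length ps}"
  then obtain j where j: "i = Suc j" "j < length ps" by (cases i) auto
  have step: "?s (Suc j) = ?s j + fst (ps ! j)" using j by (simp add: take_Suc_conv_app_nth)
  have arc: "arc_on (heading \<theta>0 u) (snd (ps ! j)) (?s j) (?s (Suc j))" "0 \<le> ?s j" "?s (Suc j) \<le> T"
    using runs_nth[OF runs j(2)] by auto
  show "0 \<le> fst (ps ! (i - 1))"
    using arc_on_le[OF arc(1)] step j by simp
  have uT: "u integrable_on {0..T}" "\<And>t. t \<in> {0..T} \<Longrightarrow> \<bar>u t\<bar> \<le> 1"
    using adm by (auto simp: admissible_def)
  have "AE t in lborel. ?s j < t \<and> t < ?s (Suc j) \<longrightarrow> u t = snd (ps ! j)"
  proof (rule AE_eq_const)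
    show "u integrable_on {?s j..?s (Suc j)}"
      using arc by (intro integrable_on_subinterval[OF uT(1)]) auto
    show "\<bar>u t\<bar> \<le> 1" if "t \<in> {?s j..?s (Suc j)}" for t using that arc uT(2)[of t] by auto
    show "\<bar>snd (ps ! j)\<bar> \<le> 1" using v[of "fst (ps ! j)" "snd (ps ! j)"] j by auto
    show "?s j \<le> ?s (Suc j)" by (rule arc_on_le[OF arc(1)])
    fix t assume t: "t \<in> {?s j..?s (Suc j)}"
    have "integral {0..?s j} u + integral {?s j..t} u = integral {0..t} u"
      using t arc by (intro Henstock_Kurzweil_Integration.integral_combine integrable_on_subinterval[OF uT(1)]) auto
    moreover have "heading \<theta>0 u t - heading \<theta>0 u (?s j) = snd (ps ! j) * (t - ?s j)"
      using arc(1) t unfolding arc_on_def by auto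
    ultimately show "integral {?s j..t} u = snd (ps ! j) * (t - ?s j)" by (simp add: heading_def)
  qed
  then show "AE t in lborel. (\<Sum>j=1..<i. fst (ps ! (j - 1))) < t \<and> t < (\<Sum>j=1..i. fst (ps ! (j - 1))) \<longrightarrow> u t = snd (ps ! (i - 1))"
    unfolding s1[OF i] using j by simp
qed

text \<open>Meant to follow the first arc: position \<open>j\<close> here, counted from 0, becomes
  number \<open>j + 2\<close> of the control, so straight pieces get even numbers and full loops odd
  ones. Straight pieces may have length 0.\<close>

definition alternating :: "real \<Rightarrow> (real \<times> real) list \<Rightarrow> bool" where
  "alternating P ps \<longleftrightarrow> odd (length ps) \<and> (\<forall>j<length ps. (even j \<longrightarrow> snd (ps ! j) = 0) \<and>
     (odd j \<longrightarrow> fst (ps ! j) = P \<and> snd (ps ! j) \<in> {-1, 1}))"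

text \<open>The list is built from right to left in front of an already coded tail: a rest merges
  with the leading rest of the tail, and a loop is preceded by a rest of length 0.\<close>

lemma loops_runs:
  assumes "loops P \<theta> x y" "alternating P ps" "runs \<theta> y ps z"
  shows "\<exists>qs. alternating P qs \<and> runs \<theta> x qs z"
  using assms
proof (induction arbitrary: ps rule: loops.induct)
  case (rest x y)
  obtain r v ps' where ps: "ps = (r, v) # ps'"
    using rest.prems(1) by (cases ps) (auto simp: alternating_def)
  have v: "v = 0" using rest.prems(1) by (auto simp: alternating_def ps dest: spec[of _ 0])
  have "alternating P ((y - x + r, 0) # ps')"
    using rest.prems(1) by (auto simp: alternating_def ps v nth_Cons split: nat.splits)
  moreover have "runs \<theta> x ((y - x + r, 0) # ps') z"
    using rest.prems(2) arc_on_join[OF rest.hyps, of "y + r"] by (simp add: ps v)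
  ultimately show ?case by blast
next
  case (loop \<sigma> x)
  have "alternating P ((0, 0) # (P, \<sigma>) # ps)"
    using loop.prems(1) loop.hyps(1) by (auto simp: alternating_def nth_Cons split: nat.splits)
  moreover have "runs \<theta> x ((0, 0) # (P, \<sigma>) # ps) z"
    using loop.prems(2) loop.hyps(2) by (simp add: arc_on_refl)
  ultimately show ?case by blast
next
  case (trans x y z')
  then show ?case by blast
qed

lemma path_type_a_imp:
  assumes adm: "admissible T u" and a: "path_type_a (2 * S) (heading \<theta>0 u) T"
  shows "\<exists>n L v. piecewise_const u T n L v \<and> type_a S n L v"
proof -
  let ?\<theta> = "heading \<theta>0 u"
  obtain \<sigma> \<tau> x y where *: "\<sigma> = 1 \<or> \<sigma> = -1" "\<tau> = 1 \<or> \<tau> = -1" "arc_on ?\<theta> \<sigma> 0 x" "x \<le> 2 * S"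
    "loops (2 * S) ?\<theta> x y" "arc_on ?\<theta> \<tau> y T" "T - y \<le> 2 * S"
    using a unfolding path_type_a_def by blast
  have "alternating (2 * S) [(0, 0)]" "runs ?\<theta> y [(0, 0)] y"
    by (auto simp: alternating_def arc_on_refl)
  then obtain qs where qs: "alternating (2 * S) qs" "runs ?\<theta> x qs y"
    using loops_runs[OF *(5)] by blast
  \<comment> \<open>As \<open>qs\<close> has odd length, the last arc receives an odd number, as
    type (a) requires.\<close>
  define ps where "ps = (x, \<sigma>) # qs @ [(T - y, \<tau>)]"
  have len: "length ps = length qs + 2" by (simp add: ps_def)
  have runs: "runs ?\<theta> 0 ps T"
    unfolding ps_def using * qs by (auto intro!: runs_append)
  have nth: "ps ! 0 = (x, \<sigma>)" "ps ! Suc (length qs) = (T - y, \<tau>)" "\<And>j. j < length qs \<Longrightarrow> ps ! Suc j = qs ! j"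
    by (auto simp: ps_def nth_append)
  have odd: "odd (length qs)" using qs(1) by (simp add: alternating_def)
  have ev: "snd (qs ! j) = 0" if "j < length qs" "even j" for j
    using qs(1) that by (simp add: alternating_def)
  have od: "fst (qs ! j) = 2 * S" "snd (qs ! j) = -1 \<or> snd (qs ! j) = 1" if "j < length qs" "odd j" for j
    using qs(1) that by (auto simp: alternating_def)
  have pos: "j = 0 \<or> j = Suc (length qs) \<or> (\<exists>k. j = Suc k \<and> k < length qs)" if "j < length ps" for j
    using that len by (cases j) auto
  have vals: "(odd j \<longrightarrow> snd (ps ! j) = 0) \<and> (even j \<longrightarrow> snd (ps ! j) = -1 \<or> snd (ps ! j) = 1) \<and>
     (even j \<longrightarrow> j \<noteq> 0 \<longrightarrow> Suc j \<noteq> length ps \<longrightarrow> fst (ps ! j) = 2 * S)" if "j < length ps" for j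
    using pos[OF that]
  proof (elim disjE exE conjE)
    fix k assume k: "j = Suc k" "k < length qs"
    then have "ps ! j = qs ! k" using nth(3) by simp
    then show ?thesis using ev[OF k(2)] od[OF k(2)] k(1) by auto
  qed (use nth(1,2) odd *(1,2) len in auto)
  have "\<bar>v\<bar> \<le> 1" if lv: "(l, v) \<in> set ps" for l v
  proof -
    obtain j where "j < length ps" "ps ! j = (l, v)" using lv by (auto simp: in_set_conv_nth)
    then show ?thesis using vals[of j] by (cases "even j") auto
  qed
  then have "piecewise_const u T (length ps) (\<lambda>i. fst (ps ! (i - 1))) (\<lambda>i. snd (ps ! (i - 1)))"
    by (intro runs_piecewise_const[OF adm runs]) auto
  moreover have "type_a S (length ps) (\<lambda>i. fst (ps ! (i - 1))) (\<lambda>i. snd (ps ! (i - 1)))"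
    unfolding type_a_def
  proof (intro conjI ballI impI)
    fix i assume "i \<in> {1..length ps}"
    then obtain j where j: "i = Suc j" "j < length ps" by (cases i) auto
    show "snd (ps ! (i - 1)) = 0" if "even i" using vals[OF j(2)] that j(1) by simp
    show "snd (ps ! (i - 1)) \<in> {-1, 1}" if "odd i" using vals[OF j(2)] that j(1) by simp
    show "fst (ps ! (i - 1)) = 2 * S" if "odd i \<and> i \<noteq> 1 \<and> i \<noteq> length ps"
      using vals[OF j(2)] that j(1) by simp
  next
    show "fst (ps ! (1 - 1)) \<le> 2 * S" using nth(1) *(4) by simp
    show "fst (ps ! (length ps - 1)) \<le> 2 * S" using nth(2) *(7) len by simp
  qed
  ultimately show ?thesis by blast
qed

lemma path_type_b_imp:
  assumes adm: "admissible T u" and b: "path_type_b (2 * S) (heading \<theta>0 u) T"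
  shows "\<exists>n L v. piecewise_const u T n L v \<and> type_b S n L v"
proof -
  let ?\<theta> = "heading \<theta>0 u"
  obtain \<sigma> x y where *: "\<sigma> = 1 \<or> \<sigma> = -1" "arc_on ?\<theta> \<sigma> 0 x" "arc_on ?\<theta> (- \<sigma>) x y" "arc_on ?\<theta> \<sigma> y T"
    "x \<le> y - x" "T - y \<le> y - x" "y - x \<le> 2 * S"
    using b unfolding path_type_b_def by blast
  define ps where "ps = [(x, \<sigma>), (y - x, - \<sigma>), (T - y, \<sigma>)]"
  have "piecewise_const u T (length ps) (\<lambda>i. fst (ps ! (i - 1))) (\<lambda>i. snd (ps ! (i - 1)))"
    using * by (intro runs_piecewise_const[OF adm]) (auto simp: ps_def)
  moreover have "type_b S (length ps) (\<lambda>i. fst (ps ! (i - 1))) (\<lambda>i. snd (ps ! (i - 1)))"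
    unfolding type_b_def
  \<comment> \<open>The sign that \<open>type_b\<close> asks for is that of the even-numbered
    pieces, here of the middle arc.\<close>
  proof (intro conjI bexI[of _ "- \<sigma>"] exI[of _ "y - x"] ballI allI impI)
    fix i assume "i \<in> {1..length ps}"
    then have "i = 1 \<or> i = 2 \<or> i = 3" by (auto simp: ps_def)
    then show "snd (ps ! (i - 1)) = (if even i then - \<sigma> else - (- \<sigma>))" by (auto simp: ps_def)
  next
    fix i assume "2 \<le> i \<and> i \<le> length ps - 1"
    then have "i = 2" by (auto simp: ps_def)
    then show "fst (ps ! (i - 1)) = y - x" by (simp add: ps_def)
  qed (use * in \<open>auto simp: ps_def\<close>)
  ultimately show ?thesis by blast
qed

lemma (in strictly_convex_body) sc_curve_gen_pt: "sc_curve (gen_pt \<Omega>) (2 * area \<Omega>) \<Omega>"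
proof
  show "gen_pt \<Omega> s \<in> \<Omega>" "gen_pt \<Omega> s \<notin> interior \<Omega>" for s
    using gen_pt_frontier frontier_subset frontier_disjoint by blast+
qed (use area_pos gen_pt_continuous gen_pt_periodic gen_pt_inj strict in auto)

lemma (in sc_curve) argmax_ex1:
  assumes "\<psi> \<noteq> 0"
  shows "\<exists>!s. 0 \<le> s \<and> s < P \<and> argmax \<psi> s"
proof -
  obtain M where "argmax \<psi> M" using unimodal[OF assms] unfolding argmax_def by metis
  moreover obtain k :: int where "0 \<le> M + P * of_int k" "M + P * of_int k < 0 + P"
    using reduce by blast
  ultimately have ex: "0 \<le> M + P * of_int k \<and> M + P * of_int k < P \<and> argmax \<psi> (M + P * of_int k)"
    by (simp add: argmax_def per_int)
  show ?thesis
  proof (rule ex1I[where a = "M + P * of_int k"], rule ex)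
    fix s assume s: "0 \<le> s \<and> s < P \<and> argmax \<psi> s"
    obtain j :: int where j: "s = (M + P * of_int k) + P * of_int j"
      using argmax_unique[OF assms] ex s by metis
    then have "P * of_int j < P * 1" "P * (-1) < P * of_int j" using s ex by linarith+
    then have "j < 1" "-1 < j" using P_pos by (simp_all only: mult_less_cancel_left_pos)
    then show "s = M + P * of_int k" using j by simp
  qed
qed

text \<open>The functionals -1 and 1 take the values minus and plus the first coordinate, so both
  extrema of \<open>cos_gen\<close> are instances of \<open>argmax\<close>.\<close>

lemma (in strictly_convex_body) extremal_angles_unique:
  "\<exists>!\<theta>. 0 \<le> \<theta> \<and> \<theta> < 2 * area \<Omega> \<and> (\<forall>t. cos_gen \<Omega> \<theta> \<le> cos_gen \<Omega> t)"
  "\<exists>!\<theta>. 0 \<le> \<theta> \<and> \<theta> < 2 * area \<Omega> \<and> (\<forall>t. cos_gen \<Omega> t \<le> cos_gen \<Omega> \<theta>)"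
proof -
  interpret c: sc_curve "gen_pt \<Omega>" "2 * area \<Omega>" \<Omega> by (rule sc_curve_gen_pt)
  show "\<exists>!\<theta>. 0 \<le> \<theta> \<and> \<theta> < 2 * area \<Omega> \<and> (\<forall>t. cos_gen \<Omega> \<theta> \<le> cos_gen \<Omega> t)"
    using c.argmax_ex1[of "-1"] by (simp add: c.argmax_def cos_gen_def inner_complex_def)
  show "\<exists>!\<theta>. 0 \<le> \<theta> \<and> \<theta> < 2 * area \<Omega> \<and> (\<forall>t. cos_gen \<Omega> t \<le> cos_gen \<Omega> \<theta>)"
    using c.argmax_ex1[of 1] by (simp add: c.argmax_def cos_gen_def inner_complex_def)
qed

text \<open>Every \<open>adm_path\<close> that starts at \<open>\<theta>0\<close> is the heading of
  an admissible control, so optimality among controls gives optimality among paths.\<close>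

lemma (in strictly_convex_body) time_optimal_types:
  assumes opt: "time_optimal \<Omega> \<theta>0 p1 \<theta>1 u T"
  shows "\<exists>n L v. piecewise_const u T n L v \<and> (type_a (area \<Omega>) n L v \<or> type_b (area \<Omega>) n L v)"
proof -
  interpret c: sc_curve "gen_pt \<Omega>" "2 * area \<Omega>" \<Omega> by (rule sc_curve_gen_pt)
  have pos: "position \<Omega> \<theta>0 u t = c.disp (heading \<theta>0 u) t" for u t
    by (simp add: position_def c.disp_def cos_gen_def sin_gen_def)
  have adm: "admissible T u" and reach: "reaches \<Omega> \<theta>0 p1 \<theta>1 u T"
    and best: "\<And>u' T'. admissible T' u' \<Longrightarrow> reaches \<Omega> \<theta>0 p1 \<theta>1 u' T' \<Longrightarrow> T \<le> T'"
    using opt by (auto simp: time_optimal_def)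
  have h0: "heading \<theta>0 u 0 = \<theta>0" for u by (simp add: heading_def)
  obtain k0 :: int where k0: "heading \<theta>0 u T = \<theta>1 + 2 * area \<Omega> * of_int k0"
    using reach by (auto simp: reaches_def)
  have "c.optimal (heading \<theta>0 u) T"
    unfolding c.optimal_def
  proof (intro conjI allI impI)
    show "adm_path (heading \<theta>0 u) T"
      using adm unfolding admissible_def adm_path_def by (auto simp: heading_def)
    fix \<theta>' T' and k :: int
    assume *: "adm_path \<theta>' T'" "\<theta>' 0 = heading \<theta>0 u 0" "\<theta>' T' = heading \<theta>0 u T + 2 * area \<Omega> * of_int k"
      "c.disp \<theta>' T' = c.disp (heading \<theta>0 u) T"
    then obtain u' where u': "0 \<le> T'" "u' integrable_on {0..T'}" "\<forall>t\<in>{0..T'}. \<bar>u' t\<bar> \<le> 1"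
      "\<forall>t\<in>{0..T'}. integral {0..t} u' = \<theta>' t - \<theta>' 0"
      unfolding adm_path_def by blast
    have eq: "heading \<theta>0 u' t = \<theta>' t" if "t \<in> {0..T'}" for t
      using u'(4) that *(2) h0 by (simp add: heading_def)
    have "c.disp (heading \<theta>0 u') T' = c.disp \<theta>' T'"
      unfolding c.disp_def by (intro Henstock_Kurzweil_Integration.integral_cong) (simp add: eq)
    then have "position \<Omega> \<theta>0 u' T' = p1"
      using *(4) reach by (simp add: pos reaches_def)
    moreover have "heading \<theta>0 u' T' = \<theta>1 + 2 * area \<Omega> * of_int (k0 + k)"
      using eq[of T'] u'(1) *(3) k0 by (simp add: algebra_simps)
    ultimately have "reaches \<Omega> \<theta>0 p1 \<theta>1 u' T'" unfolding reaches_def by blast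
    moreover have "admissible T' u'" using u' by (simp add: admissible_def)
    ultimately show "T \<le> T'" using best by blast
  qed
  then have "path_type_a (2 * area \<Omega>) (heading \<theta>0 u) T \<or> path_type_b (2 * area \<Omega>) (heading \<theta>0 u) T"
    by (rule c.optimal_types)
  then show ?thesis
    using path_type_a_imp[OF adm] path_type_b_imp[OF adm] by blast
qed

theorem theorem9:
  fixes \<Omega> :: "complex set"
  assumes "compact \<Omega>" and "convex \<Omega>" and "0 \<in> interior \<Omega>"
    and "strictly_convex_set \<Omega>"
  shows "(\<forall>\<alpha>.
           (\<exists>!\<theta>. 0 \<le> \<theta> \<and> \<theta> < 2 * area \<Omega> \<and>
               (\<forall>t. cos_gen (rot \<alpha> \<Omega>) \<theta> \<le> cos_gen (rot \<alpha> \<Omega>) t)) \<and>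
           (\<exists>!\<theta>. 0 \<le> \<theta> \<and> \<theta> < 2 * area \<Omega> \<and>
               (\<forall>t. cos_gen (rot \<alpha> \<Omega>) t \<le> cos_gen (rot \<alpha> \<Omega>) \<theta>))) \<and>
         (\<forall>\<theta>0 p1 \<theta>1 u T. time_optimal \<Omega> \<theta>0 p1 \<theta>1 u T \<longrightarrow>
            (\<exists>n L v. piecewise_const u T n L v \<and>
               (type_a (area \<Omega>) n L v \<or> type_b (area \<Omega>) n L v)))"
proof -
  interpret strictly_convex_body \<Omega> using assms by unfold_locales
  show ?thesis
  proof (intro conjI allI impI)
    fix \<alpha>
    interpret r: strictly_convex_body "rot \<alpha> \<Omega>"
      by (rule strictly_convex_body_rot) unfold_locales
    show "\<exists>!\<theta>. 0 \<le> \<theta> \<and> \<theta> < 2 * area \<Omega> \<and> (\<forall>t. cos_gen (rot \<alpha> \<Omega>) \<theta> \<le> cos_gen (rot \<alpha> \<Omega>) t)"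
      "\<exists>!\<theta>. 0 \<le> \<theta> \<and> \<theta> < 2 * area \<Omega> \<and> (\<forall>t. cos_gen (rot \<alpha> \<Omega>) t \<le> cos_gen (rot \<alpha> \<Omega>) \<theta>)"
      using r.extremal_angles_unique unfolding area_rot[OF assms(1)] by blast+
  qed (rule time_optimal_types)
qed

end
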